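(* Let $\Sigma=\{\sigma_1,\ldots,\sigma_n\}$ be a semigroup of maps on $\{1,\ldots,N\}$, let $V$ be a finite dimensional real vector space, and let $f=f_0+f_1+\ldots\in C^\infty(V^n,V)$ with $f(0)=0$. Let $f_0^S\in L(V^n,V)$ be such that $\gamma_{f_0^S}=\gamma_{f_0}^S$. Let $0\le r<\infty$. Then it can be arranged that the normal form $\overline f=f_0+\overline f_1+\ldots\in C^\infty(V^n,V)$ of $f$ has the special property that the truncated normal form coupled cell map/vector field $\gamma_{f_0+\overline f_1+\ldots+\overline f_r}$ commutes with the continuous family of maps $$t\mapsto e^{t\gamma_{f_0^S}}.$$ That is, there exist subspaces $N^k\subset P^k$ with $N^k\oplus\operatorname{im}\mathrm{ad}^\Sigma_{f_0}|_{P^k}=P^k$ ($1\le k\le r$) and an analytic diffeomorphism between open neighborhoods of $0$ in $V^N$ that conjugates $\gamma_f$ to some $\gamma_{\overline f}$ with $\overline f_k\in N^k$ for $1\le k\le r$ having this property.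
   Context: $N,n\ge 1$ are integers and $\Sigma=\{\sigma_1,\ldots,\sigma_n\}$ is a collection of $n$ distinct maps $\sigma_j:\{1,\ldots,N\}\to\{1,\ldots,N\}$. $\Sigma$ is called a semigroup if for all $1\le j_1,j_2\le n$ there is a unique $1\le j_3\le n$ with $\sigma_{j_1}\circ\sigma_{j_2}=\sigma_{j_3}$. In that case $\widetilde\sigma_j:\{1,\ldots,n\}\to\{1,\ldots,n\}$ is determined by $\sigma_{\widetilde\sigma_j(k)}=\sigma_j\circ\sigma_k$, and $A_{\sigma_j}(X_1,\ldots,X_n)=(X_{\widetilde\sigma_1(j)},\ldots,X_{\widetilde\sigma_n(j)})$ on $V^n$. For $f\in C^\infty(V^n,V)$, $\gamma_f:V^N\to V^N$ is $(\gamma_f)_i(x)=f(x_{\sigma_1(i)},\ldots,x_{\sigma_n(i)})$. With $D_j$ the partial derivative with respect to the $j$-th argument in $V$, $\mathrm{ad}^\Sigma_f(g)=\sum_{j=1}^n D_jf\cdot(g\circ A_{\sigma_j})-D_jg\cdot(f\circ A_{\sigma_j})$. $P^k$ is the space of homogeneous polynomial maps $V^n\to V$ of degree $k+1$, and $L(V^n,V)=P^0$. Expansions $f=f_0+f_1+\ldots$, $\overline f=f_0+\overline f_1+\ldots$ are Taylor expansions at $0$ with $f_k,\overline f_k\in P^k$. $\gamma_{f_0}^S$ denotes the semisimple part of the linear map $\gamma_{f_0}\in L(V^N,V^N)$ in its SN- (Jordan–Chevalley) decomposition. $e^{t\gamma_{f_0^S}}$ is the time-$t$ flow of the linear vector field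 $\gamma_{f_0^S}$ on $V^N$. *)

theory Defs
  imports "HOL-Analysis.Analysis" "HOL-Library.Function_Algebras"
begin

text \<open>
  \<open>V\<close> is a type \<open>'a :: euclidean_space\<close> (its inner product plays no role). \<open>V\<^sup>n\<close> and \<open>V\<^sup>N\<close> are
  \<open>'a ^ 'n\<close> and \<open>'a ^ 'm\<close>, where the finite types \<open>'n\<close> and \<open>'m\<close> stand for the index sets
  \<open>{1,\<dots>,n}\<close> and \<open>{1,\<dots>,N}\<close>. The collection \<open>\<Sigma>\<close> is an injective family \<open>\<sigma> :: 'n \<Rightarrow> 'm \<Rightarrow> 'm\<close>.
\<close>

text \<open>
  Functions into a real vector space form a real vector space, so that \<open>subspace\<close> applies to sets
  of polynomial maps.
\<close>

instantiation "fun" :: (type, real_vector) real_vector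
begin

definition "scaleR c f = (\<lambda>x. c *\<^sub>R f x)"

instance
  by standard (auto simp: scaleR_fun_def fun_eq_iff algebra_simps)

end


subsection \<open>Semigroup coupled cell networks\<close>

definition map_semigroup :: "('n \<Rightarrow> 'm \<Rightarrow> 'm) \<Rightarrow> bool" where
  "map_semigroup \<sigma> \<longleftrightarrow> (\<forall>j1 j2. \<exists>!j3. \<sigma> j1 \<circ> \<sigma> j2 = \<sigma> j3)"

definition sigma_tilde :: "('n \<Rightarrow> 'm \<Rightarrow> 'm) \<Rightarrow> 'n \<Rightarrow> 'n \<Rightarrow> 'n" where
  "sigma_tilde \<sigma> j k = (THE l. \<sigma> l = \<sigma> j \<circ> \<sigma> k)"

definition input_map :: "('n::finite \<Rightarrow> 'm \<Rightarrow> 'm) \<Rightarrow> 'n \<Rightarrow> 'a ^ 'n \<Rightarrow> 'a ^ 'n" where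
  "input_map \<sigma> j X = (\<chi> i. X $ sigma_tilde \<sigma> i j)"

definition gamma :: "('n::finite \<Rightarrow> 'm::finite \<Rightarrow> 'm) \<Rightarrow> ('a ^ 'n \<Rightarrow> 'a) \<Rightarrow> 'a ^ 'm \<Rightarrow> 'a ^ 'm" where
  "gamma \<sigma> f x = (\<chi> i. f (\<chi> j. x $ \<sigma> j i))"

definition partial_D ::
  "'n::finite \<Rightarrow> ('a::real_normed_vector ^ 'n \<Rightarrow> 'b::real_normed_vector) \<Rightarrow> 'a ^ 'n \<Rightarrow> 'a \<Rightarrow> 'b" where
  "partial_D j f X =
    frechet_derivative (\<lambda>v. f (\<chi> i. if i = j then v else X $ i)) (at (X $ j))"

definition ad ::
  "('n::finite \<Rightarrow> 'm \<Rightarrow> 'm) \<Rightarrow> ('a::real_normed_vector ^ 'n \<Rightarrow> 'a) \<Rightarrow> ('a ^ 'n \<Rightarrow> 'a) \<Rightarrow> 'a ^ 'n \<Rightarrow> 'a" where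
  "ad \<sigma> f g X = (\<Sum>j\<in>UNIV. partial_D j f X (g (input_map \<sigma> j X))
                       - partial_D j g X (f (input_map \<sigma> j X)))"


subsection \<open>Smoothness, homogeneous polynomials, Taylor expansions, analyticity\<close>

text \<open>
  In finite dimension, \<open>f\<close> is \<open>C\<^sup>k\<^sup>+\<^sup>1\<close> iff it is differentiable and all its directional
  derivatives are \<open>C\<^sup>k\<close>.
\<close>

primrec C_k :: "nat \<Rightarrow> ('a::real_normed_vector \<Rightarrow> 'b::real_normed_vector) \<Rightarrow> bool" where
  "C_k 0 f \<longleftrightarrow> continuous_on UNIV f"
| "C_k (Suc k) f \<longleftrightarrow> (\<forall>x. f differentiable (at x)) \<and>
     (\<forall>v. C_k k (\<lambda>x. frechet_derivative f (at x) v))"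

definition smooth :: "('a::real_normed_vector \<Rightarrow> 'b::real_normed_vector) \<Rightarrow> bool" where
  "smooth f \<longleftrightarrow> (\<forall>k. C_k k f)"

definition homogeneous_polynomial ::
  "nat \<Rightarrow> ('a::real_normed_vector \<Rightarrow> 'b::real_normed_vector) \<Rightarrow> bool" where
  "homogeneous_polynomial d p \<longleftrightarrow>
     polynomial_function p \<and> (\<forall>c x. p (c *\<^sub>R x) = c ^ d *\<^sub>R p x)"

text \<open>Note the index shift: elements of \<open>P k\<close> have degree \<open>k + 1\<close>.\<close>

definition P :: "nat \<Rightarrow> ('a::real_normed_vector \<Rightarrow> 'b::real_normed_vector) set" where
  "P k = {p. homogeneous_polynomial (Suc k) p}"

definition dir_deriv ::
  "'a::real_normed_vector \<Rightarrow> ('a \<Rightarrow> 'b::real_normed_vector) \<Rightarrow> 'a \<Rightarrow> 'b" where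
  "dir_deriv v f x = frechet_derivative f (at x) v"

text \<open>
  The component \<open>f\<^sub>k\<close> of degree \<open>k + 1\<close> in the Taylor expansion \<open>f = f\<^sub>0 + f\<^sub>1 + \<dots>\<close> at 0 of a map
  with \<open>f 0 = 0\<close>, i.e. \<open>f\<^sub>k X = D\<^sup>k\<^sup>+\<^sup>1 f(0)(X,\<dots>,X) / (k+1)!\<close>.
\<close>

definition taylor_part ::
  "nat \<Rightarrow> ('a::real_normed_vector \<Rightarrow> 'b::real_normed_vector) \<Rightarrow> 'a \<Rightarrow> 'b" where
  "taylor_part k f X = (1 / fact (Suc k)) *\<^sub>R ((dir_deriv X ^^ Suc k) f 0)"

text \<open>
  Real analyticity: near each point, the map is the uniform sum of a series of homogeneous
  polynomials in the displacement.
\<close>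

definition real_analytic_on ::
  "('a::real_normed_vector \<Rightarrow> 'b::real_normed_vector) \<Rightarrow> 'a set \<Rightarrow> bool" where
  "real_analytic_on F U \<longleftrightarrow>
     (\<forall>a\<in>U. \<exists>e>0. \<exists>p. (\<forall>k. homogeneous_polynomial k (p k)) \<and>
        uniform_limit (ball 0 e) (\<lambda>n h. \<Sum>k<n. p k h) (\<lambda>h. F (a + h)) sequentially)"

definition analytic_diffeomorphism ::
  "('a::real_normed_vector \<Rightarrow> 'b::real_normed_vector) \<Rightarrow> 'a set \<Rightarrow> 'b set \<Rightarrow> bool" where
  "analytic_diffeomorphism \<Phi> U W \<longleftrightarrow>
     open U \<and> open W \<and> bij_betw \<Phi> U W \<and>
     real_analytic_on \<Phi> U \<and> real_analytic_on (inv_into U \<Phi>) W"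

text \<open>
  Conjugacy of vector fields: \<open>\<Phi>\<close> sends \<open>X\<close> to \<open>Y\<close>. This is the notion of conjugacy to which the
  operators \<open>ad\<close>, which come from the Lie bracket of vector fields, belong.
\<close>

definition conjugates_vector_field ::
  "('a::real_normed_vector \<Rightarrow> 'b::real_normed_vector) \<Rightarrow> 'a set \<Rightarrow> ('a \<Rightarrow> 'a) \<Rightarrow> ('b \<Rightarrow> 'b) \<Rightarrow> bool" where
  "conjugates_vector_field \<Phi> U X Y \<longleftrightarrow>
     (\<forall>x\<in>U. frechet_derivative \<Phi> (at x) (X x) = Y (\<Phi> x))"


subsection \<open>Linear algebra\<close>

definition is_direct_sum :: "'v::real_vector set \<Rightarrow> 'v set \<Rightarrow> 'v set \<Rightarrow> bool" where
  "is_direct_sum M I E \<longleftrightarrow> M \<inter> I = {0} \<and> {u + v | u v. u \<in> M \<and> v \<in> I} = E"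

definition semisimple_map :: "('v::real_vector \<Rightarrow> 'v) \<Rightarrow> bool" where
  "semisimple_map S \<longleftrightarrow> linear S \<and>
     (\<forall>U. subspace U \<and> S ` U \<subseteq> U \<longrightarrow>
        (\<exists>W. subspace W \<and> S ` W \<subseteq> W \<and> is_direct_sum U W UNIV))"

definition nilpotent_map :: "('v::real_vector \<Rightarrow> 'v) \<Rightarrow> bool" where
  "nilpotent_map T \<longleftrightarrow> linear T \<and> (\<exists>k. \<forall>x. (T ^^ k) x = 0)"

text \<open>\<open>S\<close> is the (unique) semisimple part of \<open>A\<close> in its SN-decomposition \<open>A = S + T\<close>.\<close>

definition is_semisimple_part :: "('v::real_vector \<Rightarrow> 'v) \<Rightarrow> ('v \<Rightarrow> 'v) \<Rightarrow> bool" where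
  "is_semisimple_part A S \<longleftrightarrow>
     (\<exists>T. semisimple_map S \<and> nilpotent_map T \<and> (\<forall>x. A x = S x + T x) \<and> S \<circ> T = T \<circ> S)"

text \<open>
  The operator exponential \<open>e\<^sup>t\<^sup>A\<close>; the two lemmas below identify it with the flow of the linear
  vector field \<open>A\<close>.
\<close>

definition exp_map :: "real \<Rightarrow> ('v::real_normed_vector \<Rightarrow> 'v) \<Rightarrow> 'v \<Rightarrow> 'v" where
  "exp_map t A x = (\<Sum>k. (t ^ k / fact k) *\<^sub>R (A ^^ k) x)"

lemma funpow_linear_bound:
  fixes A :: "'v::euclidean_space \<Rightarrow> 'v"
  assumes "linear A"
  obtains K where "K > 0" "\<And>k x. norm ((A ^^ k) x) \<le> K ^ k * norm x"
proof -
  from linear_bounded_pos[OF assms] obtain K where K: "K > 0" "\<And>x. norm (A x) \<le> K * norm x"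
    by blast
  have "norm ((A ^^ k) x) \<le> K ^ k * norm x" for k x
  proof (induction k)
    case (Suc k)
    have "norm ((A ^^ Suc k) x) \<le> K * norm ((A ^^ k) x)" using K(2) by simp
    also have "\<dots> \<le> K * (K ^ k * norm x)" using Suc K(1) by (intro mult_left_mono) auto
    finally show ?case by (simp add: mult.assoc)
  qed simp
  with K(1) that show thesis by blast
qed

lemma summable_exp_map:
  fixes A :: "'v::euclidean_space \<Rightarrow> 'v"
  assumes "linear A"
  shows "summable (\<lambda>k. (t ^ k / fact k) *\<^sub>R (A ^^ k) x)"
proof -
  obtain K where K: "K > 0" "\<And>k x. norm ((A ^^ k) x) \<le> K ^ k * norm x"
    using funpow_linear_bound[OF assms] by blast
  have s: "summable (\<lambda>k. (\<bar>t\<bar> * K) ^ k /\<^sub>R fact k * norm x)"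
    using summable_exp_generic[of "\<bar>t\<bar> * K"] by (intro summable_mult2)
  show ?thesis
  proof (rule summable_comparison_test'[OF s])
    fix k :: nat
    have "norm ((t ^ k / fact k) *\<^sub>R (A ^^ k) x) = \<bar>t\<bar> ^ k / fact k * norm ((A ^^ k) x)"
      by (simp add: power_abs)
    also have "\<dots> \<le> \<bar>t\<bar> ^ k / fact k * (K ^ k * norm x)"
      using K(2) by (intro mult_left_mono) auto
    also have "\<dots> = (\<bar>t\<bar> * K) ^ k /\<^sub>R fact k * norm x"
      by (simp add: power_mult_distrib field_simps)
    finally show "norm ((t ^ k / fact k) *\<^sub>R (A ^^ k) x) \<le> (\<bar>t\<bar> * K) ^ k /\<^sub>R fact k * norm x" .
  qed
qed

lemma exp_map_flow:
  fixes A :: "'v::euclidean_space \<Rightarrow> 'v"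
  assumes "linear A"
  shows "exp_map 0 A x = x"
    and "((\<lambda>s. exp_map s A x) has_vector_derivative A (exp_map t A x)) (at t)"
proof -
  have "exp_map 0 A x = (\<Sum>k. if k = 0 then x else 0)"
    unfolding exp_map_def by (intro suminf_cong) (auto simp: power_0_left)
  also have "\<dots> = x" using sums_If_finite_set[of "{0}" "\<lambda>_. x"] by (auto simp: sums_iff)
  finally show "exp_map 0 A x = x" .
next
  have inner_eq: "exp_map s A x \<bullet> b = (\<Sum>k. ((A ^^ k) x \<bullet> b / fact k) * s ^ k)" for s b
  proof -
    have "exp_map s A x \<bullet> b = (\<Sum>k. ((s ^ k / fact k) *\<^sub>R (A ^^ k) x) \<bullet> b)"
      unfolding exp_map_def
      by (rule bounded_linear.suminf[OF bounded_linear_inner_left summable_exp_map[OF assms]])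
    then show ?thesis by (simp add: field_simps)
  qed
  have summ: "summable (\<lambda>k. ((A ^^ k) x \<bullet> b / fact k) * s ^ k)" for s b
    using bounded_linear.summable[OF bounded_linear_inner_left summable_exp_map[OF assms], of s x b]
    by (simp add: field_simps)
  have A_eq: "A (exp_map t A x) \<bullet> b = (\<Sum>k. diffs (\<lambda>k. (A ^^ k) x \<bullet> b / fact k) k * t ^ k)" for b
  proof -
    have bl: "bounded_linear (\<lambda>y. A y \<bullet> b)"
      using assms by (intro bounded_linear_compose[OF bounded_linear_inner_left])
        (simp add: linear_conv_bounded_linear)
    have "A (exp_map t A x) \<bullet> b = (\<Sum>k. A ((t ^ k / fact k) *\<^sub>R (A ^^ k) x) \<bullet> b)"
      unfolding exp_map_def
      by (rule bounded_linear.suminf[OF bl summable_exp_map[OF assms]])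
    also have "\<dots> = (\<Sum>k. diffs (\<lambda>k. (A ^^ k) x \<bullet> b / fact k) k * t ^ k)"
      by (intro suminf_cong)
        (simp add: diffs_def linear_scale[OF assms] field_simps del: of_nat_Suc)
    finally show ?thesis .
  qed
  have "((\<lambda>s. exp_map s A x \<bullet> b) has_vector_derivative A (exp_map t A x) \<bullet> b) (at t)" for b
    unfolding inner_eq A_eq has_real_derivative_iff_has_vector_derivative[symmetric]
    by (rule termdiffs_strong_converges_everywhere[OF summ])
  then show "((\<lambda>s. exp_map s A x) has_vector_derivative A (exp_map t A x)) (at t)"
    unfolding has_vector_derivative_def
    by (subst has_derivative_componentwise_within) (auto simp: inner_scaleR_left)
qed

lemma exp_map_flow_unique:
  fixes A :: "'v::euclidean_space \<Rightarrow> 'v"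
  assumes A: "linear A"
    and \<phi>: "\<phi> 0 = x" "\<And>t. (\<phi> has_vector_derivative A (\<phi> t)) (at t)"
  shows "\<phi> t = exp_map t A x"
proof -
  from linear_bounded_pos[OF A] obtain K where K: "K > 0" "\<And>x. norm (A x) \<le> K * norm x"
    by blast
  define d where "d = (\<lambda>t. \<phi> t - exp_map t A x)"
  have d0: "d 0 = 0" by (simp add: d_def \<phi> exp_map_flow[OF A])
  have d': "(d has_vector_derivative A (d t)) (at t)" for t
    unfolding d_def linear_diff[OF A]
    by (intro derivative_intros \<phi> exp_map_flow[OF A])
  have dd: "((\<lambda>t. d t \<bullet> d t) has_real_derivative 2 * (d t \<bullet> A (d t))) (at t)" for t
    using has_derivative_inner[OF d'[of t, unfolded has_vector_derivative_def]
        d'[of t, unfolded has_vector_derivative_def]]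
    by (simp add: has_field_derivative_def inner_commute algebra_simps mult_commute_abs)
  have bound: "\<bar>2 * (d t \<bullet> A (d t))\<bar> \<le> 2 * K * (d t \<bullet> d t)" for t
  proof -
    have "\<bar>d t \<bullet> A (d t)\<bar> \<le> norm (d t) * norm (A (d t))" by (rule Cauchy_Schwarz_ineq2)
    also have "\<dots> \<le> norm (d t) * (K * norm (d t))" by (intro mult_left_mono K) auto
    also have "\<dots> = K * (d t \<bullet> d t)" by (simp add: dot_square_norm power2_eq_square)
    finally show ?thesis by simp
  qed
  have "d t \<bullet> d t \<le> 0"
  proof (cases "t \<ge> 0")
    case True
    have "exp (- (2 * K * t)) * (d t \<bullet> d t) \<le> exp (- (2 * K * 0)) * (d 0 \<bullet> d 0)"
    proof (rule DERIV_nonpos_imp_nonincreasing[OF True])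
      fix s
      have "((\<lambda>s. exp (- (2 * K * s)) * (d s \<bullet> d s)) has_real_derivative
          exp (- (2 * K * s)) * (2 * (d s \<bullet> A (d s)) - 2 * K * (d s \<bullet> d s))) (at s)"
        by (rule derivative_eq_intros dd refl | simp add: algebra_simps)+
      moreover have "exp (- (2 * K * s)) * (2 * (d s \<bullet> A (d s)) - 2 * K * (d s \<bullet> d s)) \<le> 0"
        using bound[of s] by (intro mult_nonneg_nonpos) auto
      ultimately show "\<exists>y. ((\<lambda>s. exp (- (2 * K * s)) * (d s \<bullet> d s)) has_real_derivative y) (at s)
          \<and> y \<le> 0" by blast
    qed
    then show ?thesis using d0 by (simp add: mult_le_0_iff)
  next
    case False
    then have "t \<le> 0" by simp
    have "exp (2 * K * t) * (d t \<bullet> d t) \<le> exp (2 * K * 0) * (d 0 \<bullet> d 0)"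
    proof (rule DERIV_nonneg_imp_nondecreasing[OF \<open>t \<le> 0\<close>])
      fix s
      have "((\<lambda>s. exp (2 * K * s) * (d s \<bullet> d s)) has_real_derivative
          exp (2 * K * s) * (2 * (d s \<bullet> A (d s)) + 2 * K * (d s \<bullet> d s))) (at s)"
        by (rule derivative_eq_intros dd refl | simp add: algebra_simps)+
      moreover have "exp (2 * K * s) * (2 * (d s \<bullet> A (d s)) + 2 * K * (d s \<bullet> d s)) \<ge> 0"
        using bound[of s] by (intro mult_nonneg_nonneg) auto
      ultimately show "\<exists>y. ((\<lambda>s. exp (2 * K * s) * (d s \<bullet> d s)) has_real_derivative y) (at s)
          \<and> 0 \<le> y" by blast
    qed
    then show ?thesis using d0 by (simp add: mult_le_0_iff)
  qed
  then have "d t = 0" by (metis inner_gt_zero_iff not_le)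
  then show ?thesis by (simp add: d_def)
qed

end

theory Submission
  imports Defs "HOL-Computational_Algebra.Fundamental_Theorem_Algebra"
begin

text \<open>
  Let \<open>\<Psi> = id + \<gamma>\<^sub>g\<close> with \<open>g\<close> a polynomial without constant and linear terms. Near \<open>0\<close>, the pullback
  of \<open>\<gamma>\<^sub>f\<close> under \<open>\<Psi>\<close> is again a coupled cell vector field \<open>\<gamma>\<^sub>h\<close>: with \<open>\<gamma>'\<close> denoting \<open>\<gamma>\<close> for the
  semigroup acting on itself, \<open>h\<close> solves the pointwise linear equation
  \<open>h + Dg \<cdot> \<gamma>'\<^sub>h = f \<circ> (id + \<gamma>'\<^sub>g)\<close>. Adding \<open>p \<in> P k\<close> to \<open>g\<close> leaves the Taylor parts of \<open>h\<close> of
  index below \<open>k\<close> alone and changes the \<open>k\<close>-th one by \<open>ad f\<^sub>0 p\<close>, so that all parts up to \<open>r\<close> can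
  successively be moved into prescribed complements of the images of \<open>ad f\<^sub>0\<close>. The conjugacy is the
  local inverse of the polynomial map \<open>\<Psi>\<close>, which is analytic.

  By Fitting's lemma the complements can be chosen inside the generalized kernels of \<open>ad f\<^sub>0\<close>. For
  \<open>q\<close> in such a complement, the vector field \<open>\<gamma>\<^sub>q\<close> lies in the generalized kernel of the Lie bracket
  with the linear vector field \<open>A\<close> of \<open>f\<^sub>0\<close>, hence in the kernel of the bracket with the semisimple part \<open>S\<close> of \<open>A\<close>.
  This is seen by pairing with complex eigenfunctionals of \<open>S\<close> and decomposing polynomials into
  products of such functionals, which are eigenfunctions of the derivation along \<open>S\<close> and
  generalized eigenfunctions of the derivation along \<open>A\<close>. Only \<open>\<gamma>\<^sub>q\<close>, not \<open>q\<close>, needs to commute with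
  \<open>S\<close>; therefore \<open>f \<mapsto> \<gamma>\<^sub>f\<close> is allowed to have a kernel.
\<close>

subsection \<open>Smooth maps\<close>

text \<open>The complement has to come from \<open>ad f0\<close> itself: \<open>f0S\<close> is
  determined only up to the kernel of f |-> gamma f, so its own \<open>ad\<close> on
  \<open>P k\<close> need not be semisimple, and its kernel need not complement the image of
  \<open>ad f0\<close>. The map gamma turns \<open>ad f0\<close> into the bracket with A on V^N, and
  there S is genuinely the semisimple part of A. If l o S = \<kappa> l, then l o gamma q is a
  generalized eigenfunction for \<kappa> of the derivation along A. Generalized eigenfunctions for
  different eigenvalues are independent, so in the decomposition of l o gamma q only the components
  for \<kappa> survive, and on these the derivation along S is multiplication by \<kappa>. As f is
  only smooth, its Taylor series may diverge; but finitely many parts have to be normalized, so a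
  polynomial generator g is enough, and it keeps the conjugacy analytic. In exchange h is merely
  smooth, and its equation can be solved only near 0. A smooth cutoff turns the local solution into
  a globally smooth h.\<close>

lemma C_k_continuous: "C_k k f \<Longrightarrow> continuous_on UNIV f"
  by (cases k) (auto simp: continuous_on_eq_continuous_at dest: differentiable_imp_continuous_within)

lemma C_k_Suc_imp: "C_k (Suc k) f \<Longrightarrow> C_k k f"
proof (induction k arbitrary: f)
  case 0
  then show ?case
    by (auto simp: continuous_on_eq_continuous_at dest: differentiable_imp_continuous_within)
next
  case (Suc k)
  from Suc.prems Suc.IH show ?case by (metis C_k.simps(2))
qed

lemma C_k_const [simp]: "C_k k (\<lambda>x. c)"
  by (induction k arbitrary: c) auto

lemma C_k_bounded_linear:
  assumes "bounded_linear f" shows "C_k k f"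
proof (cases k)
  case (Suc k')
  have "frechet_derivative f (at x) = f" for x
    using assms by (metis bounded_linear_imp_has_derivative frechet_derivative_at)
  then show ?thesis
    using Suc assms by (auto intro: bounded_linear_imp_differentiable)
qed (use assms in \<open>auto intro: linear_continuous_on\<close>)

lemma frechet_derivative_add:
  assumes "f differentiable (at x)" "g differentiable (at x)"
  shows "frechet_derivative (\<lambda>x. f x + g x) (at x) v
    = frechet_derivative f (at x) v + frechet_derivative g (at x) v"
  using has_derivative_add[OF assms[unfolded frechet_derivative_works]]
  by (metis frechet_derivative_at)

lemma C_k_add: "C_k k f \<Longrightarrow> C_k k g \<Longrightarrow> C_k k (\<lambda>x. f x + g x)"
  by (induction k arbitrary: f g) (auto intro!: continuous_intros simp: frechet_derivative_add)

lemma C_k_sum: "finite I \<Longrightarrow> (\<And>i. i \<in> I \<Longrightarrow> C_k k (f i)) \<Longrightarrow> C_k k (\<lambda>x. \<Sum>i\<in>I. f i x)"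
  by (induction I rule: finite_induct) (auto intro: C_k_add)

lemma C_k_bilinear:
  assumes p: "bounded_bilinear p"
  shows "C_k k f \<Longrightarrow> C_k k g \<Longrightarrow> C_k k (\<lambda>x. p (f x) (g x))"
proof (induction k arbitrary: f g)
  case 0
  then show ?case by (auto intro!: bounded_bilinear.continuous_on[OF p])
next
  case (Suc k)
  have d: "((\<lambda>x. p (f x) (g x)) has_derivative
      (\<lambda>h. p (f x) (frechet_derivative g (at x) h) + p (frechet_derivative f (at x) h) (g x))) (at x)" for x
    using Suc.prems by (intro bounded_bilinear.FDERIV[OF p]) (auto simp: frechet_derivative_works)
  note fd = frechet_derivative_at[OF d, symmetric]
  have "C_k k f" "C_k k g" using Suc.prems by (auto intro: C_k_Suc_imp)
  then show ?case
    unfolding C_k.simps fd using Suc d by (auto intro!: C_k_add simp: differentiable_def)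
qed

lemma C_k_linear_comp:
  assumes L: "bounded_linear L" and f: "C_k k f" shows "C_k k (\<lambda>x. L (f x))"
  using f
proof (induction k arbitrary: f)
  case 0
  then show ?case using L by (auto intro: bounded_linear.continuous_on)
next
  case (Suc k)
  have d: "((\<lambda>x. L (f x)) has_derivative (\<lambda>h. L (frechet_derivative f (at x) h))) (at x)" for x
    using Suc.prems by (intro bounded_linear.has_derivative[OF L]) (auto simp: frechet_derivative_works)
  note fd = frechet_derivative_at[OF d, symmetric]
  show ?case unfolding C_k.simps fd using Suc d by (auto simp: differentiable_def)
qed

lemma linear_basis_expand:
  fixes B :: "'a::euclidean_space \<Rightarrow> 'b::real_vector"
  assumes "linear B" shows "B v = (\<Sum>b\<in>Basis. (v \<bullet> b) *\<^sub>R B b)"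
proof -
  have "B v = B (\<Sum>b\<in>Basis. (v \<bullet> b) *\<^sub>R b)" by (simp add: euclidean_representation)
  then show ?thesis by (simp add: linear_sum[OF assms] linear_scale[OF assms])
qed

lemma frechet_derivative_basis:
  fixes f :: "'a::euclidean_space \<Rightarrow> 'b::real_normed_vector"
  assumes "f differentiable (at x)"
  shows "frechet_derivative f (at x) v = (\<Sum>b\<in>Basis. (v \<bullet> b) *\<^sub>R frechet_derivative f (at x) b)"
  by (rule linear_basis_expand[OF linear_frechet_derivative[OF assms]])

lemma frechet_derivative_compose_eq:
  assumes "f differentiable (at (g x))" "g differentiable (at x)"
  shows "frechet_derivative (\<lambda>x. f (g x)) (at x) v
    = frechet_derivative f (at (g x)) (frechet_derivative g (at x) v)"
  using frechet_derivative_compose[of g x f] assms by (simp add: o_def)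

text \<open>In a basis, the chain rule writes a directional derivative of the composite as a sum of
  products: coordinates of the derivative of g times derivatives of f composed with g. All factors
  are covered by the induction hypothesis or by the rules for products and linear maps.\<close>

lemma C_k_compose:
  fixes f :: "'b::euclidean_space \<Rightarrow> 'c::real_normed_vector" and g :: "'a::real_normed_vector \<Rightarrow> 'b"
  shows "C_k k f \<Longrightarrow> C_k k g \<Longrightarrow> C_k k (\<lambda>x. f (g x))"
proof (induction k arbitrary: f g)
  case 0
  then show ?case by (auto intro: continuous_on_compose2)
next
  case (Suc k)
  have g: "C_k k g" using Suc.prems by (rule_tac C_k_Suc_imp)
  have eq: "frechet_derivative (\<lambda>x. f (g x)) (at x) v
      = (\<Sum>b\<in>Basis. (frechet_derivative g (at x) v \<bullet> b) *\<^sub>R frechet_derivative f (at (g x)) b)" for x v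
    using Suc.prems by (subst frechet_derivative_compose_eq) (auto intro: frechet_derivative_basis)
  have dd: "(\<lambda>x. f (g x)) differentiable (at x)" for x
    using Suc.prems differentiable_compose[of f g x UNIV] by auto
  show ?case unfolding C_k.simps eq
    using Suc.prems Suc.IH[OF _ g] dd
    by (auto intro!: C_k_sum C_k_bilinear[OF bounded_bilinear_scaleR]
        C_k_linear_comp[OF bounded_linear_inner_left])
qed

text \<open>The derivative of 1/f is a product of the derivative of f with two copies of 1/f, so the
  regularity of 1/f lifts itself one order at a time.\<close>

lemma C_k_real_inverse:
  fixes f :: "'a::real_normed_vector \<Rightarrow> real"
  shows "C_k k f \<Longrightarrow> (\<And>x. f x \<noteq> 0) \<Longrightarrow> C_k k (\<lambda>x. inverse (f x))"
proof (induction k)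
  case 0
  then show ?case by (auto intro!: continuous_intros)
next
  case (Suc k)
  have d: "((\<lambda>x. inverse (f x)) has_derivative
      (\<lambda>h. - (inverse (f x) * frechet_derivative f (at x) h * inverse (f x)))) (at x)" for x
    using Suc.prems by (intro Deriv.has_derivative_inverse) (auto simp: frechet_derivative_works)
  have fd: "frechet_derivative (\<lambda>x. inverse (f x)) (at x) v
     = (- 1) * (inverse (f x) * (inverse (f x) * frechet_derivative f (at x) v))" for x v
    by (subst frechet_derivative_at[OF d, symmetric]) (simp add: mult_ac)
  have "C_k k f" using Suc.prems by (auto intro: C_k_Suc_imp)
  with Suc have "C_k k (\<lambda>x. inverse (f x))" by blast
  then show ?case
    unfolding C_k.simps fd using Suc d
    by (intro conjI allI C_k_bilinear[OF bounded_bilinear_mult] C_k_const)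
      (auto simp: differentiable_def)
qed

lemma smooth_const [simp]: "smooth (\<lambda>x. c)"
  by (simp add: smooth_def)

lemma smooth_bounded_linear: "bounded_linear f \<Longrightarrow> smooth f"
  by (simp add: smooth_def C_k_bounded_linear)

lemma smooth_linear:
  fixes f :: "'a::euclidean_space \<Rightarrow> 'b::real_normed_vector"
  shows "linear f \<Longrightarrow> smooth f"
  by (simp add: smooth_bounded_linear linear_conv_bounded_linear)

lemma smooth_id: "smooth (\<lambda>x. x)"
  by (simp add: smooth_bounded_linear)

lemma smooth_add: "smooth f \<Longrightarrow> smooth g \<Longrightarrow> smooth (\<lambda>x. f x + g x)"
  by (simp add: smooth_def C_k_add)

lemma smooth_sum: "finite I \<Longrightarrow> (\<And>i. i \<in> I \<Longrightarrow> smooth (f i)) \<Longrightarrow> smooth (\<lambda>x. \<Sum>i\<in>I. f i x)"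
  by (simp add: smooth_def C_k_sum)

lemma smooth_bilinear:
  "bounded_bilinear p \<Longrightarrow> smooth f \<Longrightarrow> smooth g \<Longrightarrow> smooth (\<lambda>x. p (f x) (g x))"
  by (simp add: smooth_def C_k_bilinear)

lemmas smooth_scaleR = smooth_bilinear[OF bounded_bilinear_scaleR]
  and smooth_mult = smooth_bilinear[OF bounded_bilinear_mult]

lemma smooth_linear_comp: "bounded_linear L \<Longrightarrow> smooth f \<Longrightarrow> smooth (\<lambda>x. L (f x))"
  by (simp add: smooth_def C_k_linear_comp)

lemma smooth_uminus: "smooth f \<Longrightarrow> smooth (\<lambda>x. - f x)"
  by (rule smooth_linear_comp[OF bounded_linear_minus[OF bounded_linear_ident]])

lemma smooth_diff: "smooth f \<Longrightarrow> smooth g \<Longrightarrow> smooth (\<lambda>x. f x - g x)"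
  using smooth_add[OF _ smooth_uminus] by fastforce

lemma smooth_compose:
  fixes f :: "'b::euclidean_space \<Rightarrow> 'c::real_normed_vector" and g :: "'a::real_normed_vector \<Rightarrow> 'b"
  shows "smooth f \<Longrightarrow> smooth g \<Longrightarrow> smooth (\<lambda>x. f (g x))"
  by (simp add: smooth_def C_k_compose)

lemma smooth_differentiable: "smooth f \<Longrightarrow> f differentiable (at x)"
  unfolding smooth_def by (metis C_k.simps(2))

lemma smooth_has_derivative: "smooth f \<Longrightarrow> (f has_derivative frechet_derivative f (at x)) (at x)"
  using smooth_differentiable frechet_derivative_works by blast

lemma smooth_continuous: "smooth f \<Longrightarrow> continuous (at x) f"
  using smooth_differentiable differentiable_imp_continuous_within by blast

lemma smooth_dir_deriv: "smooth f \<Longrightarrow> smooth (\<lambda>x. frechet_derivative f (at x) v)"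
  unfolding smooth_def by (metis C_k.simps(2))

text \<open>The direction varies with the point; its expansion in the basis leaves only derivatives
  in constant directions.\<close>

lemma smooth_frechet_derivative:
  fixes f :: "'a::euclidean_space \<Rightarrow> 'b::real_normed_vector" and g :: "'a \<Rightarrow> 'a"
  assumes "smooth f" "smooth g"
  shows "smooth (\<lambda>x. frechet_derivative f (at x) (g x))"
  unfolding frechet_derivative_basis[OF smooth_differentiable[OF assms(1)], of _ "g _"]
  using assms by (intro smooth_sum smooth_scaleR smooth_linear_comp[OF bounded_linear_inner_left]
      smooth_dir_deriv) auto

lemma linear_smooth_frechet: "smooth f \<Longrightarrow> linear (frechet_derivative f (at x))"
  by (rule linear_frechet_derivative[OF smooth_differentiable])

section \<open>Polynomial maps and their derivatives\<close>

lemma smooth_real_polynomial_function: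
  "real_polynomial_function p \<Longrightarrow> smooth p"
  by (induction p rule: real_polynomial_function.induct)
    (auto intro: smooth_bounded_linear smooth_add smooth_mult)

lemma smooth_polynomial_function:
  fixes p :: "'a::real_normed_vector \<Rightarrow> 'b::euclidean_space"
  assumes "polynomial_function p" shows "smooth p"
proof -
  have "smooth (\<lambda>x. \<Sum>b\<in>Basis. (p x \<bullet> b) *\<^sub>R b)"
    using assms unfolding polynomial_function_iff_Basis_inner
    by (intro smooth_sum smooth_scaleR smooth_real_polynomial_function) auto
  then show ?thesis by (simp add: euclidean_representation)
qed

lemma real_polynomial_frechet_derivative:
  assumes "real_polynomial_function p" "bounded_linear B"
  shows "real_polynomial_function (\<lambda>x. frechet_derivative p (at x) (B x))"
  using assms(1)
proof (induction p rule: real_polynomial_function.induct)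
  case (linear f)
  then have "frechet_derivative f (at x) = f" for x
    by (metis bounded_linear_imp_has_derivative frechet_derivative_at)
  with linear assms(2) show ?case
    using bounded_linear_compose[of f B] by (auto intro: real_polynomial_function.intros)
next
  case (add f g)
  then show ?case
    by (simp add: frechet_derivative_add differentiable_at_real_polynomial_function
        real_polynomial_function.intros)
next
  case (mult f g)
  have d: "((\<lambda>x. f x * g x) has_derivative
      (\<lambda>h. f x * (frechet_derivative g (at x) h) + (frechet_derivative f (at x) h) * (g x))) (at x)" for x
    using mult by (intro has_derivative_mult)
      (auto simp: frechet_derivative_works[symmetric] differentiable_at_real_polynomial_function)
  show ?case unfolding frechet_derivative_at[OF d, symmetric]
    using mult by (intro real_polynomial_function.intros(3,4))
qed auto

lemma frechet_derivative_inner: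
  assumes "f differentiable (at x)"
  shows "frechet_derivative (\<lambda>x. f x \<bullet> b) (at x) v = frechet_derivative f (at x) v \<bullet> b"
  using has_derivative_inner_left[OF assms[unfolded frechet_derivative_works], of b]
  by (metis frechet_derivative_at)

lemma polynomial_frechet_derivative:
  fixes p :: "'a::real_normed_vector \<Rightarrow> 'b::euclidean_space"
  assumes "polynomial_function p" "bounded_linear B"
  shows "polynomial_function (\<lambda>x. frechet_derivative p (at x) (B x))"
  unfolding polynomial_function_iff_Basis_inner
proof
  fix b :: 'b assume "b \<in> Basis"
  then have "real_polynomial_function (\<lambda>x. p x \<bullet> b)"
    using assms(1) unfolding polynomial_function_iff_Basis_inner by blast
  from real_polynomial_frechet_derivative[OF this assms(2)]
  show "real_polynomial_function (\<lambda>x. frechet_derivative p (at x) (B x) \<bullet> b)"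
    using frechet_derivative_inner[OF smooth_differentiable[OF smooth_polynomial_function[OF assms(1)]]]
    by simp
qed

subsection \<open>Smooth cutoff functions\<close>

text \<open>Up to signs and multiples, the derivatives of \<open>exp (-1/x)\<close> stay in this family.\<close>

definition flat_fun :: "nat \<Rightarrow> real \<Rightarrow> real" where
  "flat_fun m x = (if x > 0 then inverse x ^ m * exp (- inverse x) else 0)"

text \<open>With y = 1/x this is the decay of y^m exp(-y) at infinity; on the negative side the
  function is zero.\<close>

lemma flat_fun_tendsto: "(flat_fun m \<longlongrightarrow> 0) (at 0)"
proof -
  have "((\<lambda>y. y ^ m / exp y) \<longlongrightarrow> 0) (at_top :: real filter)"
    by (rule tendsto_power_div_exp_0)
  then have "((\<lambda>x. inverse x ^ m / exp (inverse x)) \<longlongrightarrow> 0) (at_right (0::real))"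
    by (rule filterlim_compose[OF _ filterlim_inverse_at_top_right])
  then have r: "(flat_fun m \<longlongrightarrow> 0) (at_right 0)"
    by (rule Lim_transform_eventually)
      (auto simp: flat_fun_def eventually_at_filter exp_minus divide_inverse)
  have l: "(flat_fun m \<longlongrightarrow> 0) (at_left 0)"
    by (rule Lim_transform_eventually[OF tendsto_const])
      (auto simp: flat_fun_def eventually_at_filter)
  from l r show ?thesis by (rule filterlim_split_at)
qed

lemma flat_fun_deriv:
  "(flat_fun m has_real_derivative (flat_fun (m + 2) x - m * flat_fun (m + 1) x)) (at x)"
proof -
  consider "x > 0" | "x < 0" | "x = 0" by linarith
  then show ?thesis
  proof cases
    case 1
    have "((\<lambda>x. inverse x ^ m * exp (- inverse x)) has_real_derivative
       (flat_fun (m + 2) x - m * flat_fun (m + 1) x)) (at x)"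
      by (rule derivative_eq_intros refl | use 1 in simp; fail)+
        (use 1 in \<open>cases m; simp add: field_simps flat_fun_def\<close>)
    then show ?thesis
      by (rule DERIV_cong_ev[THEN iffD1, rotated -1])
        (use 1 in \<open>auto simp: flat_fun_def eventually_nhds intro!: exI[of _ "{0<..}"]\<close>)
  next
    case 2
    have "((\<lambda>x. 0) has_real_derivative (flat_fun (m + 2) x - m * flat_fun (m + 1) x)) (at x)"
      using 2 by (simp add: flat_fun_def)
    then show ?thesis
      by (rule DERIV_cong_ev[THEN iffD1, rotated -1])
        (use 2 in \<open>auto simp: flat_fun_def eventually_nhds intro!: exI[of _ "{..<0}"]\<close>)
  next
    case 3
    \<comment> \<open>The difference quotient at 0 is itself \<open>flat_fun (m + 1)\<close>, whose
      limit is already known.\<close>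
    have "((\<lambda>h. (flat_fun m (0 + h) - flat_fun m 0) / h) \<longlongrightarrow> 0) (at 0)"
      by (rule Lim_transform_eventually[OF flat_fun_tendsto[of "m + 1"]])
        (auto simp: flat_fun_def eventually_at_filter divide_inverse)
    then have "(flat_fun m has_real_derivative 0) (at 0)"
      by (simp add: DERIV_def)
    with 3 show ?thesis by (simp add: flat_fun_def)
  qed
qed

lemma smooth_flat_fun: "smooth (flat_fun m)"
proof -
  have fd: "frechet_derivative (flat_fun m) (at x) v
      = v *\<^sub>R flat_fun (m + 2) x + ((- v * m) *\<^sub>R flat_fun (m + 1) x)" for m x v
    by (subst frechet_derivative_at[OF flat_fun_deriv[unfolded has_field_derivative_def], symmetric])
      (simp add: algebra_simps)
  have "C_k k (flat_fun m)" for k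
  proof (induction k arbitrary: m)
    case 0
    show ?case
      using DERIV_isCont[OF flat_fun_deriv] by (auto simp: continuous_on_eq_continuous_at)
  next
    case (Suc k)
    have "flat_fun m differentiable (at x)" for x
      using flat_fun_deriv[unfolded has_field_derivative_def] differentiable_def by blast
    with Suc show ?case unfolding C_k.simps fd
      by (intro conjI allI C_k_add C_k_linear_comp[OF bounded_linear_scaleR_right]) auto
  qed
  then show ?thesis by (simp add: smooth_def)
qed

text \<open>The quotient a / (a + b): a is positive exactly inside the ball of radius e, b exactly
  outside the closed ball of radius e/2, so the denominator never vanishes.\<close>

lemma smooth_cutoff:
  assumes "e > 0"
  obtains \<theta> :: "'a::euclidean_space \<Rightarrow> real" and d where "smooth \<theta>" "d > 0"
    "\<And>x. 0 \<le> \<theta> x" "\<And>x. \<theta> x \<le> 1" "\<And>x. norm x < d \<Longrightarrow> \<theta> x = 1" "\<And>x. norm x \<ge> e \<Longrightarrow> \<theta> x = 0"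
proof -
  define a where "a = (\<lambda>x::'a. flat_fun 0 (e\<^sup>2 - x \<bullet> x))"
  define b where "b = (\<lambda>x::'a. flat_fun 0 (x \<bullet> x - e\<^sup>2 / 4))"
  have nn: "flat_fun 0 x \<ge> 0" for x by (simp add: flat_fun_def)
  have sq: "smooth (\<lambda>x::'a. x \<bullet> x)" by (intro smooth_bilinear[OF bounded_bilinear_inner] smooth_id)
  have sa: "smooth a" and sb: "smooth b"
    unfolding a_def b_def by (intro smooth_compose[OF smooth_flat_fun] smooth_diff sq smooth_const)+
  have pos: "a x + b x > 0" for x
  proof -
    have "e\<^sup>2 - x \<bullet> x > 0 \<or> x \<bullet> x - e\<^sup>2 / 4 > 0" using assms zero_less_power[of e 2] by linarith
    then have "a x > 0 \<or> b x > 0" by (auto simp: a_def b_def flat_fun_def)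
    with nn[of "e\<^sup>2 - x \<bullet> x"] nn[of "x \<bullet> x - e\<^sup>2 / 4"] show ?thesis
      unfolding a_def b_def by linarith
  qed
  define \<theta> where "\<theta> = (\<lambda>x. a x * inverse (a x + b x))"
  show thesis
  proof
    have "smooth (\<lambda>x. inverse (a x + b x))"
      using smooth_add[OF sa sb] less_imp_neq[OF pos, symmetric] C_k_real_inverse
      unfolding smooth_def by blast
    then show "smooth \<theta>" unfolding \<theta>_def by (intro smooth_mult sa)
    show "e / 2 > 0" using assms by simp
    have ab: "a x \<ge> 0" "b x \<ge> 0" for x using nn by (auto simp: a_def b_def)
    show "0 \<le> \<theta> x" "\<theta> x \<le> 1" for x
      using ab[of x] pos[of x] by (auto simp: \<theta>_def field_simps)
    show "\<theta> x = 1" if "norm x < e / 2" for x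
    proof -
      have "(norm x)\<^sup>2 \<le> (e / 2)\<^sup>2" using that by (intro power_mono) auto
      then have "b x = 0" by (simp add: b_def flat_fun_def dot_square_norm power_divide)
      then show ?thesis using pos[of x] by (simp add: \<theta>_def)
    qed
    show "\<theta> x = 0" if "norm x \<ge> e" for x
    proof -
      have "e\<^sup>2 \<le> (norm x)\<^sup>2" using that assms by (intro power_mono) auto
      then show ?thesis by (simp add: \<theta>_def a_def flat_fun_def dot_square_norm)
    qed
  qed
qed

text \<open>A product rule in which one factor is merely continuous: the other factor vanishes at
  the point, so the missing derivative would be multiplied by zero. It serves to pass from the
  continuity of a solution to its differentiability.\<close>

lemma has_derivative_scaleR_zero:
  assumes a: "isCont \<alpha> x" and d: "(\<phi> has_derivative \<phi>') (at x)" and z: "\<phi> x = 0"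
  shows "((\<lambda>y. \<alpha> y *\<^sub>R \<phi> y) has_derivative (\<lambda>h. \<alpha> x *\<^sub>R \<phi>' h)) (at x)"
proof -
  have bl: "bounded_linear \<phi>'" using d by (rule has_derivative_bounded_linear)
  then obtain K where K: "\<And>h. norm (\<phi>' h) \<le> norm h * K" by (auto dest: bounded_linear.bounded)
  have lim: "((\<lambda>y. (1 / norm (y - x)) *\<^sub>R (\<phi> y - \<phi>' (y - x))) \<longlongrightarrow> 0) (at x)"
    using d z by (simp add: has_derivative_within)
  have a1: "(\<alpha> \<longlongrightarrow> \<alpha> x) (at x)" using a by (simp add: continuous_within)
  have "((\<lambda>y. \<bar>\<alpha> y - \<alpha> x\<bar> * K) \<longlongrightarrow> \<bar>\<alpha> x - \<alpha> x\<bar> * K) (at x)"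
    by (intro tendsto_intros a1)
  then have lim0: "((\<lambda>y. \<bar>\<alpha> y - \<alpha> x\<bar> * K) \<longlongrightarrow> 0) (at x)" by simp
  have le: "norm ((\<alpha> y - \<alpha> x) *\<^sub>R ((1 / norm (y - x)) *\<^sub>R \<phi>' (y - x))) \<le> \<bar>\<alpha> y - \<alpha> x\<bar> * K"
    if "y \<noteq> x" for y
  proof -
    have "norm (\<phi>' (y - x)) * \<bar>\<alpha> y - \<alpha> x\<bar> \<le> norm (y - x) * K * \<bar>\<alpha> y - \<alpha> x\<bar>"
      by (intro mult_right_mono K) auto
    with that show ?thesis by (simp add: divide_simps) (simp add: mult_ac)
  qed
  have "((\<lambda>y. (\<alpha> y - \<alpha> x) *\<^sub>R ((1 / norm (y - x)) *\<^sub>R \<phi>' (y - x))) \<longlongrightarrow> 0) (at x)"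
    by (rule Lim_null_comparison[OF _ lim0]) (use le in \<open>simp add: eventually_at_filter\<close>)
  with tendsto_scaleR[OF a1 lim]
  have "((\<lambda>y. \<alpha> y *\<^sub>R ((1 / norm (y - x)) *\<^sub>R (\<phi> y - \<phi>' (y - x)))
      + (\<alpha> y - \<alpha> x) *\<^sub>R ((1 / norm (y - x)) *\<^sub>R \<phi>' (y - x))) \<longlongrightarrow> \<alpha> x *\<^sub>R 0 + 0) (at x)"
    by (rule tendsto_add)
  moreover have "\<alpha> y *\<^sub>R ((1 / norm (y - x)) *\<^sub>R (\<phi> y - \<phi>' (y - x)))
      + (\<alpha> y - \<alpha> x) *\<^sub>R ((1 / norm (y - x)) *\<^sub>R \<phi>' (y - x))
      = (1 / norm (y - x)) *\<^sub>R (\<alpha> y *\<^sub>R \<phi> y - \<alpha> x *\<^sub>R \<phi>' (y - x))" for y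
  proof -
    have "a *\<^sub>R (c *\<^sub>R (p - q)) + (a - b) *\<^sub>R (c *\<^sub>R q) = c *\<^sub>R (a *\<^sub>R p - b *\<^sub>R q)" for a b c and p q :: 'b
      by (simp add: algebra_simps)
    then show ?thesis .
  qed
  ultimately have "((\<lambda>y. (1 / norm (y - x)) *\<^sub>R (\<alpha> y *\<^sub>R \<phi> y - \<alpha> x *\<^sub>R \<phi>' (y - x))) \<longlongrightarrow> 0) (at x)"
    by simp
  then show ?thesis
    unfolding has_derivative_within using z bl
    by (auto intro: bounded_linear_compose[OF bounded_linear_scaleR_right])
qed

text \<open>Differentiating \<open>u + B u = w\<close> gives an equation of the same form for each directional
  derivative of \<open>u\<close>.\<close>

lemma smooth_linear_solve:
  fixes B :: "'a::euclidean_space \<Rightarrow> 'v::euclidean_space \<Rightarrow> 'v"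
  assumes lin: "\<And>x. linear (B x)" and half: "\<And>x v. norm (B x v) \<le> norm v / 2"
    and smB: "\<And>v. smooth (\<lambda>x. B x v)"
    and eq: "\<And>x. u x + B x (u x) = w x" and w: "smooth w"
  shows "smooth u"
proof -
  have bd: "norm v \<le> 2 * norm (v + B x v)" for x v
    using norm_diff_ineq[of v "B x v"] half[of x v] by linarith
  have "C_k k u" if "\<And>x. u x + B x (u x) = w x" "C_k k w" for k u w
    using that
  proof (induction k arbitrary: u w)
    case 0
    have "isCont u x0" for x0
    proof -
      \<comment> \<open>Subtracting the value at \<open>x0\<close> gives an equation for u x - u x0
        whose right side contains u only at the fixed point, so it tends to 0; \<open>bd\<close>
        then controls u x - u x0.\<close>
      have "((\<lambda>x. w x - u x0 - B x (u x0)) \<longlongrightarrow> w x0 - u x0 - B x0 (u x0)) (at x0)"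
        using 0 smooth_continuous[OF smB[of "u x0"], of x0]
        by (intro tendsto_intros)
          (auto simp: continuous_on_eq_continuous_at continuous_within)
      moreover have "w x0 - u x0 - B x0 (u x0) = 0" unfolding 0(1)[of x0, symmetric] by simp
      ultimately have l: "((\<lambda>x. 2 * norm (w x - u x0 - B x (u x0))) \<longlongrightarrow> 0) (at x0)"
        using tendsto_mult_right_zero tendsto_norm_zero by metis
      have "norm (u x - u x0) \<le> 2 * norm (w x - u x0 - B x (u x0))" for x
        using bd[of "u x - u x0" x] by (simp add: linear_diff[OF lin] 0(1)[symmetric] algebra_simps)
      then have "((\<lambda>x. u x - u x0) \<longlongrightarrow> 0) (at x0)"
        by (intro Lim_null_comparison[OF _ l]) auto
      then show ?thesis by (simp add: continuous_within LIM_zero_iff)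
    qed
    then show ?case by (simp add: continuous_on_eq_continuous_at)
  next
    case (Suc k)
    have w: "C_k k w" by (rule C_k_Suc_imp) fact
    have u: "C_k k u" using Suc.IH[OF Suc.prems(1) w] .
    have uc: "isCont u x" for x
      using C_k_continuous[OF u] by (simp add: continuous_on_eq_continuous_at)
    have du: "u differentiable (at x0)" for x0
    proof -
      have "linear (\<lambda>v. v + B x0 v)" using lin[of x0] linear_id by (intro linear_compose_add) (auto simp: id_def)
      moreover have "inj (\<lambda>v. v + B x0 v)"
      proof (rule injI)
        fix v v' assume "v + B x0 v = v' + B x0 v'"
        then show "v = v'" using bd[of "v - v'" x0] by (simp add: linear_diff[OF lin] algebra_simps)
      qed
      ultimately obtain N where N: "linear N" "N \<circ> (\<lambda>v. v + B x0 v) = id"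
        using linear_injective_left_inverse by blast
      have Nb: "bounded_linear N" using N by (simp add: linear_conv_bounded_linear)
      \<comment> \<open>B is frozen at \<open>x0\<close>, and N inverts id + B x0. On the right, u
        occurs only in products with B x b - B x0 b, which vanishes at \<open>x0\<close>, so that
        the continuity of u is enough to differentiate.\<close>
      have "u x = N (w x - (\<Sum>b\<in>Basis. (u x \<bullet> b) *\<^sub>R (B x b - B x0 b)))" for x
      proof -
        have "(\<Sum>b\<in>Basis. (u x \<bullet> b) *\<^sub>R (B x b - B x0 b)) = B x (u x) - B x0 (u x)"
          by (subst (1 2) linear_basis_expand[OF lin]) (simp add: sum_subtractf algebra_simps)
        then have "w x - (\<Sum>b\<in>Basis. (u x \<bullet> b) *\<^sub>R (B x b - B x0 b)) = u x + B x0 (u x)"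
          using Suc.prems(1)[of x] by (simp add: algebra_simps)
        then show ?thesis using N(2) by (metis comp_apply id_apply)
      qed
      moreover have "(\<lambda>x. N (w x - (\<Sum>b\<in>Basis. (u x \<bullet> b) *\<^sub>R (B x b - B x0 b)))) differentiable (at x0)"
      proof -
        have "(\<lambda>x. (u x \<bullet> b) *\<^sub>R (B x b - B x0 b)) differentiable (at x0)" for b
        proof -
          have "isCont (\<lambda>x. u x \<bullet> b) x0" using uc by (intro continuous_intros)
          moreover have "((\<lambda>x. B x b - B x0 b) has_derivative (frechet_derivative (\<lambda>x. B x b) (at x0))) (at x0)"
            using has_derivative_diff[OF smooth_has_derivative[OF smB] has_derivative_const] by simp
          ultimately show ?thesis
            unfolding differentiable_def using has_derivative_scaleR_zero by fastforce
        qed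
        then have "(\<lambda>x. w x - (\<Sum>b\<in>Basis. (u x \<bullet> b) *\<^sub>R (B x b - B x0 b))) differentiable (at x0)"
          using Suc.prems by (intro differentiable_diff differentiable_sum) auto
        then show ?thesis
          using differentiable_compose[of N _ x0 UNIV] bounded_linear_imp_differentiable[OF Nb] by blast
      qed
      ultimately show ?thesis by presburger
    qed
    \<comment> \<open>The right side contains the derivative of w and u itself, but no derivative of
      u, so it is already known to be \<open>C_k k\<close>.\<close>
    have eqd: "frechet_derivative u (at x) v + B x (frechet_derivative u (at x) v)
        = frechet_derivative w (at x) v
          + (- (\<Sum>b\<in>Basis. (u x \<bullet> b) *\<^sub>R frechet_derivative (\<lambda>x. B x b) (at x) v))" for x v
    proof -
      let ?u = "frechet_derivative u (at x)"
      have w_eq: "w = (\<lambda>x. u x + (\<Sum>b\<in>Basis. (u x \<bullet> b) *\<^sub>R B x b))"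
        by (simp add: fun_eq_iff Suc.prems(1)[symmetric] linear_basis_expand[OF lin, symmetric])
      have "((\<lambda>x. u x + (\<Sum>b\<in>Basis. (u x \<bullet> b) *\<^sub>R B x b)) has_derivative
          (\<lambda>v. ?u v + (\<Sum>b\<in>Basis. (u x \<bullet> b) *\<^sub>R frechet_derivative (\<lambda>x. B x b) (at x) v
            + (?u v \<bullet> b) *\<^sub>R B x b))) (at x)"
        using du[of x]
        by (intro has_derivative_add has_derivative_sum has_derivative_scaleR
            has_derivative_inner_left smooth_has_derivative[OF smB])
          (simp_all add: frechet_derivative_works)
      then have "frechet_derivative w (at x) v = ?u v
          + (\<Sum>b\<in>Basis. (u x \<bullet> b) *\<^sub>R frechet_derivative (\<lambda>x. B x b) (at x) v + (?u v \<bullet> b) *\<^sub>R B x b)"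
        unfolding w_eq[symmetric] by (simp add: frechet_derivative_at[symmetric])
      then show ?thesis
        by (simp add: sum.distrib linear_basis_expand[OF lin, symmetric])
    qed
    have "C_k k (\<lambda>x. frechet_derivative u (at x) v)" for v
    proof (rule Suc.IH[OF eqd])
      have "C_k k (\<lambda>x. frechet_derivative (\<lambda>x. B x b) (at x) v)" for b
        using smooth_dir_deriv[OF smB] by (simp add: smooth_def)
      then show "C_k k (\<lambda>x. frechet_derivative w (at x) v
          + (- (\<Sum>b\<in>Basis. (u x \<bullet> b) *\<^sub>R frechet_derivative (\<lambda>x. B x b) (at x) v)))"
        using Suc.prems u
        by (intro C_k_add C_k_linear_comp[OF bounded_linear_minus[OF bounded_linear_ident]] C_k_sum
            C_k_bilinear[OF bounded_bilinear_scaleR] C_k_linear_comp[OF bounded_linear_inner_left]) auto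
    qed
    with du show ?case by simp
  qed
  with eq w show ?thesis unfolding smooth_def by blast
qed

text \<open>As B vanishes at 0, it has norm at most 1/2 nearby. Multiplied by a cutoff it has this
  bound everywhere, id + B' x is always invertible, and the original equation is recovered where the
  cutoff equals 1. The bound in the conclusion gives uniqueness of the pointwise solution near
  0.\<close>

lemma exists_smooth_linear_solution:
  fixes B :: "'a::euclidean_space \<Rightarrow> 'v::euclidean_space \<Rightarrow> 'v"
  assumes lin: "\<And>x. linear (B x)" and smB: "\<And>v. smooth (\<lambda>x. B x v)"
    and z: "\<And>v. B 0 v = 0" and w: "smooth w"
  obtains u e where "smooth u" "e > 0" "\<And>x. norm x < e \<Longrightarrow> u x + B x (u x) = w x"
    "\<And>x v. norm x < e \<Longrightarrow> norm (B x v) \<le> norm v / 2"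
proof -
  have "\<exists>e>0. \<forall>x. norm x < e \<longrightarrow> (\<forall>v. norm (B x v) \<le> norm v / 2)"
  proof -
    have "((\<lambda>x. \<Sum>b\<in>Basis. norm (B x b)) \<longlongrightarrow> (\<Sum>b\<in>(Basis::'v set). norm (B 0 b))) (at 0)"
      using smooth_continuous[OF smB] by (intro tendsto_intros) (auto simp: continuous_within)
    then have "\<forall>\<^sub>F x in at 0. (\<Sum>b\<in>(Basis::'v set). norm (B x b)) < 1/2"
      using z by (intro order_tendstoD(2)[where y=0]) auto
    then obtain e where e: "e > 0" "\<And>x. norm x < e \<Longrightarrow> x \<noteq> 0 \<Longrightarrow> (\<Sum>b\<in>(Basis::'v set). norm (B x b)) < 1/2"
      by (auto simp: eventually_at)
    have "norm (B x v) \<le> norm v / 2" if "norm x < e" for x v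
    proof (cases "x = 0")
      case False
      have "norm (B x v) \<le> (\<Sum>b\<in>Basis. norm ((v \<bullet> b) *\<^sub>R B x b))"
        by (subst linear_basis_expand[OF lin]) (rule norm_sum)
      also have "\<dots> \<le> (\<Sum>b\<in>Basis. norm v * norm (B x b))"
        by (intro sum_mono) (auto intro!: mult_right_mono simp: Basis_le_norm)
      also have "\<dots> = norm v * (\<Sum>b\<in>Basis. norm (B x b))" by (simp add: sum_distrib_left)
      also have "\<dots> \<le> norm v * (1/2)" using e(2)[OF that False] by (intro mult_left_mono) auto
      finally show ?thesis by simp
    qed (simp add: z)
    with e(1) show ?thesis by blast
  qed
  then obtain e where e: "e > 0" "\<And>x v. norm x < e \<Longrightarrow> norm (B x v) \<le> norm v / 2" by blast
  obtain \<theta> :: "'a \<Rightarrow> real" and d where \<theta>: "smooth \<theta>" "d > 0" "\<And>x. 0 \<le> \<theta> x" "\<And>x. \<theta> x \<le> 1"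
      "\<And>x. norm x < d \<Longrightarrow> \<theta> x = 1" "\<And>x. norm x \<ge> e \<Longrightarrow> \<theta> x = 0"
    using smooth_cutoff[OF e(1)] by metis
  define B' where "B' = (\<lambda>x v. \<theta> x *\<^sub>R B x v)"
  have lin': "linear (B' x)" for x
    unfolding B'_def by (rule linear_compose_scale_right[OF lin])
  have half: "norm (B' x v) \<le> norm v / 2" for x v
  proof (cases "norm x < e")
    case True
    have "norm (B' x v) \<le> 1 * norm (B x v)"
      unfolding B'_def norm_scaleR using \<theta>(3,4)[of x] by (intro mult_right_mono) auto
    with e(2)[OF True, of v] show ?thesis by simp
  qed (use \<theta>(6) in \<open>simp add: B'_def\<close>)
  have "\<exists>u. u + B' x u = w x" for x
  proof -
    have l: "linear (\<lambda>v. v + B' x v)" using lin'[of x] linear_id by (intro linear_compose_add) (auto simp: id_def)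
    moreover have "inj (\<lambda>v. v + B' x v)"
      unfolding linear_injective_0[OF l]
    proof (intro allI impI)
      fix v assume "v + B' x v = 0"
      then have "norm v = norm (B' x v)" by (metis norm_minus_cancel add_eq_0_iff)
      with half[of x v] show "v = 0" by simp
    qed
    ultimately have "surj (\<lambda>v. v + B' x v)" by (rule linear_injective_imp_surjective) simp
    then show ?thesis by (metis surjD)
  qed
  then obtain u where u: "\<And>x. u x + B' x (u x) = w x" by metis
  have "smooth u"
    by (rule smooth_linear_solve[OF lin' half _ u w])
      (auto simp: B'_def intro: smooth_scaleR \<theta> smB)
  moreover have "u x + B x (u x) = w x" if "norm x < min d e" for x
    using u[of x] \<theta>(5)[of x] that by (simp add: B'_def)
  ultimately show thesis using that[of u "min d e"] e \<theta>(2) by simp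
qed

subsection \<open>Orders of vanishing and Taylor expansions\<close>

text \<open>The condition h = O(|x|^m) at 0. The neighbourhood contains 0 itself, so for m > 0 the
  condition includes h 0 = 0.\<close>

definition vanish_order :: "nat \<Rightarrow> ('a::real_normed_vector \<Rightarrow> 'b::real_normed_vector) \<Rightarrow> bool" where
  "vanish_order m h \<longleftrightarrow> (\<exists>C. \<forall>\<^sub>F x in nhds 0. norm (h x) \<le> C * norm x ^ m)"

lemma vanish_orderE:
  assumes "vanish_order m h"
  obtains C where "C \<ge> 0" "\<forall>\<^sub>F x in nhds 0. norm (h x) \<le> C * norm x ^ m"
proof -
  obtain C where C: "\<forall>\<^sub>F x in nhds 0. norm (h x) \<le> C * norm x ^ m"
    using assms by (auto simp: vanish_order_def)
  have "\<forall>\<^sub>F x in nhds 0. norm (h x) \<le> max C 0 * norm x ^ m"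
    using C by eventually_elim (erule order_trans, intro mult_right_mono, auto)
  then show thesis using that[of "max C 0"] by simp
qed

lemma eventually_small: "e > 0 \<Longrightarrow> \<forall>\<^sub>F x in nhds (0::'a::real_normed_vector). norm x < e"
  by (auto simp: eventually_nhds_metric dist_norm)

lemma vanish_order_cong:
  assumes "\<forall>\<^sub>F x in nhds 0. f x = g x" "vanish_order m f" shows "vanish_order m g"
proof -
  obtain C where "\<forall>\<^sub>F x in nhds 0. norm (f x) \<le> C * norm x ^ m"
    using assms(2) by (auto simp: vanish_order_def)
  with assms(1) have "\<forall>\<^sub>F x in nhds 0. norm (g x) \<le> C * norm x ^ m" by eventually_elim simp
  then show ?thesis by (auto simp: vanish_order_def)
qed

lemma vanish_order_imp_0: "vanish_order m f \<Longrightarrow> 0 < m \<Longrightarrow> f 0 = 0"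
  by (auto simp: vanish_order_def zero_power dest!: eventually_nhds_x_imp_x)

lemma vanish_order_zero [simp]: "vanish_order m (\<lambda>x. 0)"
  by (auto simp: vanish_order_def intro: exI[of _ 0])

lemma vanish_order_add:
  assumes "vanish_order m f" "vanish_order m g" shows "vanish_order m (\<lambda>x. f x + g x)"
proof -
  obtain C D where "\<forall>\<^sub>F x in nhds 0. norm (f x) \<le> C * norm x ^ m"
    "\<forall>\<^sub>F x in nhds 0. norm (g x) \<le> D * norm x ^ m"
    using assms by (auto simp: vanish_order_def)
  then have "\<forall>\<^sub>F x in nhds 0. norm (f x + g x) \<le> (C + D) * norm x ^ m"
    by eventually_elim (rule norm_triangle_le, simp add: algebra_simps)
  then show ?thesis by (auto simp: vanish_order_def)
qed

lemma vanish_order_linear_comp: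
  assumes L: "bounded_linear L" and f: "vanish_order m f" shows "vanish_order m (\<lambda>x. L (f x))"
proof -
  obtain C where C: "\<forall>\<^sub>F x in nhds 0. norm (f x) \<le> C * norm x ^ m"
    using f by (auto simp: vanish_order_def)
  obtain K where K: "K > 0" "\<And>x. norm (L x) \<le> norm x * K"
    using bounded_linear.pos_bounded[OF L] by blast
  from C have "\<forall>\<^sub>F x in nhds 0. norm (L (f x)) \<le> (C * K) * norm x ^ m"
  proof eventually_elim
    case (elim x)
    have "norm (L (f x)) \<le> norm (f x) * K" by (rule K)
    also have "\<dots> \<le> C * norm x ^ m * K" using elim(1) K(1) by (intro mult_right_mono) auto
    finally show ?case by (simp add: mult_ac)
  qed
  then show ?thesis by (auto simp: vanish_order_def)
qed

lemma vanish_order_uminus: "vanish_order m f \<Longrightarrow> vanish_order m (\<lambda>x. - f x)"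
  by (rule vanish_order_linear_comp[OF bounded_linear_minus[OF bounded_linear_ident]])

lemma vanish_order_diff:
  "vanish_order m f \<Longrightarrow> vanish_order m g \<Longrightarrow> vanish_order m (\<lambda>x. f x - g x)"
  using vanish_order_add[OF _ vanish_order_uminus] by fastforce

lemma vanish_order_sum:
  "finite I \<Longrightarrow> (\<And>i. i \<in> I \<Longrightarrow> vanish_order m (f i)) \<Longrightarrow> vanish_order m (\<lambda>x. \<Sum>i\<in>I. f i x)"
  by (induction I rule: finite_induct) (auto intro: vanish_order_add)

lemma vanish_order_mono:
  assumes "vanish_order n f" "m \<le> n" shows "vanish_order m f"
proof -
  obtain C where C: "C \<ge> 0" "\<forall>\<^sub>F x in nhds 0. norm (f x) \<le> C * norm x ^ n"
    using assms by (blast elim: vanish_orderE)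
  have "\<forall>\<^sub>F x in nhds 0. norm (f x) \<le> C * norm x ^ m"
    using C(2) eventually_small[of 1, OF zero_less_one]
  proof eventually_elim
    case (elim x)
    have "C * norm x ^ n \<le> C * norm x ^ m"
      using elim(2) assms(2) C(1) by (intro mult_left_mono power_decreasing) auto
    with elim(1) show ?case by simp
  qed
  then show ?thesis by (auto simp: vanish_order_def)
qed

lemma vanish_order_bilinear:
  assumes p: "bounded_bilinear p" and f: "vanish_order m f" and g: "vanish_order n g"
  shows "vanish_order (m + n) (\<lambda>x. p (f x) (g x))"
proof -
  obtain C where C: "C \<ge> 0" "\<forall>\<^sub>F x in nhds 0. norm (f x) \<le> C * norm x ^ m"
    using f by (blast elim: vanish_orderE)
  obtain D where D: "D \<ge> 0" "\<forall>\<^sub>F x in nhds 0. norm (g x) \<le> D * norm x ^ n"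
    using g by (blast elim: vanish_orderE)
  obtain K where K: "K > 0" "\<And>x y. norm (p x y) \<le> norm x * norm y * K"
    using bounded_bilinear.pos_bounded[OF p] by blast
  from C(2) D(2) have "\<forall>\<^sub>F x in nhds 0. norm (p (f x) (g x)) \<le> (C * D * K) * norm x ^ (m + n)"
  proof eventually_elim
    case (elim x)
    have "norm (p (f x) (g x)) \<le> norm (f x) * norm (g x) * K" by (rule K)
    also have "\<dots> \<le> (C * norm x ^ m) * (D * norm x ^ n) * K"
      using elim C(1) D(1) K(1) by (intro mult_right_mono mult_mono) auto
    finally show ?case by (simp add: mult_ac power_add)
  qed
  then show ?thesis by (auto simp: vanish_order_def)
qed

lemma vanish_order_tendsto:
  assumes "vanish_order (Suc m) f" shows "filterlim f (nhds 0) (nhds 0)"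
proof -
  obtain C where C: "\<forall>\<^sub>F x in nhds 0. norm (f x) \<le> C * norm x ^ Suc m"
    using assms by (auto simp: vanish_order_def)
  have "((\<lambda>x::'a. C * norm x ^ Suc m) \<longlongrightarrow> C * norm (0::'a) ^ Suc m) (nhds 0)"
    by (intro tendsto_intros filterlim_ident)
  then have "((\<lambda>x::'a. C * norm x ^ Suc m) \<longlongrightarrow> 0) (nhds 0)" by simp
  with C show ?thesis by (rule Lim_null_comparison)
qed

lemma vanish_order_compose:
  assumes f: "vanish_order m f" and g: "vanish_order 1 g" shows "vanish_order m (\<lambda>x. f (g x))"
proof -
  obtain C where C: "C \<ge> 0" "\<forall>\<^sub>F x in nhds 0. norm (f x) \<le> C * norm x ^ m"
    using f by (blast elim: vanish_orderE)
  obtain D where D: "D \<ge> 0" "\<forall>\<^sub>F x in nhds 0. norm (g x) \<le> D * norm x ^ 1"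
    using g by (blast elim: vanish_orderE)
  have "\<forall>\<^sub>F x in nhds 0. norm (f (g x)) \<le> C * norm (g x) ^ m"
    using filterlim_iff[THEN iffD1, OF vanish_order_tendsto[of 0 g], rule_format, OF _ C(2)] g by simp
  with D(2) have "\<forall>\<^sub>F x in nhds 0. norm (f (g x)) \<le> (C * D ^ m) * norm x ^ m"
  proof eventually_elim
    case (elim x)
    have "C * norm (g x) ^ m \<le> C * (D * norm x) ^ m"
      using elim(1) C(1) by (intro mult_left_mono power_mono) auto
    with elim(2) show ?case by (simp add: power_mult_distrib mult_ac)
  qed
  then show ?thesis by (auto simp: vanish_order_def)
qed

text \<open>Compactness bounds p on the closed unit ball, and homogeneity rescales the bound to
  every x.\<close>

lemma vanish_order_homogeneous:
  fixes p :: "'a::euclidean_space \<Rightarrow> 'b::real_normed_vector"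
  assumes h: "\<And>c x. p (c *\<^sub>R x) = c ^ d *\<^sub>R p x" and c: "continuous_on UNIV p"
  shows "vanish_order d p"
proof -
  have "compact (p ` cball 0 1)"
    using c by (intro compact_continuous_image) (auto intro: continuous_on_subset)
  then have "bounded (p ` cball 0 1)" by (rule compact_imp_bounded)
  then obtain C where C: "\<And>x. x \<in> cball 0 1 \<Longrightarrow> norm (p x) \<le> C"
    unfolding bounded_iff by blast
  have "norm (p x) \<le> C * norm x ^ d" for x
  proof (cases "x = 0")
    case True
    show ?thesis
    proof (cases d)
      case 0
      then show ?thesis using C[of 0] True by simp
    next
      case (Suc d')
      have "p 0 = 0" using h[of 0 0] Suc by simp
      then show ?thesis using True Suc by simp
    qed
  next
    case False
    have "p x = norm x ^ d *\<^sub>R p ((1 / norm x) *\<^sub>R x)"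
      using h[of "norm x" "(1 / norm x) *\<^sub>R x"] False by simp
    then have "norm (p x) = norm (p ((1 / norm x) *\<^sub>R x)) * norm x ^ d"
      by (metis abs_norm_cancel mult.commute norm_scaleR power_abs)
    also have "\<dots> \<le> C * norm x ^ d"
      using False by (intro mult_right_mono C) auto
    finally show ?thesis .
  qed
  then show ?thesis unfolding vanish_order_def by (intro exI always_eventually allI)
qed

lemma smooth_continuous_on: "smooth f \<Longrightarrow> continuous_on A f"
  by (meson continuous_at_imp_continuous_on smooth_continuous)

lemma vanish_order_linear:
  fixes f :: "'a::euclidean_space \<Rightarrow> 'b::real_normed_vector"
  shows "linear f \<Longrightarrow> vanish_order 1 f"
  by (rule vanish_order_homogeneous)
    (auto simp: linear_scale smooth_continuous_on smooth_linear)

text \<open>Differentiate p (c x) in two ways and cancel one factor c. For c = 0 nothing can be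
  cancelled; this value follows by continuity in c.\<close>

lemma frechet_derivative_homogeneous:
  fixes p :: "'a::euclidean_space \<Rightarrow> 'b::real_normed_vector"
  assumes s: "smooth p" and h: "\<And>c x. p (c *\<^sub>R x) = c ^ Suc d *\<^sub>R p x"
  shows "frechet_derivative p (at (c *\<^sub>R x)) v = c ^ d *\<^sub>R frechet_derivative p (at x) v"
proof -
  have nz: "frechet_derivative p (at (c *\<^sub>R x)) v = c ^ d *\<^sub>R frechet_derivative p (at x) v"
    if "c \<noteq> 0" for c
  proof -
    have d1: "((\<lambda>x. p (c *\<^sub>R x)) has_derivative (\<lambda>v. frechet_derivative p (at (c *\<^sub>R x)) (c *\<^sub>R v))) (at x)"
      by (rule has_derivative_compose[OF _ smooth_has_derivative[OF s]])
        (rule bounded_linear_imp_has_derivative[OF bounded_linear_scaleR_right])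
    have d2: "((\<lambda>x. p (c *\<^sub>R x)) has_derivative (\<lambda>v. c ^ Suc d *\<^sub>R frechet_derivative p (at x) v)) (at x)"
      unfolding h by (intro has_derivative_scaleR_right smooth_has_derivative s)
    have "frechet_derivative p (at (c *\<^sub>R x)) (c *\<^sub>R v) = c ^ Suc d *\<^sub>R frechet_derivative p (at x) v"
      using has_derivative_unique[OF d1 d2] by metis
    then have "c *\<^sub>R frechet_derivative p (at (c *\<^sub>R x)) v = c *\<^sub>R (c ^ d *\<^sub>R frechet_derivative p (at x) v)"
      by (simp add: linear_scale[OF linear_smooth_frechet[OF s]])
    with that show ?thesis by (metis scaleR_left_imp_eq)
  qed
  show ?thesis
  proof (cases "c = 0")
    case True
    let ?g = "\<lambda>c. frechet_derivative p (at (c *\<^sub>R x)) v"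
    have "isCont (\<lambda>x. frechet_derivative p (at x) v) (0 *\<^sub>R x)"
      by (rule smooth_continuous[OF smooth_dir_deriv[OF s]])
    moreover have "isCont (\<lambda>c. c *\<^sub>R x) 0" by (intro continuous_intros)
    ultimately have "isCont ?g 0" by (rule isCont_o2[rotated])
    then have "(?g \<longlongrightarrow> ?g 0) (at 0)" by (simp add: continuous_within)
    moreover have "((\<lambda>c. c ^ d *\<^sub>R frechet_derivative p (at x) v) \<longlongrightarrow> 0 ^ d *\<^sub>R frechet_derivative p (at x) v) (at 0)"
      by (intro tendsto_intros)
    then have "(?g \<longlongrightarrow> 0 ^ d *\<^sub>R frechet_derivative p (at x) v) (at 0)"
      by (rule Lim_transform_eventually) (use nz in \<open>simp add: eventually_at_filter\<close>)
    ultimately have "?g 0 = 0 ^ d *\<^sub>R frechet_derivative p (at x) v"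
      by (rule tendsto_unique[OF trivial_limit_at])
    with True show ?thesis by simp
  qed (rule nz)
qed

section \<open>Iterated directional derivatives and Taylor's formula\<close>

lemma dir_deriv_eq: "dir_deriv v f = (\<lambda>x. frechet_derivative f (at x) v)"
  by (simp add: dir_deriv_def fun_eq_iff)

lemma dir_deriv_pow_smooth: "smooth f \<Longrightarrow> smooth ((dir_deriv v ^^ m) f)"
  by (induction m) (auto simp: dir_deriv_eq intro: smooth_dir_deriv)

lemma dir_deriv_pow_sum:
  assumes "finite I" "\<And>i. i \<in> I \<Longrightarrow> smooth (f i)"
  shows "(dir_deriv v ^^ m) (\<lambda>x. \<Sum>i\<in>I. c i *\<^sub>R f i x) = (\<lambda>x. \<Sum>i\<in>I. c i *\<^sub>R (dir_deriv v ^^ m) (f i) x)"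
proof (induction m)
  case (Suc m)
  have "((\<lambda>x. \<Sum>i\<in>I. c i *\<^sub>R (dir_deriv v ^^ m) (f i) x) has_derivative
      (\<lambda>w. \<Sum>i\<in>I. c i *\<^sub>R frechet_derivative ((dir_deriv v ^^ m) (f i)) (at x) w)) (at x)" for x
    using assms by (intro has_derivative_sum has_derivative_scaleR_right smooth_has_derivative
        dir_deriv_pow_smooth)
  note fd = frechet_derivative_at[OF this, symmetric]
  show ?case
    by (simp only: funpow.simps o_apply Suc fd dir_deriv_eq[of v "(dir_deriv v ^^ m) (f _)"]
        dir_deriv_eq[of v "\<lambda>x. \<Sum>i\<in>I. c i *\<^sub>R (dir_deriv v ^^ m) (f i) x"])
qed simp

text \<open>Only the derivative taken first is expanded; the other m then act on a map that does not
  depend on v. By induction this makes the dependence on v explicit, as a polynomial and with bounds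
  uniform on a ball.\<close>

lemma dir_deriv_pow_expand:
  fixes f :: "'a::euclidean_space \<Rightarrow> 'b::real_normed_vector"
  assumes f: "smooth f"
  shows "(dir_deriv v ^^ Suc m) f = (\<lambda>x. \<Sum>b\<in>Basis. (v \<bullet> b) *\<^sub>R (dir_deriv v ^^ m) (dir_deriv b f) x)"
proof -
  have "dir_deriv v f = (\<lambda>x. \<Sum>b\<in>Basis. (v \<bullet> b) *\<^sub>R dir_deriv b f x)"
    unfolding dir_deriv_def using frechet_derivative_basis[OF smooth_differentiable[OF f]] by fast
  then have "(dir_deriv v ^^ Suc m) f = (dir_deriv v ^^ m) (\<lambda>x. \<Sum>b\<in>Basis. (v \<bullet> b) *\<^sub>R dir_deriv b f x)"
    by (simp add: funpow_Suc_right del: funpow.simps)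
  also have "\<dots> = (\<lambda>x. \<Sum>b\<in>Basis. (v \<bullet> b) *\<^sub>R (dir_deriv v ^^ m) (dir_deriv b f) x)"
    using dir_deriv_pow_smooth[OF f, of 1] by (intro dir_deriv_pow_sum) auto
  finally show ?thesis .
qed

lemma smooth_dir_deriv': "smooth f \<Longrightarrow> smooth (dir_deriv v f)"
  using dir_deriv_pow_smooth[of f 1] by simp

lemma polynomial_dir_deriv_pow:
  fixes f :: "'a::euclidean_space \<Rightarrow> 'b::euclidean_space"
  shows "smooth f \<Longrightarrow> polynomial_function (\<lambda>v. (dir_deriv v ^^ m) f x)"
proof (induction m arbitrary: f)
  case (Suc m)
  show ?case unfolding dir_deriv_pow_expand[OF Suc.prems]
    using Suc by (intro polynomial_function_sum polynomial_function_mult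
        polynomial_function_bounded_linear[OF bounded_linear_inner_left] smooth_dir_deriv'
        Suc.IH) auto
qed auto

lemma dir_deriv_pow_scale:
  assumes "smooth f" shows "(dir_deriv (c *\<^sub>R v) ^^ m) f = (\<lambda>x. c ^ m *\<^sub>R (dir_deriv v ^^ m) f x)"
proof (induction m)
  case (Suc m)
  have "((\<lambda>x. c ^ m *\<^sub>R (dir_deriv v ^^ m) f x) has_derivative
      (\<lambda>w. c ^ m *\<^sub>R frechet_derivative ((dir_deriv v ^^ m) f) (at x) w)) (at x)" for x
    using assms by (intro has_derivative_scaleR_right smooth_has_derivative dir_deriv_pow_smooth)
  note fd = frechet_derivative_at[OF this, symmetric]
  show ?case
    by (simp only: funpow.simps o_apply Suc fd scaleR_scaleR power_Suc
        dir_deriv_eq[of v "(dir_deriv v ^^ m) f"] mult.commute[of c]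
        dir_deriv_eq[of "c *\<^sub>R v" "\<lambda>x. c ^ m *\<^sub>R (dir_deriv v ^^ m) f x"]
        linear_scale[OF linear_smooth_frechet[OF dir_deriv_pow_smooth[OF assms]]])
qed simp

lemma dir_deriv_pow_bound:
  fixes f :: "'a::euclidean_space \<Rightarrow> 'b::real_normed_vector"
  shows "smooth f \<Longrightarrow> \<exists>C\<ge>0. \<forall>y\<in>cball 0 1. \<forall>v. norm ((dir_deriv v ^^ m) f y) \<le> C * norm v ^ m"
proof (induction m arbitrary: f)
  case 0
  have "compact (f ` cball 0 1)"
    using 0 by (intro compact_continuous_image smooth_continuous_on) auto
  then have "bounded (f ` cball 0 1)" by (rule compact_imp_bounded)
  then obtain C where C: "\<And>x. x \<in> cball 0 1 \<Longrightarrow> norm (f x) \<le> C"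
    unfolding bounded_iff by blast
  have "0 \<le> C" by (rule order_trans[OF norm_ge_zero C[of 0]]) simp
  with C show ?case by auto
next
  case (Suc m)
  have "\<forall>b. \<exists>C\<ge>0. \<forall>y\<in>cball 0 1. \<forall>v. norm ((dir_deriv v ^^ m) (dir_deriv b f) y) \<le> C * norm v ^ m"
    using Suc.IH smooth_dir_deriv'[OF Suc.prems] by blast
  then obtain C where C: "\<And>b. C b \<ge> 0"
    "\<And>b y v. y \<in> cball 0 1 \<Longrightarrow> norm ((dir_deriv v ^^ m) (dir_deriv b f) y) \<le> C b * norm v ^ m"
    by metis
  have "norm ((dir_deriv v ^^ Suc m) f y) \<le> (\<Sum>b\<in>Basis. C b) * norm v ^ Suc m"
    if "y \<in> cball 0 1" for y v
  proof -
    have "norm ((dir_deriv v ^^ Suc m) f y)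
        \<le> (\<Sum>b\<in>Basis. norm ((v \<bullet> b) *\<^sub>R (dir_deriv v ^^ m) (dir_deriv b f) y))"
      unfolding dir_deriv_pow_expand[OF Suc.prems] by (rule norm_sum)
    also have "\<dots> \<le> (\<Sum>b\<in>Basis. norm v * (C b * norm v ^ m))"
      unfolding norm_scaleR using C[of y] that by (intro sum_mono mult_mono) (auto simp: Basis_le_norm)
    also have "\<dots> = (\<Sum>b\<in>Basis. C b) * norm v ^ Suc m"
      by (simp add: sum_distrib_right sum_distrib_left mult_ac)
    finally show ?thesis .
  qed
  with C(1) show ?case by (intro exI[of _ "\<Sum>b\<in>Basis. C b"]) (simp add: sum_nonneg)
qed

text \<open>Maclaurin's formula on the segment from 0 to x, for each coordinate separately because
  the intermediate point depends on the coordinate. \<open>dir_deriv_pow_bound\<close> controls the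
  remainder uniformly for |x| < 1.\<close>

lemma taylor_remainder:
  fixes f :: "'a::euclidean_space \<Rightarrow> 'b::euclidean_space"
  assumes f: "smooth f"
  shows "vanish_order n (\<lambda>x. f x - (\<Sum>j<n. (1 / fact j) *\<^sub>R (dir_deriv x ^^ j) f 0))"
proof -
  obtain C where C: "C \<ge> 0"
    "\<And>y v. y \<in> cball 0 1 \<Longrightarrow> norm ((dir_deriv v ^^ n) f y) \<le> C * norm v ^ n"
    using dir_deriv_pow_bound[OF f] by metis
  have "norm (f x - (\<Sum>j<n. (1 / fact j) *\<^sub>R (dir_deriv x ^^ j) f 0)) \<le> (DIM('b) * C) * norm x ^ n"
    if x: "norm x < 1" for x
  proof -
    let ?R = "f x - (\<Sum>j<n. (1 / fact j) *\<^sub>R (dir_deriv x ^^ j) f 0)"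
    have "\<bar>?R \<bullet> b\<bar> \<le> C * norm x ^ n" if b: "b \<in> Basis" for b
    proof -
      define \<phi> where "\<phi> j s = (dir_deriv x ^^ j) f (s *\<^sub>R x) \<bullet> b" for j and s :: real
      have "(\<phi> j has_real_derivative \<phi> (Suc j) s) (at s)" for j s
      proof -
        have "((\<lambda>s. (dir_deriv x ^^ j) f (s *\<^sub>R x)) has_derivative
            (\<lambda>h. frechet_derivative ((dir_deriv x ^^ j) f) (at (s *\<^sub>R x)) (h *\<^sub>R x))) (at s)"
          by (rule has_derivative_compose[OF _ smooth_has_derivative[OF dir_deriv_pow_smooth[OF f]]])
            (rule bounded_linear_imp_has_derivative[OF bounded_linear_scaleR_left])
        from has_derivative_inner_left[OF this, of b] show ?thesis
          unfolding \<phi>_def has_field_derivative_def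
          by (simp add: linear_scale[OF linear_smooth_frechet[OF dir_deriv_pow_smooth[OF f]]]
              dir_deriv_def[of x "(dir_deriv x ^^ j) f"] mult_commute_abs)
      qed
      then obtain t where t: "0 < t" "t \<le> 1"
        "\<phi> 0 1 = (\<Sum>m<n. \<phi> m 0 / fact m * 1 ^ m) + \<phi> n t / fact n * 1 ^ n"
        using Maclaurin2[of 1 \<phi> "\<phi> 0" n] by auto
      then have "?R \<bullet> b = \<phi> n t / fact n"
        by (simp add: \<phi>_def inner_diff_left inner_sum_left)
      moreover have "\<bar>\<phi> n t\<bar> \<le> C * norm x ^ n"
      proof -
        have "t * norm x \<le> 1 * 1" using t x by (intro mult_mono) auto
        then have "norm ((dir_deriv x ^^ n) f (t *\<^sub>R x)) \<le> C * norm x ^ n"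
          using t by (intro C) (auto simp: abs_mult)
        then show ?thesis using Basis_le_norm[OF b, of "(dir_deriv x ^^ n) f (t *\<^sub>R x)"]
          by (simp add: \<phi>_def)
      qed
      moreover have "\<bar>\<phi> n t / fact n\<bar> \<le> \<bar>\<phi> n t\<bar>"
        using fact_ge_1[of n, where 'a=real] by (simp add: divide_le_eq mult_le_cancel_left1)
      ultimately show ?thesis by linarith
    qed
    then have "(\<Sum>b\<in>Basis. \<bar>?R \<bullet> b\<bar>) \<le> (\<Sum>b\<in>(Basis::'b set). C * norm x ^ n)" by (rule sum_mono)
    with norm_le_l1[of ?R] show ?thesis by (simp add: mult_ac)
  qed
  then show ?thesis unfolding vanish_order_def
    by (intro exI[of _ "DIM('b) * C"] eventually_mono[OF eventually_small[of 1]]) auto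
qed

lemma taylor_expansion:
  fixes f :: "'a::euclidean_space \<Rightarrow> 'b::euclidean_space"
  assumes f: "smooth f" "f 0 = 0"
  shows "vanish_order (Suc n) (\<lambda>x. f x - (\<Sum>k<n. taylor_part k f x))"
  using taylor_remainder[OF f(1), of "Suc n"] f(2)
  by (simp add: sum.lessThan_Suc_shift taylor_part_def del: funpow.simps(2) sum.lessThan_Suc fact_Suc)

lemma P_smooth: "p \<in> P k \<Longrightarrow> smooth (p :: 'a::real_normed_vector \<Rightarrow> 'b::euclidean_space)"
  by (auto simp: P_def homogeneous_polynomial_def smooth_polynomial_function)

lemma taylor_part_in_P:
  fixes f :: "'a::euclidean_space \<Rightarrow> 'b::euclidean_space"
  assumes "smooth f" shows "taylor_part k f \<in> P k"
  unfolding P_def homogeneous_polynomial_def mem_Collect_eq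
proof (intro conjI allI)
  show "polynomial_function (taylor_part k f)"
    unfolding taylor_part_def[abs_def]
    by (intro polynomial_function_mult polynomial_function_const polynomial_dir_deriv_pow assms)
qed (simp add: taylor_part_def dir_deriv_pow_scale[OF assms] del: funpow.simps)

lemma linear_taylor_part_0:
  assumes "smooth f" shows "linear (taylor_part 0 f)"
  using linear_smooth_frechet[OF assms, of 0] by (simp add: taylor_part_def[abs_def] dir_deriv_def)

lemma vanish_order_sub_linear_part:
  fixes f :: "'a::euclidean_space \<Rightarrow> 'b::euclidean_space"
  assumes "smooth f" "f 0 = 0" shows "vanish_order 2 (\<lambda>X. f X - taylor_part 0 f X)"
  using taylor_expansion[OF assms, of 1] by (simp add: numeral_2_eq_2)

text \<open>The limit s -> 0 isolates \<open>v 0\<close>; once this is zero, one factor s cancels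
  from the sum and from the bound, and the argument repeats.\<close>

lemma power_expansion_unique:
  fixes v :: "nat \<Rightarrow> 'b::real_normed_vector"
  assumes "\<forall>\<^sub>F s in at_right 0. norm (\<Sum>k<n. s ^ k *\<^sub>R v k) \<le> C * s ^ n" "k < n"
  shows "v k = 0"
  using assms
proof (induction n arbitrary: v k)
  case (Suc n)
  have "((\<lambda>s::real. \<Sum>k<Suc n. s ^ k *\<^sub>R v k) \<longlongrightarrow> (\<Sum>k<Suc n. 0 ^ k *\<^sub>R v k)) (at_right 0)"
    by (intro tendsto_intros)
  moreover have "(\<Sum>k<Suc n. (0::real) ^ k *\<^sub>R v k) = v 0"
    by (simp add: sum.lessThan_Suc_shift del: sum.lessThan_Suc)
  moreover have "((\<lambda>s::real. C * s ^ Suc n) \<longlongrightarrow> C * 0 ^ Suc n) (at_right 0)"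
    by (intro tendsto_intros)
  then have "((\<lambda>s::real. \<Sum>k<Suc n. s ^ k *\<^sub>R v k) \<longlongrightarrow> 0) (at_right 0)"
    using Lim_null_comparison[OF Suc.prems(1)] by simp
  ultimately have v0: "v 0 = 0" using tendsto_unique[OF trivial_limit_at_right_real] by fastforce
  have "\<forall>\<^sub>F s in at_right 0. norm (\<Sum>k<n. s ^ k *\<^sub>R v (Suc k)) \<le> C * s ^ n"
    using Suc.prems(1) eventually_at_right_less[of 0]
  proof eventually_elim
    case (elim s)
    have "(\<Sum>k<Suc n. s ^ k *\<^sub>R v k) = s *\<^sub>R (\<Sum>k<n. s ^ k *\<^sub>R v (Suc k))"
      by (simp add: sum.lessThan_Suc_shift v0 scaleR_sum_right del: sum.lessThan_Suc)
    then have "s * norm (\<Sum>k<n. s ^ k *\<^sub>R v (Suc k)) \<le> s * (C * s ^ n)"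
      using elim by (simp add: mult_ac)
    then show ?case using elim(2) by simp
  qed
  from Suc.IH[OF this] Suc.prems(2) v0 show ?case by (cases k) auto
qed simp

text \<open>On the ray through x every summand is a power of s times its value at x. All degrees are
  at least 1, so a factor s can be removed, which turns degree k + 1 into exponent k.\<close>

lemma homogeneous_sum_unique:
  assumes v: "vanish_order (Suc n) (\<lambda>x. \<Sum>k<n. q k x)"
    and h: "\<And>k c x. k < n \<Longrightarrow> q k (c *\<^sub>R x) = c ^ Suc k *\<^sub>R q k x" and k: "k < n"
  shows "q k x = 0"
proof -
  obtain C where C: "\<forall>\<^sub>F x in nhds 0. norm (\<Sum>k<n. q k x) \<le> C * norm x ^ Suc n"
    using v by (auto simp: vanish_order_def)
  have "((\<lambda>s::real. s *\<^sub>R x) \<longlongrightarrow> 0 *\<^sub>R x) (at_right 0)" by (intro tendsto_intros)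
  then have "filterlim (\<lambda>s::real. s *\<^sub>R x) (nhds 0) (at_right 0)" by simp
  with C have "\<forall>\<^sub>F s in at_right 0. norm (\<Sum>k<n. q k (s *\<^sub>R x)) \<le> C * norm (s *\<^sub>R x) ^ Suc n"
    unfolding filterlim_iff by blast
  then have "\<forall>\<^sub>F s in at_right 0. norm (\<Sum>k<n. s ^ k *\<^sub>R q k x) \<le> (C * norm x ^ Suc n) * s ^ n"
    using eventually_at_right_less[of 0]
  proof eventually_elim
    case (elim s)
    have "(\<Sum>k<n. q k (s *\<^sub>R x)) = s *\<^sub>R (\<Sum>k<n. s ^ k *\<^sub>R q k x)"
      by (simp add: h scaleR_sum_right)
    then have "s * norm (\<Sum>k<n. s ^ k *\<^sub>R q k x) \<le> s * ((C * norm x ^ Suc n) * s ^ n)"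
      using elim by (simp add: mult_ac power_mult_distrib)
    then show ?case using elim(2) by simp
  qed
  from power_expansion_unique[OF this k] show ?thesis .
qed

lemma taylor_part_unique:
  fixes f :: "'a::euclidean_space \<Rightarrow> 'b::euclidean_space"
  assumes f: "smooth f" "f 0 = 0" and p: "\<And>k. k < n \<Longrightarrow> p k \<in> P k"
    and v: "vanish_order (Suc n) (\<lambda>x. f x - (\<Sum>k<n. p k x))" and k: "k < n"
  shows "taylor_part k f = p k"
proof -
  have "vanish_order (Suc n) (\<lambda>x. \<Sum>k<n. p k x - taylor_part k f x)"
    using vanish_order_diff[OF taylor_expansion[OF f, of n] v]
    by (simp add: sum_subtractf)
  moreover have "p k (c *\<^sub>R x) - taylor_part k f (c *\<^sub>R x) = c ^ Suc k *\<^sub>R (p k x - taylor_part k f x)"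
    if "k < n" for k c x
    using p[OF that] taylor_part_in_P[OF f(1), of k]
    by (simp add: P_def homogeneous_polynomial_def scaleR_diff_right)
  ultimately have "p k x - taylor_part k f x = 0" for x
    by (rule homogeneous_sum_unique) (use k in auto)
  then show ?thesis by (simp add: fun_eq_iff)
qed

subsection \<open>Complements inside the generalized kernel\<close>

text \<open>The coordinates of x in the basis B are supported both in S and in T, hence
  nowhere.\<close>

lemma span_disjoint_Int:
  fixes B :: "'v::real_vector set"
  assumes B: "independent B" "S \<subseteq> B" "T \<subseteq> B" "S \<inter> T = {}" and x: "x \<in> span S" "x \<in> span T"
  shows "x = 0"
proof -
  have r: "representation B x = representation S x" "representation B x = representation T x"
    using representation_extend[of B x S] representation_extend[of B x T] B x by auto
  have "representation S x b = 0" for b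
    using representation_ne_zero[of S x b] representation_ne_zero[of T x b] r B(4) by auto
  moreover have "independent S" using B(1,2) independent_mono by blast
  ultimately show ?thesis using sum_nonzero_representation_eq[of S x] x(1) by simp
qed

lemma subspace_complement:
  fixes D :: "'v::real_vector set"
  assumes D: "subspace D" and K: "subspace K" and DK: "D \<subseteq> K"
  obtains N where "subspace N" "N \<subseteq> K" "N \<inter> D = {0}" "\<And>x. x \<in> K \<Longrightarrow> \<exists>n\<in>N. \<exists>d\<in>D. x = n + d"
proof -
  obtain b where b: "b \<subseteq> D" "independent b" "D \<subseteq> span b" using basis_exists by metis
  obtain B where B: "b \<subseteq> B" "B \<subseteq> K" "independent B" "K \<subseteq> span B"
    using maximal_independent_subset_extend[of b K] b DK by (metis subset_trans)
  show thesis
  proof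
    show "subspace (span (B - b))" by simp
    show "span (B - b) \<subseteq> K" using B(2) K by (intro span_minimal) auto
    have "x = 0" if "x \<in> span (B - b)" "x \<in> D" for x
      by (rule span_disjoint_Int[OF B(3), of "B - b" b]) (use that b B in auto)
    then show "span (B - b) \<inter> D = {0}" using D by (auto simp: span_zero subspace_0)
    fix x assume "x \<in> K"
    then have "x \<in> span ((B - b) \<union> b)" using B by (auto simp: Un_absorb2)
    then obtain n d where "x = n + d" "n \<in> span (B - b)" "d \<in> span b" unfolding span_Un by blast
    moreover have "span b \<subseteq> D" using b(1) D by (rule span_minimal)
    ultimately show "\<exists>n\<in>span (B - b). \<exists>d\<in>D. x = n + d" by blast
  qed
qed

text \<open>The space of all maps is infinite dimensional, so finiteness is supplied by the spanning
  set B. In the equality case, a vector of C outside A would extend a basis of A to more than dim C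
  independent vectors of C.\<close>

lemma subspace_dim_le:
  fixes A :: "'v::real_vector set"
  assumes A: "subspace A" "A \<subseteq> C" and C: "C \<subseteq> span B" "finite B"
  shows "dim A \<le> dim C" and "dim A = dim C \<Longrightarrow> A = C"
proof -
  obtain a where a: "a \<subseteq> A" "independent a" "A \<subseteq> span a" "card a = dim A" using basis_exists by metis
  obtain c where c: "c \<subseteq> C" "independent c" "C \<subseteq> span c" "card c = dim C" using basis_exists by metis
  have fc: "finite c" using independent_span_bound[OF C(2) c(2)] c(1) C(1) by blast
  have fa: "finite a" "card a \<le> card c"
    using independent_span_bound[OF fc a(2)] a(1) A(2) c(3) by auto
  then show "dim A \<le> dim C" using a c by simp
  assume eq: "dim A = dim C"
  show "A = C"
  proof (rule ccontr)
    assume "A \<noteq> C"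
    then obtain x where x: "x \<in> C" "x \<notin> A" using A by blast
    have "span a \<subseteq> A" using a(1) A(1) by (rule span_minimal)
    then have xa: "x \<notin> span a" "x \<notin> a" using x span_superset by blast+
    then have "independent (insert x a)" using a(2) by (simp add: independent_insert)
    moreover have "insert x a \<subseteq> span c" using x(1) a(1) A(2) c(3) by auto
    ultimately have "card (insert x a) \<le> card c" using independent_span_bound[OF fc] by blast
    then show False using xa(2) fa(1) a c eq by simp
  qed
qed

lemma decreasing_nat_stabilizes:
  fixes d :: "nat \<Rightarrow> nat"
  assumes "\<And>m. d (Suc m) \<le> d m"
  shows "\<exists>m. d (Suc m) = d m"
proof (rule ccontr)
  assume "\<not> ?thesis"
  then have "d (Suc m) < d m" for m using assms[of m] le_neq_implies_less by blast
  then have "d m + m \<le> d 0" for m by (induction m) (auto simp: less_eq_Suc_le intro: order_trans[rotated])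
  from this[of "Suc (d 0)"] show False by simp
qed

text \<open>Fitting: \<open>E\<close> is the sum of the kernel and the image of a high power of \<open>L\<close>.\<close>

lemma fitting_complement:
  fixes L :: "'v::real_vector \<Rightarrow> 'v"
  assumes E: "subspace E" "E \<subseteq> span B" "finite B" and LE: "\<And>x. x \<in> E \<Longrightarrow> L x \<in> E"
    and add: "\<And>x y. x \<in> E \<Longrightarrow> y \<in> E \<Longrightarrow> L (x + y) = L x + L y"
    and scale: "\<And>c x. x \<in> E \<Longrightarrow> L (c *\<^sub>R x) = c *\<^sub>R L x"
  obtains N m where "subspace N" "N \<subseteq> E" "is_direct_sum N (L ` E) E" "\<And>x. x \<in> N \<Longrightarrow> (L ^^ m) x = 0"
proof -
  \<comment> \<open>L is linear only on E (for \<open>ad\<close>, linearity rests on the smoothness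
    of the arguments), so the powers are shown to stay in E and to be linear there.\<close>
  have pE: "(L ^^ m) x \<in> E" if "x \<in> E" for m x using that LE by (induction m) auto
  have padd: "(L ^^ m) (x + y) = (L ^^ m) x + (L ^^ m) y" if "x \<in> E" "y \<in> E" for m x y
    using that add pE by (induction m) auto
  have pscale: "(L ^^ m) (c *\<^sub>R x) = c *\<^sub>R (L ^^ m) x" if "x \<in> E" for m c x
    using that scale pE by (induction m) auto
  have p0: "(L ^^ m) 0 = 0" for m using pscale[of 0 m 0] subspace_0[OF E(1)] by simp
  define I where "I m = (L ^^ m) ` E" for m
  have sub: "subspace (I m)" for m
    unfolding subspace_def
  proof (intro conjI ballI allI)
    show "0 \<in> I m" using p0[of m] subspace_0[OF E(1)] unfolding I_def by (metis imageI)
    show "x + y \<in> I m" if xy: "x \<in> I m" "y \<in> I m" for x y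
    proof -
      obtain x' y' where "x' \<in> E" "x = (L ^^ m) x'" "y' \<in> E" "y = (L ^^ m) y'"
        using xy by (auto simp: I_def)
      then show ?thesis using padd subspace_add[OF E(1)] unfolding I_def by (metis imageI)
    qed
    show "c *\<^sub>R x \<in> I m" if x: "x \<in> I m" for c x
    proof -
      obtain x' where "x' \<in> E" "x = (L ^^ m) x'" using x by (auto simp: I_def)
      then show ?thesis using pscale subspace_scale[OF E(1)] unfolding I_def by (metis imageI)
    qed
  qed
  have dec: "I (Suc m) \<subseteq> I m" for m
    using LE by (auto simp: I_def funpow_Suc_right simp del: funpow.simps)
  have IE: "I m \<subseteq> E" for m using pE by (auto simp: I_def)
  then have Isp: "I m \<subseteq> span B" for m using E(2) by blast
  obtain m where m: "dim (I (Suc m)) = dim (I m)"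
    using decreasing_nat_stabilizes[of "\<lambda>m. dim (I m)"] subspace_dim_le(1)[OF sub dec Isp E(3)] by metis
  then have eq: "I (Suc m) = I m" by (rule subspace_dim_le(2)[OF sub dec Isp E(3)])
  have stab: "I (m + j) = I m" for j
  proof (induction j)
    case (Suc j)
    have "I (m + Suc j) = L ` I (m + j)" by (auto simp: I_def image_image)
    also have "\<dots> = I (Suc m)" unfolding Suc by (auto simp: I_def image_image)
    finally show ?case using eq by simp
  qed simp
  \<comment> \<open>The images are constant from exponent m on; the additional 1 ensures that the
    image of L^M lies in the image of L even when m = 0.\<close>
  define M where "M = Suc m"
  define K where "K = {x \<in> E. (L ^^ M) x = 0}"
  have K: "subspace K"
    unfolding K_def subspace_def
    using E(1) p0 padd pscale by (auto simp: subspace_0 subspace_add subspace_scale)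
  have I1: "L ` E = I 1" by (simp add: I_def)
  have IM: "I M \<subseteq> I 1" unfolding M_def
  proof (induction m)
    case (Suc m) then show ?case using dec[of "Suc m"] by simp
  qed simp
  have dec_x: "\<exists>k\<in>K. \<exists>y\<in>L ` E. x = k + y" if x: "x \<in> E" for x
  proof -
    \<comment> \<open>L^M maps its own image onto itself, so the value of L^M at x is also attained
      at a point of that image; the difference between x and this point lies in K.\<close>
    have "I M = I (M + M)" using stab[of 1] stab[of "Suc M"] by (simp add: M_def)
    then have "(L ^^ M) x \<in> I (M + M)" using x unfolding I_def by blast
    then obtain y where y: "y \<in> E" "(L ^^ M) x = (L ^^ M) ((L ^^ M) y)"
      by (auto simp: I_def funpow_add)
    let ?z = "(L ^^ M) y"
    have z: "?z \<in> E" "- 1 *\<^sub>R ?z \<in> E" using pE[OF y(1)] subspace_scale[OF E(1)] by blast+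
    have "(L ^^ M) (x + - 1 *\<^sub>R ?z) = 0"
      by (simp only: padd[OF x z(2)] pscale[OF z(1)] y(2)) simp
    then have "x + - 1 *\<^sub>R ?z \<in> K" using subspace_add[OF E(1) x z(2)] by (simp add: K_def)
    moreover have "?z \<in> L ` E" using IM I1 y(1) unfolding I_def by blast
    ultimately show ?thesis by (intro bexI[of _ "x + - 1 *\<^sub>R ?z"] bexI[of _ ?z]) auto
  qed
  \<comment> \<open>K and the image of L may intersect; a complement of the intersection inside K
    makes the sum direct.\<close>
  obtain N where N: "subspace N" "N \<subseteq> K" "N \<inter> (K \<inter> L ` E) = {0}"
    "\<And>x. x \<in> K \<Longrightarrow> \<exists>n\<in>N. \<exists>d\<in>K \<inter> L ` E. x = n + d"
    using subspace_complement[of "K \<inter> L ` E" K] K sub[of 1] I1 by (metis inf_le1 subspace_inter)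
  show thesis
  proof (rule that[OF N(1)])
    show NE: "N \<subseteq> E" using N(2) by (auto simp: K_def)
    show "\<And>x. x \<in> N \<Longrightarrow> (L ^^ M) x = 0" using N(2) by (auto simp: K_def)
    have "{u + v |u v. u \<in> N \<and> v \<in> L ` E} = E"
    proof (intro equalityI subsetI)
      fix x assume "x \<in> E"
      then obtain k y where ky: "k \<in> K" "y \<in> L ` E" "x = k + y" using dec_x by blast
      moreover obtain n d where "n \<in> N" "d \<in> L ` E" "k = n + d" using N(4)[OF ky(1)] by blast
      moreover have "d + y \<in> L ` E" if "d \<in> L ` E" "y \<in> L ` E" for d y
        using sub[of 1] that I1 by (metis subspace_add)
      ultimately show "x \<in> {u + v |u v. u \<in> N \<and> v \<in> L ` E}" by (force simp: add.assoc)
    qed (use NE LE subspace_add[OF E(1)] in blast)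
    then show "is_direct_sum N (L ` E) E" unfolding is_direct_sum_def using N(2,3) by blast
  qed
qed

subsection \<open>Monomials\<close>

definition monom_fun :: "'a::euclidean_space list \<Rightarrow> 'a \<Rightarrow> real" where
  "monom_fun ws x = (\<Prod>b\<leftarrow>ws. x \<bullet> b)"

text \<open>Polynomials as syntax: a list of coefficients with words of vectors. Words make the
  degree of a term visible and allow one-variable polynomials to be substituted for the coordinates.
  The representation is not unique.\<close>

definition poly_eval :: "(real \<times> 'a::euclidean_space list) list \<Rightarrow> 'a \<Rightarrow> real" where
  "poly_eval L x = (\<Sum>(c, ws)\<leftarrow>L. c * monom_fun ws x)"

lemma monom_fun_Nil [simp]: "monom_fun [] x = 1"
  and monom_fun_append: "monom_fun (ws @ vs) x = monom_fun ws x * monom_fun vs x"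
  and monom_fun_scale: "monom_fun ws (c *\<^sub>R x) = c ^ length ws * monom_fun ws x"
  by (simp_all add: monom_fun_def) (induction ws; simp)

lemma poly_eval_simps [simp]:
  "poly_eval [] x = 0" "poly_eval ((c, ws) # L) x = c * monom_fun ws x + poly_eval L x"
  "poly_eval (L @ L') x = poly_eval L x + poly_eval L' x"
  by (simp_all add: poly_eval_def)

lemma poly_eval_mult:
  "poly_eval [(c * d, ws @ vs). (c, ws) \<leftarrow> L, (d, vs) \<leftarrow> L'] x = poly_eval L x * poly_eval L' x"
proof (induction L)
  case (Cons a L)
  obtain c ws where a: "a = (c, ws)" by force
  have "poly_eval [(c * d, ws @ vs). (d, vs) \<leftarrow> L'] x = c * monom_fun ws x * poly_eval L' x"
    by (induction L') (auto simp: monom_fun_append algebra_simps)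
  with Cons a show ?case by (simp add: algebra_simps)
qed simp

lemma real_polynomial_poly_eval:
  fixes p :: "'a::euclidean_space \<Rightarrow> real"
  assumes "real_polynomial_function p"
  obtains L where "\<And>c ws. (c, ws) \<in> set L \<Longrightarrow> set ws \<subseteq> Basis" "p = poly_eval L"
proof -
  have "\<exists>L. (\<forall>(c, ws)\<in>set L. set ws \<subseteq> Basis) \<and> p = poly_eval L"
    using assms
  proof (induction p rule: real_polynomial_function.induct)
    case (linear f)
    obtain bs :: "'a list" where bs: "set bs = Basis" "distinct bs"
      using finite_distinct_list[OF finite_Basis] by blast
    have e1: "poly_eval (map (\<lambda>b. (f b, [b])) bs) x = (\<Sum>b\<in>Basis. f b * (x \<bullet> b))" for x
      unfolding bs(1)[symmetric] sum_list_distinct_conv_sum_set[OF bs(2), symmetric]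
      by (simp add: poly_eval_def o_def monom_fun_def)
    have e2: "f x = (\<Sum>b\<in>Basis. f b * (x \<bullet> b))" for x
      by (rule trans[OF linear_basis_expand[OF bounded_linear.linear[OF linear.hyps], of x]])
        (simp add: mult.commute)
    have "f = poly_eval (map (\<lambda>b. (f b, [b])) bs)" by (rule ext, rule trans[OF e2 e1[symmetric]])
    with bs(1) show ?case by (intro exI[of _ "map (\<lambda>b. (f b, [b])) bs"] conjI) auto
  next
    case (const c)
    show ?case by (intro exI[of _ "[(c, [])]"]) (auto simp: fun_eq_iff)
  next
    case (add f g)
    then obtain L L' where "\<forall>(c, ws)\<in>set L. set ws \<subseteq> Basis" "f = poly_eval L"
      "\<forall>(c, ws)\<in>set L'. set ws \<subseteq> Basis" "g = poly_eval L'" by blast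
    then show ?case by (intro exI[of _ "L @ L'"]) auto
  next
    case (mult f g)
    then obtain L L' where L: "\<forall>(c, ws)\<in>set L. set ws \<subseteq> Basis" "f = poly_eval L"
      "\<forall>(c, ws)\<in>set L'. set ws \<subseteq> Basis" "g = poly_eval L'" by blast
    then show ?case unfolding L(2,4) poly_eval_mult[symmetric]
      by (intro exI[of _ "[(c * d, ws @ vs). (c, ws) \<leftarrow> L, (d, vs) \<leftarrow> L']"]) fastforce
  qed
  then show thesis using that by blast
qed

definition hom_part :: "nat \<Rightarrow> (real \<times> 'a list) list \<Rightarrow> (real \<times> 'a list) list" where
  "hom_part k L = filter (\<lambda>(c, ws). length ws = k) L"

lemma poly_eval_hom_part_scale:
  "poly_eval (hom_part k L) (s *\<^sub>R x) = s ^ k * poly_eval (hom_part k L) x"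
  by (induction L) (auto simp: hom_part_def monom_fun_scale algebra_simps)

lemma poly_eval_eq_sum_hom_part:
  assumes "\<And>c ws. (c, ws) \<in> set L \<Longrightarrow> length ws < n"
  shows "poly_eval L x = (\<Sum>k<n. poly_eval (hom_part k L) x)"
  using assms
proof (induction L)
  case (Cons a L)
  obtain c ws where a: "a = (c, ws)" by force
  have "poly_eval (hom_part k (a # L)) x
      = (if k = length ws then c * monom_fun ws x else 0) + poly_eval (hom_part k L) x" for k
    by (auto simp: a hom_part_def)
  moreover have "poly_eval L x = (\<Sum>k<n. poly_eval (hom_part k L) x)" using Cons by force
  moreover have "length ws < n" using Cons.prems[of c ws] a by simp
  ultimately show ?case by (simp add: a sum.distrib)
qed (simp add: hom_part_def)

lemma poly_eval_length_bound:
  obtains n where "\<And>c ws. (c, ws) \<in> set L \<Longrightarrow> length ws < n" "d < n"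
proof -
  have "length ws < Suc (d + (\<Sum>(c, ws)\<leftarrow>L. length ws))" if "(c, ws) \<in> set L" for c ws
  proof -
    have "length ws \<le> (\<Sum>(c, ws)\<leftarrow>L. length ws)"
      using that by (induction L) auto
    then show ?thesis by simp
  qed
  then show thesis using that[of "Suc (d + (\<Sum>(c, ws)\<leftarrow>L. length ws))"] by simp
qed

text \<open>Both s^d times the value at x and the sum of the homogeneous parts expand the value at s
  x in powers of s; the coefficients of s^d must agree.\<close>

lemma homogeneous_poly_eval:
  assumes h: "\<And>c x. poly_eval L (c *\<^sub>R x) = c ^ d * poly_eval L x"
  shows "poly_eval L x = poly_eval (hom_part d L) x"
proof -
  obtain n where n: "\<And>c ws. (c, ws) \<in> set L \<Longrightarrow> length ws < n" "d < n"
    using poly_eval_length_bound by blast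
  define v where "v k = poly_eval (hom_part k L) x - (if k = d then poly_eval L x else 0)" for k
  have "(\<Sum>k<n. s ^ k *\<^sub>R v k) = 0" for s
  proof -
    have "(\<Sum>k<n. s ^ k *\<^sub>R v k)
        = (\<Sum>k<n. poly_eval (hom_part k L) (s *\<^sub>R x)) - (\<Sum>k<n. if k = d then s ^ k * poly_eval L x else 0)"
      unfolding sum_subtractf[symmetric] v_def
      by (intro sum.cong) (auto simp: poly_eval_hom_part_scale algebra_simps)
    also have "\<dots> = 0" using h[of s x] n(2) by (simp add: poly_eval_eq_sum_hom_part[of L n, OF n(1), symmetric])
    finally show ?thesis .
  qed
  then have "v d = 0" by (intro power_expansion_unique[where n = n and C = 0]) (auto simp: n(2))
  then show ?thesis by (simp add: v_def)
qed

subsection \<open>Homogeneous polynomial maps form a finite dimensional space\<close>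

lemma P_subspace: "subspace (P k :: ('a::euclidean_space \<Rightarrow> 'b::euclidean_space) set)"
  unfolding subspace_def P_def homogeneous_polynomial_def
  by (auto simp: plus_fun_def zero_fun_def scaleR_fun_def scaleR_add_right polynomial_function_add
      intro!: polynomial_function_cmul)

text \<open>Monomials of degree k + 1 times basis vectors span. A syntactic representation may
  contain terms of other degrees; they cancel, and \<open>homogeneous_poly_eval\<close> discards
  them.\<close>

lemma P_finite_span:
  obtains B :: "('a::euclidean_space \<Rightarrow> 'b::euclidean_space) set" where "finite B" "P k \<subseteq> span B"
proof
  let ?W = "{ws :: 'a list. set ws \<subseteq> Basis \<and> length ws = Suc k}"
  let ?B = "(\<lambda>(ws, b) x. monom_fun ws x *\<^sub>R b) ` (?W \<times> (Basis :: 'b set))"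
  show "finite ?B"
    using finite_lists_length_eq[OF finite_Basis, of "Suc k"] by (intro finite_imageI finite_cartesian_product) auto
  show "P k \<subseteq> span ?B"
  proof
    fix p :: "'a \<Rightarrow> 'b" assume "p \<in> P k"
    then have p: "polynomial_function p" "\<And>c x. p (c *\<^sub>R x) = c ^ Suc k *\<^sub>R p x"
      by (auto simp: P_def homogeneous_polynomial_def)
    have "(\<lambda>x. (p x \<bullet> b) *\<^sub>R b) \<in> span ?B" if b: "b \<in> Basis" for b
    proof -
      have "real_polynomial_function (\<lambda>x. p x \<bullet> b)"
        using p(1) b unfolding polynomial_function_iff_Basis_inner by blast
      then obtain L where L: "\<And>c ws. (c, ws) \<in> set L \<Longrightarrow> set ws \<subseteq> Basis" "(\<lambda>x. p x \<bullet> b) = poly_eval L"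
        using real_polynomial_poly_eval by blast
      have "poly_eval L (c *\<^sub>R x) = c ^ Suc k * poly_eval L x" for c x
        unfolding L(2)[symmetric] p(2) by simp
      then have "p x \<bullet> b = poly_eval (hom_part (Suc k) L) x" for x
        using fun_cong[OF L(2), of x] homogeneous_poly_eval[of L "Suc k" x] by simp
      then have "(\<lambda>x. (p x \<bullet> b) *\<^sub>R b) = (\<lambda>x. poly_eval (hom_part (Suc k) L) x *\<^sub>R b)"
        by simp
      also have "\<dots> \<in> span ?B"
        using L(1)
      proof (induction L)
        case Nil
        have "(\<lambda>x::'a. 0::'b) \<in> span ?B" using span_zero[of ?B] by (simp add: zero_fun_def)
        then show ?case by (simp add: hom_part_def)
      next
        case (Cons a L)
        obtain c ws where a: "a = (c, ws)" by force
        have IH: "(\<lambda>x. poly_eval (hom_part (Suc k) L) x *\<^sub>R b) \<in> span ?B" using Cons by force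
        show ?case
        proof (cases "length ws = Suc k")
          case True
          then have "(\<lambda>x. monom_fun ws x *\<^sub>R b) \<in> ?B" using Cons.prems[of c ws] a b by force
          then have "c *\<^sub>R (\<lambda>x. monom_fun ws x *\<^sub>R b) + (\<lambda>x. poly_eval (hom_part (Suc k) L) x *\<^sub>R b) \<in> span ?B"
            by (intro span_add[OF span_scale[OF span_base] IH])
          then show ?thesis using True
            by (simp add: a hom_part_def plus_fun_def scaleR_fun_def scaleR_add_left)
        qed (use IH in \<open>simp add: a hom_part_def\<close>)
      qed
      finally show ?thesis .
    qed
    then have "(\<Sum>b\<in>Basis. (\<lambda>x. (p x \<bullet> b) *\<^sub>R b)) \<in> span ?B" by (rule span_sum)
    moreover have "(\<Sum>b\<in>S. (\<lambda>x. (p x \<bullet> b) *\<^sub>R b)) = (\<lambda>x. \<Sum>b\<in>S. (p x \<bullet> b) *\<^sub>R b)"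
      if "finite S" for S :: "'b set"
      using that by (induction S) (auto simp: fun_eq_iff)
    ultimately show "p \<in> span ?B" by (simp add: euclidean_representation)
  qed
qed

subsection \<open>Analyticity of the local inverse of a polynomial map\<close>

text \<open>A submultiplicative norm that dominates every coefficient and the value at 1. It bounds
  iterates independently of their growing degrees.\<close>

definition l1 :: "real poly \<Rightarrow> real" where
  "l1 p = (\<Sum>x\<leftarrow>coeffs p. \<bar>x\<bar>)"

lemma l1_0 [simp]: "l1 0 = 0"
  by (simp add: l1_def)

lemma l1_pCons [simp]: "l1 (pCons a p) = \<bar>a\<bar> + l1 p"
  by (cases "p = 0 \<and> a = 0") (auto simp: l1_def)

lemma l1_nonneg: "0 \<le> l1 p"
  by (induction p) auto

lemma l1_add: "l1 (p + q) \<le> l1 p + l1 q"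
  by (induction p q rule: poly_induct2) auto

lemma l1_smult: "l1 (smult c p) = \<bar>c\<bar> * l1 p"
  by (induction p) (auto simp: abs_mult algebra_simps)

lemma l1_mult: "l1 (p * q) \<le> l1 p * l1 q"
proof (induction p)
  case (pCons a p)
  have "l1 (pCons a p * q) \<le> l1 (smult a q) + l1 (pCons 0 (p * q))"
    using l1_add by (simp add: mult_pCons_left del: l1_pCons)
  with pCons show ?case by (simp add: l1_smult algebra_simps)
qed simp

lemma abs_coeff_le_l1: "\<bar>coeff p i\<bar> \<le> l1 p"
proof (induction p arbitrary: i)
  case (pCons a p)
  then show ?case using l1_nonneg[of p] by (cases i) (auto intro: order_trans[OF pCons.IH])
qed simp

lemma abs_poly_1_le_l1: "\<bar>poly p 1\<bar> \<le> l1 p"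
proof (induction p)
  case (pCons a p)
  then show ?case by simp
qed simp

lemma poly_1_sums_coeff: "coeff p sums poly p (1::real)"
proof -
  have "coeff p sums (\<Sum>i\<le>degree p. coeff p i)"
    by (rule sums_finite) (auto simp: coeff_eq_0)
  then show ?thesis by (simp add: poly_altdef)
qed

text \<open>The formal polynomial L evaluated in the ring of one-variable polynomials, with
  \<open>h w\<close> in place of the coordinate along w.\<close>

definition poly_subst :: "(real \<times> 'w list) list \<Rightarrow> ('w \<Rightarrow> real poly) \<Rightarrow> real poly" where
  "poly_subst L h = (\<Sum>(c, ws)\<leftarrow>L. smult c (\<Prod>w\<leftarrow>ws. h w))"

lemma poly_subst_simps [simp]:
  "poly_subst [] h = 0"
  "poly_subst ((c, ws) # L) h = smult c (\<Prod>w\<leftarrow>ws. h w) + poly_subst L h"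
  by (simp_all add: poly_subst_def)

lemma poly_poly_subst:
  assumes "\<And>c ws. (c, ws) \<in> set L \<Longrightarrow> set ws \<subseteq> Basis" "\<And>w. w \<in> Basis \<Longrightarrow> poly (h w) 1 = x \<bullet> w"
  shows "poly (poly_subst L h) 1 = poly_eval L x"
  using assms(1)
proof (induction L)
  case (Cons a L)
  obtain c ws where a: "a = (c, ws)" by force
  have "set ws \<subseteq> Basis" using Cons.prems[of c ws] a by simp
  then have "poly (\<Prod>w\<leftarrow>ws. h w) 1 = monom_fun ws x"
    using assms(2) by (induction ws) (auto simp: monom_fun_def)
  moreover have "poly (poly_subst L h) 1 = poly_eval L x" using Cons by force
  ultimately show ?case by (simp add: a)
qed simp

lemma l1_prod_list:
  assumes "\<And>w. w \<in> set ws \<Longrightarrow> l1 (h w) \<le> s" "0 \<le> s"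
  shows "l1 (\<Prod>w\<leftarrow>ws. h w) \<le> s ^ length ws"
  using assms(1)
proof (induction ws)
  case Nil
  have "l1 1 = 1" by (simp add: one_pCons)
  then show ?case by simp
next
  case (Cons w ws)
  have "l1 (h w * (\<Prod>w\<leftarrow>ws. h w)) \<le> l1 (h w) * l1 (\<Prod>w\<leftarrow>ws. h w)" by (rule l1_mult)
  also have "\<dots> \<le> s * s ^ length ws"
    using Cons assms(2) by (intro mult_mono) (auto simp: l1_nonneg)
  finally show ?case by simp
qed

text \<open>Every word has at least two letters and s is at most 1: the quadratic estimate that
  keeps the iterates small.\<close>

lemma l1_poly_subst:
  assumes "\<And>c ws. (c, ws) \<in> set L \<Longrightarrow> set ws \<subseteq> B \<and> 2 \<le> length ws"
    "\<And>w. w \<in> B \<Longrightarrow> l1 (h w) \<le> s" "0 \<le> s" "s \<le> 1"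
  shows "l1 (poly_subst L h) \<le> (\<Sum>(c, ws)\<leftarrow>L. \<bar>c\<bar>) * s\<^sup>2"
  using assms(1)
proof (induction L)
  case (Cons a L)
  obtain c ws where a: "a = (c, ws)" by force
  have ws: "set ws \<subseteq> B" "2 \<le> length ws" using Cons.prems[of c ws] a by auto
  have "l1 (\<Prod>w\<leftarrow>ws. h w) \<le> s ^ length ws" using ws assms by (intro l1_prod_list) auto
  also have "\<dots> \<le> s\<^sup>2" using ws assms by (intro power_decreasing) auto
  finally have "\<bar>c\<bar> * l1 (\<Prod>w\<leftarrow>ws. h w) \<le> \<bar>c\<bar> * s\<^sup>2" by (intro mult_left_mono) auto
  moreover have "l1 (poly_subst L h) \<le> (\<Sum>(c, ws)\<leftarrow>L. \<bar>c\<bar>) * s\<^sup>2"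
    using Cons by force
  ultimately show ?case
    using l1_add[of "smult c (\<Prod>w\<leftarrow>ws. h w)" "poly_subst L h"] by (simp add: a l1_smult algebra_simps)
qed simp

lemma monom_dvd_prod_list:
  assumes "\<And>w. w \<in> set ws \<Longrightarrow> monom 1 1 dvd h w"
  shows "monom (1::real) (length ws) dvd (\<Prod>w\<leftarrow>ws. h w)"
  using assms
proof (induction ws)
  case Nil
  then show ?case by (simp add: monom_0 one_pCons[symmetric])
next
  case (Cons w ws)
  then have "monom 1 1 * monom 1 (length ws) dvd h w * (\<Prod>w\<leftarrow>ws. h w)" by (intro mult_dvd_mono) auto
  then show ?case by (simp add: mult_monom)
qed

text \<open>The factors are exchanged one at a time. Each exchange contributes a difference
  divisible by t^(k+1), where t is the variable, and every other factor contributes one more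
  t.\<close>

lemma monom_dvd_prod_list_diff:
  fixes h h' :: "'w \<Rightarrow> real poly"
  assumes "\<And>w. w \<in> set ws \<Longrightarrow> monom 1 1 dvd h w" "\<And>w. w \<in> set ws \<Longrightarrow> monom 1 1 dvd h' w"
    "\<And>w. w \<in> set ws \<Longrightarrow> monom 1 (Suc k) dvd h w - h' w"
  shows "monom 1 (k + length ws) dvd (\<Prod>w\<leftarrow>ws. h w) - (\<Prod>w\<leftarrow>ws. h' w)"
  using assms
proof (induction ws)
  case (Cons w ws)
  have "monom 1 (Suc k) * monom 1 (length ws) dvd (h w - h' w) * (\<Prod>w\<leftarrow>ws. h w)"
    using Cons.prems by (intro mult_dvd_mono monom_dvd_prod_list) auto
  moreover have "monom 1 1 * monom 1 (k + length ws) dvd h' w * ((\<Prod>w\<leftarrow>ws. h w) - (\<Prod>w\<leftarrow>ws. h' w))"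
    using Cons by (intro mult_dvd_mono) auto
  ultimately have "monom 1 (Suc (k + length ws)) dvd
      (h w - h' w) * (\<Prod>w\<leftarrow>ws. h w) + h' w * ((\<Prod>w\<leftarrow>ws. h w) - (\<Prod>w\<leftarrow>ws. h' w))"
    by (intro dvd_add) (simp_all add: mult_monom)
  then show ?case by (simp add: algebra_simps)
qed simp

lemma monom_dvd_mono: "m \<le> n \<Longrightarrow> monom 1 n dvd p \<Longrightarrow> monom (1::real) m dvd p"
  by (auto simp: monom_1_dvd_iff')

text \<open>As all words have length at least 2, substitution improves agreement modulo t^(k+1) to
  agreement modulo t^(k+2).\<close>

lemma monom_dvd_poly_subst_diff:
  assumes "\<And>c ws. (c, ws) \<in> set L \<Longrightarrow> set ws \<subseteq> B \<and> 2 \<le> length ws"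
    "\<And>w. w \<in> B \<Longrightarrow> monom 1 1 dvd h w" "\<And>w. w \<in> B \<Longrightarrow> monom 1 1 dvd h' w"
    "\<And>w. w \<in> B \<Longrightarrow> monom 1 (Suc k) dvd h w - h' w"
  shows "monom 1 (Suc (Suc k)) dvd poly_subst L h - poly_subst L h'"
  using assms(1)
proof (induction L)
  case (Cons a L)
  obtain c ws where a: "a = (c, ws)" by force
  have ws: "set ws \<subseteq> B" "2 \<le> length ws" using Cons.prems[of c ws] a by auto
  have "monom 1 (k + length ws) dvd (\<Prod>w\<leftarrow>ws. h w) - (\<Prod>w\<leftarrow>ws. h' w)"
    using ws assms by (intro monom_dvd_prod_list_diff) auto
  then have "monom 1 (Suc (Suc k)) dvd (\<Prod>w\<leftarrow>ws. h w) - (\<Prod>w\<leftarrow>ws. h' w)"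
    using ws by (intro monom_dvd_mono[of "Suc (Suc k)" "k + length ws"]) auto
  then have "monom 1 (Suc (Suc k)) dvd smult c ((\<Prod>w\<leftarrow>ws. h w) - (\<Prod>w\<leftarrow>ws. h' w))"
    by (rule dvd_smult)
  moreover have "monom 1 (Suc (Suc k)) dvd poly_subst L h - poly_subst L h'" using Cons by force
  ultimately have "monom 1 (Suc (Suc k)) dvd
      smult c ((\<Prod>w\<leftarrow>ws. h w) - (\<Prod>w\<leftarrow>ws. h' w)) + (poly_subst L h - poly_subst L h')"
    by (rule dvd_add)
  then show ?case by (simp add: a smult_diff_right algebra_simps)
qed simp

text \<open>A family of polynomials in one auxiliary variable whose \<open>k\<close>-th coefficient is a homogeneous
  polynomial of degree \<open>k\<close> in the parameter: the auxiliary variable counts the degree.\<close>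

definition graded_family :: "('w::euclidean_space \<Rightarrow> real poly) \<Rightarrow> bool" where
  "graded_family u \<longleftrightarrow> (\<forall>k. real_polynomial_function (\<lambda>y. coeff (u y) k) \<and>
     (\<forall>c y. coeff (u (c *\<^sub>R y)) k = c ^ k * coeff (u y) k))"

lemma graded_family_const: "graded_family (\<lambda>y. [:c:])"
  by (auto simp: graded_family_def coeff_pCons split: nat.splits)

lemma graded_family_0: "graded_family (\<lambda>y. 0)"
  using graded_family_const[of 0] by simp

lemma graded_family_add: "graded_family u \<Longrightarrow> graded_family v \<Longrightarrow> graded_family (\<lambda>y. u y + v y)"
  by (auto simp: graded_family_def algebra_simps intro: real_polynomial_function.intros)

lemma graded_family_mult:
  assumes u: "graded_family u" and v: "graded_family v" shows "graded_family (\<lambda>y. u y * v y)"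
  unfolding graded_family_def coeff_mult
proof (intro allI conjI)
  fix k
  show "real_polynomial_function (\<lambda>y. \<Sum>i\<le>k. coeff (u y) i * coeff (v y) (k - i))"
    using assms unfolding graded_family_def
    by (intro real_polynomial_function_sum real_polynomial_function.intros(4)) auto
  fix c y
  have "(\<Sum>i\<le>k. coeff (u (c *\<^sub>R y)) i * coeff (v (c *\<^sub>R y)) (k - i))
      = (\<Sum>i\<le>k. c ^ k * (coeff (u y) i * coeff (v y) (k - i)))"
  proof (intro sum.cong refl)
    fix i assume "i \<in> {..k}"
    then have "c ^ k = c ^ i * c ^ (k - i)" by (simp add: power_add[symmetric])
    then show "coeff (u (c *\<^sub>R y)) i * coeff (v (c *\<^sub>R y)) (k - i) = c ^ k * (coeff (u y) i * coeff (v y) (k - i))"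
      using assms unfolding graded_family_def by simp
  qed
  then show "(\<Sum>i\<le>k. coeff (u (c *\<^sub>R y)) i * coeff (v (c *\<^sub>R y)) (k - i))
      = c ^ k * (\<Sum>i\<le>k. coeff (u y) i * coeff (v y) (k - i))"
    by (simp add: sum_distrib_left)
qed

lemma graded_family_smult: "graded_family u \<Longrightarrow> graded_family (\<lambda>y. smult c (u y))"
  using graded_family_mult[OF graded_family_const[of c]] by simp

lemma graded_family_linear:
  assumes "bounded_linear f" shows "graded_family (\<lambda>y. monom (f y) 1)"
  unfolding graded_family_def
proof (intro allI conjI)
  fix k c y
  show "real_polynomial_function (\<lambda>y. coeff (monom (f y) 1) k)"
    using real_polynomial_function.intros(1)[OF assms] by (cases "k = 1") auto
  show "coeff (monom (f (c *\<^sub>R y)) 1) k = c ^ k * coeff (monom (f y) 1) k"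
    using assms by (auto simp: linear_simps(5))
qed

lemma graded_family_poly_subst:
  assumes "\<And>c ws. (c, ws) \<in> set L \<Longrightarrow> set ws \<subseteq> B" "\<And>w. w \<in> B \<Longrightarrow> graded_family (\<lambda>y. h y w)"
  shows "graded_family (\<lambda>y. poly_subst L (h y))"
  using assms(1)
proof (induction L)
  case Nil
  then show ?case by (simp add: graded_family_0)
next
  case (Cons a L)
  obtain c ws where a: "a = (c, ws)" by force
  have "set ws \<subseteq> B" using Cons.prems[of c ws] a by simp
  then have "graded_family (\<lambda>y. \<Prod>w\<leftarrow>ws. h y w)"
    using graded_family_const[of 1] assms(2)
    by (induction ws) (auto intro: graded_family_mult simp: one_pCons)
  moreover have "graded_family (\<lambda>y. poly_subst L (h y))" using Cons by force
  ultimately show ?case unfolding a poly_subst_simps by (intro graded_family_add graded_family_smult)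
qed

text \<open>Iteration from 0 for the equation H = t A y + Q(H), where t is the polynomial variable
  and \<open>L b\<close> represents the component of Q along b. At t = 1 it is the iteration for H =
  A y + Q(H).\<close>

fun picard :: "('w::euclidean_space \<Rightarrow> 'w) \<Rightarrow> ('w \<Rightarrow> (real \<times> 'w list) list) \<Rightarrow> 'w \<Rightarrow> nat \<Rightarrow> 'w \<Rightarrow> real poly"
where
  "picard A L y 0 b = 0"
| "picard A L y (Suc m) b = monom (A y \<bullet> b) 1 + poly_subst (L b) (picard A L y m)"

context
  fixes A :: "'w::euclidean_space \<Rightarrow> 'w" and L :: "'w \<Rightarrow> (real \<times> 'w list) list"
  assumes A: "linear A"
    and L: "\<And>b c ws. b \<in> Basis \<Longrightarrow> (c, ws) \<in> set (L b) \<Longrightarrow> set ws \<subseteq> Basis \<and> 2 \<le> length ws"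
begin

lemma picard_graded: "b \<in> Basis \<Longrightarrow> graded_family (\<lambda>y. picard A L y m b)"
proof (induction m arbitrary: b)
  case 0
  then show ?case by (simp add: graded_family_0)
next
  case (Suc m)
  have "bounded_linear (\<lambda>y. A y \<bullet> b)"
    using A by (intro bounded_linear_compose[OF bounded_linear_inner_left]) (simp add: linear_conv_bounded_linear)
  with Suc L show ?case unfolding picard.simps
    by (intro graded_family_add graded_family_linear graded_family_poly_subst[where B = Basis]) blast+
qed

lemma picard_dvd:
  "b \<in> Basis \<Longrightarrow> monom 1 1 dvd picard A L y m b"
  "b \<in> Basis \<Longrightarrow> monom 1 (Suc m) dvd picard A L y (Suc m) b - picard A L y m b"
proof -
  have X: "monom 1 1 dvd monom c 1" for c :: real
    using dvd_smult[OF dvd_refl, of "monom 1 1" c] by (simp add: smult_monom)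
  have *: "monom 1 1 dvd picard A L y m b" if "b \<in> Basis" for m b
  using that
  proof (induction m arbitrary: b)
    case (Suc m)
    have "monom 1 1 dvd (\<Prod>w\<leftarrow>ws. picard A L y m w)" if "(c, ws) \<in> set (L b)" for c ws
      using monom_dvd_mono[OF _ monom_dvd_prod_list[of ws "picard A L y m"], of 1] L[OF Suc.prems that] Suc.IH
      by force
    then have "monom 1 1 dvd poly_subst L' (picard A L y m)" if "set L' \<subseteq> set (L b)" for L'
      using that by (induction L') (auto intro!: dvd_add dvd_smult)
    then show ?case by (auto intro!: dvd_add X simp del: One_nat_def)
  qed simp
  then show "b \<in> Basis \<Longrightarrow> monom 1 1 dvd picard A L y m b" .
  show "b \<in> Basis \<Longrightarrow> monom 1 (Suc m) dvd picard A L y (Suc m) b - picard A L y m b"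
  proof (induction m arbitrary: b)
    case 0
    then show ?case using *[of b 1] by simp
  next
    case (Suc m)
    have "monom 1 (Suc (Suc m)) dvd poly_subst (L b) (picard A L y (Suc m)) - poly_subst (L b) (picard A L y m)"
      using L[OF Suc.prems] * Suc.IH
      by (intro monom_dvd_poly_subst_diff[where B = Basis]) blast+
    then show ?case by simp
  qed
qed

text \<open>Iterates m and m + 1 agree modulo t^(m+1), so the k-th coefficient is frozen from
  iterate k on.\<close>

lemma picard_stable:
  assumes b: "b \<in> Basis" shows "k \<le> m \<Longrightarrow> coeff (picard A L y m b) k = coeff (picard A L y k b) k"
proof (induction m rule: nat_induct_at_least[of k])
  case (Suc m)
  have "coeff (picard A L y (Suc m) b - picard A L y m b) k = 0"
    using picard_dvd(2)[OF b, of m y] Suc.hyps unfolding monom_1_dvd_iff' by simp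
  with Suc show ?case by (simp del: picard.simps)
qed simp_all

lemma analytic_fixed_point:
  assumes \<delta>: "\<delta> > 0"
  obtains e p H where "e > 0" "\<And>k. homogeneous_polynomial k (p k)"
    "uniform_limit (ball 0 e) (\<lambda>n h. \<Sum>k<n. p k h) H sequentially"
    "\<And>y. y \<in> ball 0 e \<Longrightarrow> norm (H y) < \<delta>"
    "\<And>y. y \<in> ball 0 e \<Longrightarrow> H y = A y + (\<Sum>b\<in>Basis. poly_eval (L b) (H y) *\<^sub>R b)"
proof -
  define C where "C = (\<Sum>b\<in>Basis. \<Sum>(c, ws)\<leftarrow>L b. \<bar>c\<bar>)"
  have nn: "0 \<le> (\<Sum>(c, ws)\<leftarrow>M. \<bar>c\<bar>)" for M :: "(real \<times> 'w list) list"
    by (induction M) auto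
  then have C0: "C \<ge> 0" by (auto simp: C_def intro: sum_nonneg)
  have Cb: "(\<Sum>(c, ws)\<leftarrow>L b. \<bar>c\<bar>) \<le> C" if "b \<in> Basis" for b
    unfolding C_def using that nn by (intro member_le_sum) auto
  \<comment> \<open>The size of the iterates: the bound 1 is for the quadratic estimate, the second
    bound gives C s^2 <= s/2 (C + 1 because C may be 0), and the third keeps a sum of
    \<open>DIM('w)\<close> components of size s below \<delta>.\<close>
  define s where "s = min 1 (min (1 / (2 * (C + 1))) (\<delta> / (2 * DIM('w))))"
  have s: "s > 0" "s \<le> 1" "s \<le> 1 / (2 * (C + 1))" "s \<le> \<delta> / (2 * DIM('w))"
    using C0 \<delta> by (auto simp: s_def)
  have Cs: "C * s\<^sup>2 \<le> s / 2"
  proof -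
    have "C * s \<le> C * (1 / (2 * (C + 1)))" using s C0 by (intro mult_left_mono) auto
    also have "\<dots> \<le> 1 / 2" using C0 by (simp add: field_simps)
    finally have "C * s * s \<le> 1 / 2 * s" using s by (intro mult_right_mono) auto
    then show ?thesis by (simp add: power2_eq_square)
  qed
  have Ds: "DIM('w) * s < \<delta>"
  proof -
    have "DIM('w) * s \<le> DIM('w) * (\<delta> / (2 * DIM('w)))" using s by (intro mult_left_mono) auto
    also have "\<dots> < \<delta>" using \<delta> by simp
    finally show ?thesis .
  qed
  obtain K where K: "K > 0" "\<And>x. norm (A x) \<le> K * norm x" using linear_bounded_pos[OF A] by blast
  \<comment> \<open>With this choice |y| <= 2 e implies |A y| <= s/2, which together with C s^2 <=
    s/2 reproduces the bound s in the next iterate.\<close>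
  define e where "e = s / (4 * K)"
  have e: "e > 0" using s K by (simp add: e_def)
  have l1: "l1 (picard A L y m b) \<le> s" if y: "norm y \<le> 2 * e" and b: "b \<in> Basis" for y m b
    using b
  proof (induction m arbitrary: b)
    case (Suc m)
    have "\<bar>A y \<bullet> b\<bar> \<le> norm (A y)" by (rule Basis_le_norm[OF Suc.prems])
    also have "\<dots> \<le> K * (2 * e)" using K(2)[of y] y K(1) by (meson mult_left_mono less_imp_le order_trans)
    also have "\<dots> = s / 2" using K by (simp add: e_def)
    finally have "l1 (monom (A y \<bullet> b) 1) \<le> s / 2" by (simp add: monom_Suc monom_0)
    moreover have "l1 (poly_subst (L b) (picard A L y m)) \<le> (\<Sum>(c, ws)\<leftarrow>L b. \<bar>c\<bar>) * s\<^sup>2"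
      using L[OF Suc.prems] Suc.IH s by (intro l1_poly_subst[where B = Basis]) auto
    moreover have "\<dots> \<le> C * s\<^sup>2" using Cb[OF Suc.prems] by (intro mult_right_mono) auto
    ultimately show ?case
      using l1_add[of "monom (A y \<bullet> b) 1" "poly_subst (L b) (picard A L y m)"] Cs by simp
  qed (use s in simp)
  define g where "g m k y = (\<Sum>b\<in>Basis. coeff (picard A L y m b) k *\<^sub>R b)" for m k y
  define p where "p k = g k k" for k
  have g_bound: "norm (g m k y) \<le> DIM('w) * s * (1 / 2) ^ k" if y: "y \<in> ball 0 e" for m k y
  proof -
    have "\<bar>coeff (picard A L y m b) k\<bar> \<le> s * (1 / 2) ^ k" if b: "b \<in> Basis" for b
    proof -
      \<comment> \<open>The k-th coefficient is homogeneous of degree k in y, so its value at y is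
        (1/2)^k times the one at 2 y, where the bound s still applies.\<close>
      have "coeff (picard A L ((1 / 2) *\<^sub>R (2 *\<^sub>R y)) m b) k = (1 / 2) ^ k * coeff (picard A L (2 *\<^sub>R y) m b) k"
        using picard_graded[OF b] unfolding graded_family_def by blast
      then have "\<bar>coeff (picard A L y m b) k\<bar> = (1 / 2) ^ k * \<bar>coeff (picard A L (2 *\<^sub>R y) m b) k\<bar>"
        by (simp add: abs_mult)
      also have "\<dots> \<le> (1 / 2) ^ k * s"
        using abs_coeff_le_l1 l1[of "2 *\<^sub>R y" b m] y b by (intro mult_left_mono) (auto intro: order_trans)
      finally show ?thesis by (simp add: mult_ac)
    qed
    then have "(\<Sum>b\<in>Basis. norm (coeff (picard A L y m b) k *\<^sub>R b)) \<le> (\<Sum>b\<in>(Basis::'w set). s * (1 / 2) ^ k)"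
      by (intro sum_mono) simp
    with norm_sum[of "\<lambda>b. coeff (picard A L y m b) k *\<^sub>R b" Basis] show ?thesis
      by (simp add: g_def mult_ac)
  qed
  have summ: "summable (\<lambda>k. DIM('w) * s * (1 / 2) ^ k)" by (intro summable_mult summable_geometric) simp
  define H where "H y = (\<Sum>k. p k y)" for y
  define X where "X m y = (\<Sum>b\<in>Basis. poly (picard A L y m b) 1 *\<^sub>R b)" for m y
  have X_sums: "(\<lambda>k. g m k y) sums X m y" for m y
    unfolding g_def X_def by (intro sums_sum sums_scaleR_left poly_1_sums_coeff)
  have X_lim: "(\<lambda>m. X m y) \<longlonglongrightarrow> H y" if y: "y \<in> ball 0 e" for y
  proof -
    have "(\<lambda>m. g m k y) \<longlonglongrightarrow> p k y" for k
    proof (rule tendsto_eventually)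
      have "g m k y = p k y" if "m \<ge> k" for m
        unfolding g_def p_def using that picard_stable[of _ k m y] by (intro sum.cong) auto
      then show "\<forall>\<^sub>F m in sequentially. g m k y = p k y" by (rule eventually_sequentiallyI)
    qed
    then have lim: "(\<lambda>m. g m k y \<bullet> i) \<longlonglongrightarrow> p k y \<bullet> i" for k i
      by (intro tendsto_intros)
    have "summable (\<lambda>k. p k y)"
      using g_bound[OF y] summ unfolding p_def by (intro summable_comparison_test'[OF summ]) auto
    then have H_i: "H y \<bullet> i = (\<Sum>k. p k y \<bullet> i)" for i
      unfolding H_def by (rule bounded_linear.suminf[OF bounded_linear_inner_left])
    have X_i: "X m y \<bullet> i = (\<Sum>k. g m k y \<bullet> i)" for m i
      by (rule sums_unique[OF bounded_linear.sums[OF bounded_linear_inner_left X_sums]])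
    have "norm (g m k y \<bullet> i) \<le> DIM('w) * s * (1 / 2) ^ k" if "i \<in> Basis" for i m k
      using Basis_le_norm[OF that, of "g m k y"] g_bound[OF y, of m k] by simp
    then have "(\<lambda>m. \<Sum>k. g m k y \<bullet> i) \<longlonglongrightarrow> (\<Sum>k. p k y \<bullet> i)" if "i \<in> Basis" for i
      using tannerys_theorem[where a = "\<lambda>k m. g m k y \<bullet> i" and b = "\<lambda>k. p k y \<bullet> i"
          and F = sequentially and M = "\<lambda>k. DIM('w) * s * (1 / 2) ^ k"] lim summ that
      by (simp add: always_eventually)
    then show ?thesis
      by (subst tendsto_componentwise_iff) (simp add: H_i X_i)
  qed
  have X_inner: "X m y \<bullet> b = poly (picard A L y m b) 1" if "b \<in> Basis" for m y b
    using that by (simp add: X_def inner_sum_left inner_Basis if_distrib sum.delta cong: if_cong)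
  have X_Suc: "X (Suc m) y = A y + (\<Sum>b\<in>Basis. poly_eval (L b) (X m y) *\<^sub>R b)" for m y
  proof -
    have "poly (picard A L y (Suc m) b) 1 = A y \<bullet> b + poly_eval (L b) (X m y)" if b: "b \<in> Basis" for b
      using poly_poly_subst[of "L b" "picard A L y m" "X m y"] L[OF b] X_inner
      by (simp add: poly_monom)
    then have "X (Suc m) y = (\<Sum>b\<in>Basis. (A y \<bullet> b + poly_eval (L b) (X m y)) *\<^sub>R b)"
      unfolding X_def by (intro sum.cong) auto
    then show ?thesis by (simp add: scaleR_add_left sum.distrib euclidean_representation)
  qed
  have cont: "isCont (poly_eval M) x" for M :: "(real \<times> 'w list) list" and x
  proof -
    have "isCont (monom_fun ws) x" for ws :: "'w list"
      by (induction ws) (auto simp: monom_fun_def[abs_def] intro!: continuous_intros)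
    then show ?thesis by (induction M) (auto simp: poly_eval_def[abs_def] intro!: continuous_intros)
  qed
  show thesis
  proof
    show "e > 0" by fact
    show "homogeneous_polynomial k (p k)" for k
      unfolding homogeneous_polynomial_def p_def g_def
    proof (intro conjI allI)
      show "polynomial_function (\<lambda>y. \<Sum>b\<in>Basis. coeff (picard A L y k b) k *\<^sub>R b)"
        using picard_graded unfolding graded_family_def
        by (intro polynomial_function_sum polynomial_function_mult polynomial_function_const)
          (auto simp: real_polynomial_function_eq[symmetric])
      fix c y
      have "coeff (picard A L (c *\<^sub>R y) k b) k = c ^ k * coeff (picard A L y k b) k" if "b \<in> Basis" for b
        using picard_graded[OF that] unfolding graded_family_def by blast
      then show "(\<Sum>b\<in>Basis. coeff (picard A L (c *\<^sub>R y) k b) k *\<^sub>R b)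
          = c ^ k *\<^sub>R (\<Sum>b\<in>Basis. coeff (picard A L y k b) k *\<^sub>R b)"
        by (simp add: scaleR_sum_right)
    qed
    show "uniform_limit (ball 0 e) (\<lambda>n h. \<Sum>k<n. p k h) H sequentially"
      unfolding H_def[abs_def] by (rule Weierstrass_m_test[OF _ summ]) (auto simp: p_def intro!: g_bound)
    show "norm (H y) < \<delta>" if y: "y \<in> ball 0 e" for y
    proof -
      have "norm (X m y) \<le> DIM('w) * s" for m
      proof -
        have "\<bar>poly (picard A L y m b) 1\<bar> \<le> s" if "b \<in> Basis" for b
          using abs_poly_1_le_l1 l1[of y b m] y e that by (auto intro: order_trans)
        then have "(\<Sum>b\<in>Basis. norm (poly (picard A L y m b) 1 *\<^sub>R b)) \<le> (\<Sum>b\<in>(Basis::'w set). s)"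
          by (intro sum_mono) simp
        with norm_sum[of "\<lambda>b. poly (picard A L y m b) 1 *\<^sub>R b" Basis] show ?thesis by (simp add: X_def)
      qed
      then have "norm (H y) \<le> DIM('w) * s"
        using X_lim[OF y] by (intro Lim_norm_ubound[of sequentially "\<lambda>m. X m y"]) auto
      with Ds show ?thesis by simp
    qed
    show "H y = A y + (\<Sum>b\<in>Basis. poly_eval (L b) (H y) *\<^sub>R b)" if y: "y \<in> ball 0 e" for y
    proof (rule LIMSEQ_unique)
      show "(\<lambda>m. X (Suc m) y) \<longlonglongrightarrow> H y" using X_lim[OF y] by (rule LIMSEQ_Suc)
      show "(\<lambda>m. X (Suc m) y) \<longlonglongrightarrow> A y + (\<Sum>b\<in>Basis. poly_eval (L b) (H y) *\<^sub>R b)"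
        unfolding X_Suc using X_lim[OF y] by (intro tendsto_intros isCont_tendsto_compose[OF cont])
    qed
  qed
qed

end

lemma vanish_order_1:
  fixes f :: "'a::euclidean_space \<Rightarrow> 'b::euclidean_space"
  assumes "smooth f" "f 0 = 0" shows "vanish_order 1 f"
  using taylor_expansion[OF assms, of 0] by simp

lemma vanish_order_2:
  fixes f :: "'a::euclidean_space \<Rightarrow> 'b::euclidean_space"
  assumes "smooth f" "f 0 = 0" "\<And>v. frechet_derivative f (at 0) v = 0" shows "vanish_order 2 f"
  using taylor_expansion[OF assms(1,2), of 1] assms(3)
  by (simp add: taylor_part_def dir_deriv_def numeral_2_eq_2)

lemma real_polynomial_poly_eval_fun: "real_polynomial_function (poly_eval L)"
proof -
  have "real_polynomial_function (monom_fun ws)" for ws :: "'a list"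
    by (induction ws) (auto simp: monom_fun_def[abs_def] intro: real_polynomial_function.intros(2)
        real_polynomial_function.intros(4)[OF real_polynomial_function.intros(1)[OF bounded_linear_inner_left]])
  then show ?thesis
    by (induction L) (auto simp: poly_eval_def[abs_def] intro!: real_polynomial_function.intros(2-4))
qed

text \<open>Terms of degree 0 and 1 may occur in L, but vanishing to second order makes their sums
  zero as functions. Deleting them gives words of length at least 2, as the iteration
  requires.\<close>

lemma poly_eval_vanish_order_2:
  fixes L :: "(real \<times> 'a::euclidean_space list) list"
  assumes v: "vanish_order 2 (poly_eval L)"
  shows "poly_eval L x = poly_eval (filter (\<lambda>(c, ws). 2 \<le> length ws) L) x"
proof -
  let ?L2 = "filter (\<lambda>(c, ws). 2 \<le> length ws) L"
  obtain n where n: "\<And>c ws. (c, ws) \<in> set L \<Longrightarrow> length ws < n" "2 < n"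
    using poly_eval_length_bound[of L 2] by blast
  have split: "poly_eval L x = poly_eval (hom_part 0 L) x + poly_eval (hom_part 1 L) x + poly_eval ?L2 x" for x
  proof (induction L)
    case (Cons a L)
    obtain c ws where a: "a = (c, ws)" by force
    consider "length ws = 0" | "length ws = 1" | "2 \<le> length ws" by linarith
    then show ?case using Cons by cases (auto simp: a hom_part_def)
  qed (simp add: hom_part_def)
  have v2: "vanish_order 2 (poly_eval ?L2)"
  proof (induction L)
    case (Cons a L)
    obtain c ws where a: "a = (c, ws)" by force
    have "vanish_order 2 (monom_fun ws)" if "2 \<le> length ws"
    proof (rule vanish_order_mono[OF vanish_order_homogeneous that])
      show "continuous_on UNIV (monom_fun ws)"
        by (induction ws) (auto simp: monom_fun_def[abs_def] intro!: continuous_intros)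
    qed (simp add: monom_fun_scale)
    then have "vanish_order 2 (\<lambda>x. c * monom_fun ws x)" if "2 \<le> length ws"
      using that by (intro vanish_order_linear_comp[OF bounded_linear_mult_right])
    with Cons a show ?case by (auto simp: poly_eval_def[abs_def] intro!: vanish_order_add)
  qed (simp add: poly_eval_def[abs_def])
  have "poly_eval L 0 = 0"
    by (rule vanish_order_imp_0[OF v]) simp
  moreover have z: "poly_eval (hom_part 1 L) 0 = 0" "poly_eval (hom_part 0 L) 0 = poly_eval (hom_part 0 L) x" for x
    using poly_eval_hom_part_scale[of 1 L 0 0] poly_eval_hom_part_scale[of 0 L 0 x] by auto
  moreover have "poly_eval ?L2 0 = 0"
    by (rule vanish_order_imp_0[OF v2]) simp
  ultimately have h0: "poly_eval (hom_part 0 L) x = 0" for x using split[of 0] by simp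
  have "vanish_order (Suc 1) (\<lambda>x. \<Sum>k<1. poly_eval (hom_part (Suc k) L) x)"
    using vanish_order_diff[OF v v2] by (simp add: split h0 numeral_2_eq_2)
  then have "poly_eval (hom_part (Suc 0) L) x = 0"
    by (rule homogeneous_sum_unique[where q = "\<lambda>k. poly_eval (hom_part (Suc k) L)"])
      (simp_all add: poly_eval_hom_part_scale del: power_Suc)
  with h0 split show ?thesis by simp
qed

lemma polynomial_fixed_point:
  fixes Q A :: "'w::euclidean_space \<Rightarrow> 'w"
  assumes Q: "polynomial_function Q" "vanish_order 2 Q" and A: "linear A" and \<delta>: "\<delta> > 0"
  obtains e p H where "e > 0" "\<And>k. homogeneous_polynomial k (p k)"
    "uniform_limit (ball 0 e) (\<lambda>n h. \<Sum>k<n. p k h) H sequentially"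
    "\<And>y. y \<in> ball 0 e \<Longrightarrow> norm (H y) < \<delta>" "\<And>y. y \<in> ball 0 e \<Longrightarrow> H y = A y + Q (H y)"
proof -
  have "\<exists>L. (\<forall>(c, ws)\<in>set L. set ws \<subseteq> Basis \<and> 2 \<le> length ws) \<and> (\<lambda>x. Q x \<bullet> b) = poly_eval L"
    if b: "b \<in> Basis" for b
  proof -
    have "real_polynomial_function (\<lambda>x. Q x \<bullet> b)"
      using Q(1) b unfolding polynomial_function_iff_Basis_inner by blast
    then obtain L where L: "\<And>c ws. (c, ws) \<in> set L \<Longrightarrow> set ws \<subseteq> Basis" "(\<lambda>x. Q x \<bullet> b) = poly_eval L"
      using real_polynomial_poly_eval by blast
    have "vanish_order 2 (poly_eval L)"
      unfolding L(2)[symmetric] by (rule vanish_order_linear_comp[OF bounded_linear_inner_left Q(2)])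
    from poly_eval_vanish_order_2[OF this] L show ?thesis
      by (intro exI[of _ "filter (\<lambda>(c, ws). 2 \<le> length ws) L"]) (auto simp: fun_eq_iff)
  qed
  then have "\<forall>b\<in>Basis. \<exists>L. (\<forall>(c, ws)\<in>set L. set ws \<subseteq> Basis \<and> 2 \<le> length ws)
      \<and> (\<lambda>x. Q x \<bullet> b) = poly_eval L" by (rule ballI)
  from bchoice[OF this] obtain L where
    L0: "\<forall>b\<in>Basis. (\<forall>(c, ws)\<in>set (L b). set ws \<subseteq> Basis \<and> 2 \<le> length ws)
      \<and> (\<lambda>x. Q x \<bullet> b) = poly_eval (L b)" ..
  then have L: "\<And>b c ws. b \<in> Basis \<Longrightarrow> (c, ws) \<in> set (L b) \<Longrightarrow> set ws \<subseteq> Basis \<and> 2 \<le> length ws"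
    "\<And>b. b \<in> Basis \<Longrightarrow> (\<lambda>x. Q x \<bullet> b) = poly_eval (L b)" by fast+
  have Q_eq: "(\<Sum>b\<in>Basis. poly_eval (L b) x *\<^sub>R b) = Q x" for x
    by (simp add: L(2)[symmetric] euclidean_representation)
  show thesis
  proof (rule analytic_fixed_point[OF A, of L \<delta>])
    fix e p H
    assume *: "e > 0" "\<And>k. homogeneous_polynomial k (p k)"
      "uniform_limit (ball 0 e) (\<lambda>n h. \<Sum>k<n. p k h) H sequentially"
      "\<And>y. y \<in> ball 0 e \<Longrightarrow> norm (H y) < \<delta>"
      "\<And>y. y \<in> ball 0 e \<Longrightarrow> H y = A y + (\<Sum>b\<in>Basis. poly_eval (L b) (H y) *\<^sub>R b)"
    show thesis by (rule that[of e p H]) (use * in \<open>simp_all only: Q_eq\<close>)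
  qed (use L(1) \<delta> in auto)
qed

section \<open>Analyticity of polynomial maps and of their local inverses\<close>

lemma real_analytic_polynomial:
  fixes F :: "'a::euclidean_space \<Rightarrow> 'b::euclidean_space"
  assumes F: "polynomial_function F" shows "real_analytic_on F U"
  unfolding real_analytic_on_def
proof
  fix a
  have "polynomial_function (\<lambda>h. F (a + h))"
    using polynomial_function_compose[of "\<lambda>h. a + h" F] F polynomial_function_bounded_linear[OF bounded_linear_ident]
    by (simp add: o_def polynomial_function_add)
  then have "\<exists>L. (\<lambda>h. F (a + h) \<bullet> b) = poly_eval L" if "b \<in> Basis" for b
    using that real_polynomial_poly_eval unfolding polynomial_function_iff_Basis_inner by metis
  then obtain L where L: "\<And>b. b \<in> Basis \<Longrightarrow> (\<lambda>h. F (a + h) \<bullet> b) = poly_eval (L b)" by metis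
  define p where "p k h = (\<Sum>b\<in>Basis. poly_eval (hom_part k (L b)) h *\<^sub>R b)" for k h
  have "\<exists>n. \<forall>(c, ws)\<in>set (L b). length ws < n" for b
  proof -
    obtain n where "\<And>c ws. (c, ws) \<in> set (L b) \<Longrightarrow> length ws < n"
      using poly_eval_length_bound[of "L b" 0] by metis
    then show ?thesis by auto
  qed
  then obtain n where n: "\<And>b. \<forall>(c, ws)\<in>set (L b). length ws < n b" by metis
  have "(\<Sum>k<m. p k h) = F (a + h)" if m: "m \<ge> (\<Sum>b\<in>Basis. n b)" for m h
  proof -
    have "(\<Sum>k<m. p k h) = (\<Sum>b\<in>Basis. (\<Sum>k<m. poly_eval (hom_part k (L b)) h) *\<^sub>R b)"
      unfolding p_def by (subst sum.swap) (simp add: scaleR_sum_left)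
    also have "\<dots> = (\<Sum>b\<in>Basis. (F (a + h) \<bullet> b) *\<^sub>R b)"
    proof (intro sum.cong refl)
      fix b :: 'b assume b: "b \<in> Basis"
      have "n b \<le> (\<Sum>b\<in>Basis. n b)" using b by (intro member_le_sum) auto
      then have "poly_eval (L b) h = (\<Sum>k<m. poly_eval (hom_part k (L b)) h)"
        using n[of b] m by (intro poly_eval_eq_sum_hom_part) force
      then show "(\<Sum>k<m. poly_eval (hom_part k (L b)) h) *\<^sub>R b = (F (a + h) \<bullet> b) *\<^sub>R b"
        using fun_cong[OF L[OF b], of h] by simp
    qed
    finally show ?thesis by (simp add: euclidean_representation)
  qed
  then have "uniform_limit (ball 0 1) (\<lambda>n h. \<Sum>k<n. p k h) (\<lambda>h. F (a + h)) sequentially"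
    by (intro uniform_limitI eventually_sequentiallyI[of "\<Sum>b\<in>Basis. n b"]) auto
  moreover have "homogeneous_polynomial k (p k)" for k
    unfolding homogeneous_polynomial_def p_def
    by (auto intro!: polynomial_function_sum polynomial_function_mult polynomial_function_const
        simp: real_polynomial_function_eq[symmetric] real_polynomial_poly_eval_fun
          poly_eval_hom_part_scale scaleR_sum_right)
  ultimately show "\<exists>e>0. \<exists>p. (\<forall>k. homogeneous_polynomial k (p k)) \<and>
      uniform_limit (ball 0 e) (\<lambda>n h. \<Sum>k<n. p k h) (\<lambda>h. F (a + h)) sequentially"
    by (intro exI[of _ "1::real"] conjI exI[of _ p]) auto
qed

text \<open>With D the derivative at a and A its inverse, F (a + h) = F a + y is equivalent to h = A
  y + Q h, where Q has neither constant nor linear part. The analytic solution of this fixed point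
  equation is small enough to stay in W - a, so it is the one that \<Phi> selects.\<close>

lemma analytic_local_inverse:
  fixes F :: "'w::euclidean_space \<Rightarrow> 'w"
  assumes F: "polynomial_function F" and bij: "bij (frechet_derivative F (at a))"
    and W: "open W" "a \<in> W" and \<Phi>: "\<And>x. x \<in> W \<Longrightarrow> \<Phi> (F x) = x"
  shows "\<exists>e>0. \<exists>p. (\<forall>k. homogeneous_polynomial k (p k)) \<and>
      uniform_limit (ball 0 e) (\<lambda>n h. \<Sum>k<n. p k h) (\<lambda>h. \<Phi> (F a + h)) sequentially"
proof -
  let ?D = "frechet_derivative F (at a)"
  have sF: "smooth F" using F by (rule smooth_polynomial_function)
  have D: "linear ?D" by (rule linear_smooth_frechet[OF sF])
  obtain A where A: "linear A" "A \<circ> ?D = id"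
    using linear_injective_left_inverse[OF D] bij by (auto simp: bij_def)
  have AD: "A (?D x) = x" for x using A(2) by (metis comp_apply id_apply)
  have DA: "?D (A x) = x" for x using bij AD by (metis bij_pointE)
  have bA: "bounded_linear A" "bounded_linear ?D" using A D by (auto simp: linear_conv_bounded_linear)
  define Q where "Q h = A (?D h - (F (a + h) - F a))" for h
  have pF: "polynomial_function (\<lambda>h. F (a + h))"
    using polynomial_function_compose[of "\<lambda>h. a + h" F] F polynomial_function_bounded_linear[OF bounded_linear_ident]
    by (simp add: o_def polynomial_function_add)
  have pQ: "polynomial_function Q"
    using polynomial_function_compose[OF _ polynomial_function_bounded_linear[OF bA(1)],
        of "\<lambda>h. ?D h - (F (a + h) - F a)"] pF polynomial_function_bounded_linear[OF bA(2)]
    by (simp add: Q_def[abs_def] o_def polynomial_function_diff)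
  have "(Q has_derivative (\<lambda>v. A (?D v - (?D v - 0)))) (at 0)"
  proof -
    have "((\<lambda>h. F (a + h)) has_derivative ?D) (at 0)"
    proof -
      have "((\<lambda>h. a + h) has_derivative (\<lambda>v. v)) (at 0)"
        by (rule derivative_eq_intros refl | simp)+
      from has_derivative_compose[OF this, of F ?D] show ?thesis
        using smooth_has_derivative[OF sF, of a] by simp
    qed
    then show ?thesis unfolding Q_def
      by (intro bounded_linear.has_derivative[OF bA(1)] has_derivative_diff
          bounded_linear_imp_has_derivative bA has_derivative_const)
  qed
  then have "frechet_derivative Q (at 0) v = 0" for v
    by (simp add: frechet_derivative_at[symmetric] linear_0[OF A(1)])
  then have "vanish_order 2 Q"
    using pQ by (intro vanish_order_2 smooth_polynomial_function)
      (auto simp: Q_def linear_0[OF A(1)] linear_0[OF D])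
  moreover obtain \<delta> where \<delta>: "\<delta> > 0" "ball a \<delta> \<subseteq> W" using W openE by blast
  ultimately obtain e p H where e: "e > 0" and p: "\<And>k. homogeneous_polynomial k (p k)"
    and lim: "uniform_limit (ball 0 e) (\<lambda>n h. \<Sum>k<n. p k h) H sequentially"
    and H: "\<And>y. y \<in> ball 0 e \<Longrightarrow> norm (H y) < \<delta>" "\<And>y. y \<in> ball 0 e \<Longrightarrow> H y = A y + Q (H y)"
    using polynomial_fixed_point[OF pQ _ A(1)] by metis
  have \<Phi>H: "\<Phi> (F a + y) = a + H y" if y: "y \<in> ball 0 e" for y
  proof -
    have "?D (H y) = ?D (A y + Q (H y))" using H(2)[OF y] by simp
    also have "\<dots> = y + (?D (H y) - (F (a + H y) - F a))"
      by (simp add: linear_add[OF D] DA Q_def)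
    finally have "F a + y = F (a + H y)" by (simp add: algebra_simps)
    moreover have "a + H y \<in> W" using \<delta>(2) H(1)[OF y] by (auto simp: dist_norm)
    ultimately show ?thesis using \<Phi> by simp
  qed
  \<comment> \<open>The term of degree 0 supplies the base point in \<Phi> (F a + y) = a + H
    y.\<close>
  define p' where "p' k h = (if k = 0 then a else 0) + p k h" for k h
  have "homogeneous_polynomial k (p' k)" for k
    using p[of k] by (auto simp: homogeneous_polynomial_def p'_def[abs_def] polynomial_function_add scaleR_add_right)
  moreover have "uniform_limit (ball 0 e) (\<lambda>n h. \<Sum>k<n. p' k h) (\<lambda>h. \<Phi> (F a + h)) sequentially"
  proof (rule uniform_limitI)
    fix \<epsilon> :: real assume "\<epsilon> > 0"
    with lim have "\<forall>\<^sub>F n in sequentially. \<forall>h\<in>ball 0 e. dist (\<Sum>k<n. p k h) (H h) < \<epsilon>"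
      by (rule uniform_limitD)
    then show "\<forall>\<^sub>F n in sequentially. \<forall>h\<in>ball 0 e. dist (\<Sum>k<n. p' k h) (\<Phi> (F a + h)) < \<epsilon>"
      using eventually_gt_at_top[of 0]
      by eventually_elim (auto simp: \<Phi>H p'_def sum.distrib dist_norm)
  qed
  ultimately show ?thesis using e by blast
qed

subsection \<open>Complex eigenfunctionals of a semisimple map\<close>

text \<open>A complex eigenvector of the transpose of S (zero included), encoded as a real-linear
  complex-valued functional; the underlying space stays real.\<close>

definition eigen_functional :: "('w::real_vector \<Rightarrow> 'w) \<Rightarrow> complex \<Rightarrow> ('w \<Rightarrow> complex) \<Rightarrow> bool" where
  "eigen_functional S \<kappa> l \<longleftrightarrow> linear l \<and> (\<forall>x. l (S x) = \<kappa> * l x)"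

text \<open>The polynomial p in the transpose of S, applied to the functional l.\<close>

definition poly_act :: "('w \<Rightarrow> 'w) \<Rightarrow> complex poly \<Rightarrow> ('w \<Rightarrow> complex) \<Rightarrow> 'w \<Rightarrow> complex" where
  "poly_act S p l x = (\<Sum>i\<le>degree p. coeff p i * l ((S ^^ i) x))"

lemma poly_act_bound:
  assumes "degree p \<le> n" shows "poly_act S p l x = (\<Sum>i\<le>n. coeff p i * l ((S ^^ i) x))"
  unfolding poly_act_def
  by (intro sum.mono_neutral_left) (use assms in \<open>auto simp: coeff_eq_0\<close>)

lemma poly_act_diff: "poly_act S (p - q) l x = poly_act S p l x - poly_act S q l x"
proof -
  have "degree (p - q) \<le> max (degree p) (degree q)" by (rule degree_diff_le_max)
  note b = poly_act_bound[OF this] poly_act_bound[OF max.cobounded1[of "degree p" "degree q"]]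
    poly_act_bound[OF max.cobounded2[of "degree q" "degree p"]]
  show ?thesis unfolding b by (simp add: sum_subtractf algebra_simps)
qed

lemma poly_act_smult: "poly_act S (smult c p) l x = c * poly_act S p l x"
  using poly_act_bound[of "smult c p" "degree p"]
  by (simp add: degree_smult_le poly_act_def sum_distrib_left mult.assoc)

lemma poly_act_pCons_0: "poly_act S (pCons 0 p) l x = poly_act S p l (S x)"
proof -
  have "poly_act S (pCons 0 p) l x = (\<Sum>i\<le>Suc (degree p). coeff (pCons 0 p) i * l ((S ^^ i) x))"
    by (rule poly_act_bound) (rule degree_pCons_le)
  then show ?thesis
    by (simp add: poly_act_def sum.atMost_Suc_shift funpow_Suc_right del: sum.atMost_Suc funpow.simps(2))
qed

lemma linear_relation_exists:
  fixes v :: "nat \<Rightarrow> 'w::euclidean_space"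
  obtains c n where "(\<Sum>i\<le>n. c i *\<^sub>R v i) = 0" "\<exists>i\<le>n. c i \<noteq> (0::real)"
proof (cases "inj_on v {..DIM('w)}")
  case True
  have "dependent (v ` {..DIM('w)})" by (intro dependent_biggerset) (simp add: card_image[OF True])
  then obtain u where u: "\<exists>x\<in>v ` {..DIM('w)}. u x \<noteq> 0" "(\<Sum>x\<in>v ` {..DIM('w)}. u x *\<^sub>R x) = 0"
    unfolding dependent_finite[OF finite_imageI[OF finite_atMost]] by blast
  have "(\<Sum>i\<le>DIM('w). u (v i) *\<^sub>R v i) = 0"
    using u(2) by (simp add: sum.reindex[OF True])
  with u(1) that[where n = "DIM('w)" and c = "\<lambda>i. u (v i)"] show thesis by auto
next
  case False
  then obtain i j where ij: "i \<noteq> j" "v i = v j" "i \<le> DIM('w)" "j \<le> DIM('w)"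
    by (auto simp: inj_on_def)
  let ?c = "\<lambda>k. (if k = i then 1 else 0) - (if k = j then 1 else 0) :: real"
  have "(\<Sum>k\<le>DIM('w). ?c k *\<^sub>R v k)
      = (\<Sum>k\<le>DIM('w). if k = i then v k else 0) - (\<Sum>k\<le>DIM('w). if k = j then v k else 0)"
    unfolding sum_subtractf[symmetric] by (intro sum.cong) auto
  also have "\<dots> = 0" using ij by simp
  finally have "(\<Sum>k\<le>DIM('w). ?c k *\<^sub>R v k) = 0" .
  moreover have "\<exists>k\<le>DIM('w). ?c k \<noteq> 0" using ij by (intro exI[of _ i]) auto
  ultimately show thesis by (rule that)
qed

text \<open>Under the transpose of S, a nonzero functional that kills the invariant space Z
  generates functionals that also kill Z. A root of its minimal annihilating polynomial yields an
  eigenvector among them.\<close>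

lemma exists_eigen_functional:
  fixes S :: "'w::euclidean_space \<Rightarrow> 'w"
  assumes S: "linear S" and Z: "subspace Z" "S ` Z \<subseteq> Z" "Z \<noteq> UNIV"
  obtains \<kappa> l x where "eigen_functional S \<kappa> l" "\<And>z. z \<in> Z \<Longrightarrow> l z = 0" "l x \<noteq> 0"
proof -
  have "dim Z < DIM('w)"
    using Z(1,3) dim_subset_UNIV[of Z] by (metis dim_eq_full le_neq_implies_less span_eq_iff)
  then obtain d where d: "d \<noteq> 0" "\<And>y. y \<in> span Z \<Longrightarrow> orthogonal d y"
    using orthogonal_to_subspace_exists by blast
  define l0 where "l0 x = complex_of_real (x \<bullet> d)" for x
  have l0: "linear l0" by (auto simp: l0_def[abs_def] inner_add_left scaleR_conv_of_real intro!: linearI)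
  have l0Z: "l0 z = 0" if "z \<in> Z" for z
    using d(2)[of z] that span_superset[of Z] by (auto simp: l0_def orthogonal_def inner_commute)
  \<comment> \<open>A linear dependence among the iterates of d under the adjoint is a nonzero
    polynomial that annihilates \<open>l0\<close>.\<close>
  obtain c n where c: "(\<Sum>i\<le>n. c i *\<^sub>R (adjoint S ^^ i) d) = 0" "\<exists>i\<le>n. c i \<noteq> 0"
    using linear_relation_exists[of "\<lambda>i. (adjoint S ^^ i) d"] by blast
  have adj: "(S ^^ i) x \<bullet> d = x \<bullet> (adjoint S ^^ i) d" for i x
  proof (induction i arbitrary: x)
    case (Suc i)
    have "(S ^^ Suc i) x \<bullet> d = S x \<bullet> (adjoint S ^^ i) d" by (simp add: funpow_swap1 Suc[symmetric])
    then show ?case by (simp add: adjoint_works[OF S])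
  qed simp
  define P0 where "P0 = (\<Sum>i\<le>n. monom (complex_of_real (c i)) i)"
  have cP0: "coeff P0 i = (if i \<le> n then of_real (c i) else 0)" for i
    by (simp add: P0_def coeff_sum)
  have "degree P0 \<le> n" by (rule degree_le) (simp add: cP0)
  then have "poly_act S P0 l0 x = of_real (x \<bullet> (\<Sum>i\<le>n. c i *\<^sub>R (adjoint S ^^ i) d))" for x
    by (simp add: poly_act_bound[of _ n] cP0 l0_def adj inner_sum_right)
  then have P0: "P0 \<noteq> 0 \<and> (\<forall>x. poly_act S P0 l0 x = 0)"
    using c(2) cP0 by (auto simp: c(1) poly_eq_iff)
  obtain p where p: "p \<noteq> 0" "\<And>x. poly_act S p l0 x = 0"
    and least: "\<And>q. q \<noteq> 0 \<Longrightarrow> (\<forall>x. poly_act S q l0 x = 0) \<Longrightarrow> degree p \<le> degree q"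
    using ex_has_least_nat[of "\<lambda>p. p \<noteq> 0 \<and> (\<forall>x. poly_act S p l0 x = 0)" P0 degree] P0 by blast
  have "degree p \<noteq> 0"
  proof
    assume "degree p = 0"
    then have "coeff p 0 * l0 d = 0" using p(2)[of d] by (simp add: poly_act_def)
    moreover have "coeff p 0 \<noteq> 0" using \<open>degree p = 0\<close> p(1) leading_coeff_neq_0 by metis
    ultimately show False using d(1) by (simp add: l0_def)
  qed
  then have "\<not> constant (poly p)" by (simp add: constant_degree)
  then obtain z where "poly p z = 0" using fundamental_theorem_of_algebra by blast
  then obtain q where q: "p = [:- z, 1:] * q" by (metis dvdE poly_eq_0_iff_dvd)
  have q0: "q \<noteq> 0" using p(1) q by auto
  have "degree p = Suc (degree q)" unfolding q using q0 by (subst degree_mult_eq) auto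
  \<comment> \<open>By minimality of p the functional obtained from q is nonzero, whereas p, the
    product of t - z and q, annihilates \<open>l0\<close>: this functional has eigenvalue z.\<close>
  then have "\<not> (\<forall>x. poly_act S q l0 x = 0)" using least[OF q0] by auto
  then obtain x where x: "poly_act S q l0 x \<noteq> 0" by blast
  have "p = pCons 0 q - smult z q" by (simp add: q)
  then have eig: "poly_act S q l0 (S x) = z * poly_act S q l0 x" for x
    using p(2)[of x] by (simp add: poly_act_diff poly_act_pCons_0 poly_act_smult)
  have lpow: "linear (S ^^ i)" for i
    by (induction i) (use linear_compose[OF _ S] linear_id in \<open>auto simp: o_def id_def\<close>)
  have "linear (poly_act S q l0)"
    by (rule linearI) (simp_all add: poly_act_def linear_add[OF lpow] linear_add[OF l0] linear_scale[OF lpow]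
        linear_scale[OF l0] algebra_simps sum.distrib scaleR_sum_right)
  moreover have "poly_act S q l0 y = 0" if "y \<in> Z" for y
  proof -
    have "(S ^^ i) y \<in> Z" for i using that Z(2) by (induction i) auto
    then show ?thesis by (simp add: poly_act_def l0Z)
  qed
  ultimately show thesis using that[of z "poly_act S q l0" x] x eig by (simp add: eigen_functional_def)
qed

text \<open>The common kernel U of all eigenfunctionals is invariant, so it has an invariant
  complement Z. If U were nonzero, Z would be proper, and some nonzero eigenfunctional would vanish
  on Z; it also vanishes on U, hence everywhere.\<close>

lemma eigen_functionals_separate:
  fixes S :: "'w::euclidean_space \<Rightarrow> 'w"
  assumes S: "semisimple_map S" and x: "\<And>\<kappa> l. eigen_functional S \<kappa> l \<Longrightarrow> l x = 0"
  shows "x = 0"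
proof (rule ccontr)
  assume nz: "x \<noteq> 0"
  define U where "U = {x. \<forall>\<kappa> l. eigen_functional S \<kappa> l \<longrightarrow> l x = 0}"
  have "subspace U"
    unfolding U_def subspace_def eigen_functional_def
    by (auto simp: linear_0 linear_add linear_scale) (metis add_0)
  moreover have "S ` U \<subseteq> U" by (auto simp: U_def eigen_functional_def) metis
  ultimately obtain Z where Z: "subspace Z" "S ` Z \<subseteq> Z" "is_direct_sum U Z UNIV"
    using S unfolding semisimple_map_def by blast
  have "x \<in> U" using x by (auto simp: U_def)
  then have "Z \<noteq> UNIV" using Z(3) nz by (auto simp: is_direct_sum_def)
  moreover have "linear S" using S by (simp add: semisimple_map_def)
  ultimately obtain \<kappa> l y where l: "eigen_functional S \<kappa> l" "\<And>z. z \<in> Z \<Longrightarrow> l z = 0" "l y \<noteq> 0"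
    using exists_eigen_functional[of S Z] Z by metis
  have "y \<in> {u + v |u v. u \<in> U \<and> v \<in> Z}" using Z(3) by (simp add: is_direct_sum_def)
  then obtain u v where "y = u + v" "u \<in> U" "v \<in> Z" by blast
  then show False using l by (auto simp: U_def eigen_functional_def linear_add)
qed

inductive_set eigen_sums :: "('w::real_vector \<Rightarrow> 'w) \<Rightarrow> ('w \<Rightarrow> complex) set" for S where
  zero: "(\<lambda>x. 0) \<in> eigen_sums S"
| step: "eigen_functional S \<kappa> l \<Longrightarrow> f \<in> eigen_sums S \<Longrightarrow> (\<lambda>x. l x + f x) \<in> eigen_sums S"

lemma eigen_sums_add: "f \<in> eigen_sums S \<Longrightarrow> g \<in> eigen_sums S \<Longrightarrow> (\<lambda>x. f x + g x) \<in> eigen_sums S"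
  by (induction f rule: eigen_sums.induct) (auto simp: add.assoc intro: eigen_sums.intros)

lemma eigen_functional_scale: "eigen_functional S \<kappa> l \<Longrightarrow> eigen_functional S \<kappa> (\<lambda>x. c * l x)"
  by (auto simp: eigen_functional_def linear_add linear_scale algebra_simps intro!: linearI)

lemma eigen_functional_cnj: "eigen_functional S \<kappa> l \<Longrightarrow> eigen_functional S (cnj \<kappa>) (\<lambda>x. cnj (l x))"
  by (auto simp: eigen_functional_def linear_add linear_scale intro!: linearI)

lemma eigen_sums_eigen: "eigen_functional S \<kappa> l \<Longrightarrow> l \<in> eigen_sums S"
  using eigen_sums.step[OF _ eigen_sums.zero] by fastforce

lemma eigen_sums_scale: "f \<in> eigen_sums S \<Longrightarrow> (\<lambda>x. c * f x) \<in> eigen_sums S"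
  by (induction f rule: eigen_sums.induct)
    (auto simp: distrib_left intro: eigen_sums.intros eigen_functional_scale)

text \<open>Real and imaginary parts of an eigenfunctional are combinations of it and its conjugate.
  A vector orthogonal to all vectors representing such parts is killed by every eigenfunctional, so
  it is 0 by separation.\<close>

lemma inner_in_eigen_sums:
  fixes S :: "'w::euclidean_space \<Rightarrow> 'w"
  assumes S: "semisimple_map S" shows "(\<lambda>x. complex_of_real (x \<bullet> r)) \<in> eigen_sums S"
proof -
  define R where "R = {r. (\<lambda>x. complex_of_real (x \<bullet> r)) \<in> eigen_sums S}"
  have R: "subspace R"
    unfolding subspace_def R_def
    using eigen_sums_add eigen_sums_scale eigen_sums.zero
    by (auto simp: inner_add_right)
  have inR: "v \<in> R" if "\<And>x. complex_of_real (x \<bullet> v) = a * l x + b * cnj (l x)" "eigen_functional S \<kappa> l"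
    for v a b l \<kappa>
    using eigen_sums_add[OF eigen_sums_scale[OF eigen_sums_eigen[OF that(2)], of a]
        eigen_sums_scale[OF eigen_sums_eigen[OF eigen_functional_cnj[OF that(2)]], of b]]
    by (simp add: R_def that(1))
  have "R = UNIV"
  proof (rule ccontr)
    assume "R \<noteq> UNIV"
    then have "dim R < DIM('w)"
      using R dim_subset_UNIV[of R] by (metis dim_eq_full le_neq_implies_less span_eq_iff)
    then obtain y where y: "y \<noteq> 0" "\<And>v. v \<in> span R \<Longrightarrow> orthogonal y v"
      using orthogonal_to_subspace_exists by blast
    have "l y = 0" if l: "eigen_functional S \<kappa> l" for \<kappa> l
    proof (rule complex_eqI)
      have lin: "linear (\<lambda>x. Re (l x))" "linear (\<lambda>x. Im (l x))"
        using l by (auto simp: eigen_functional_def linear_add linear_scale intro!: linearI)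
      define v where "v = (\<Sum>b\<in>Basis. Re (l b) *\<^sub>R b)"
      define w where "w = (\<Sum>b\<in>Basis. Im (l b) *\<^sub>R b)"
      have v: "x \<bullet> v = Re (l x)" and w: "x \<bullet> w = Im (l x)" for x
        using linear_basis_expand[OF lin(1), of x] linear_basis_expand[OF lin(2), of x]
        by (simp_all add: v_def w_def inner_sum_right mult.commute)
      have "v \<in> R"
        by (rule inR[of _ "1/2" l "1/2", OF _ l]) (simp add: v complex_eq_iff)
      moreover have "w \<in> R"
        by (rule inR[of _ "- \<i>/2" l "\<i>/2", OF _ l]) (simp add: w complex_eq_iff)
      ultimately have "y \<bullet> v = 0" "y \<bullet> w = 0"
        using y(2) span_superset[of R] by (auto simp: orthogonal_def)
      then show "Re (l y) = Re 0" "Im (l y) = Im 0" by (simp_all add: v w)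
    qed
    then have "y = 0" by (rule eigen_functionals_separate[OF S])
    with y(1) show False ..
  qed
  then show ?thesis by (auto simp: R_def)
qed

subsection \<open>Generalized eigenfunctions of a linear vector field\<close>

definition lie_deriv :: "('w::real_normed_vector \<Rightarrow> 'w) \<Rightarrow> ('w \<Rightarrow> 'b::real_normed_vector) \<Rightarrow> 'w \<Rightarrow> 'b" where
  "lie_deriv A q x = frechet_derivative q (at x) (A x)"

lemma lie_deriv_add:
  "smooth p \<Longrightarrow> smooth q \<Longrightarrow> lie_deriv A (\<lambda>x. p x + q x) x = lie_deriv A p x + lie_deriv A q x"
  by (simp add: lie_deriv_def frechet_derivative_add smooth_differentiable)

lemma lie_deriv_linear_comp:
  assumes "bounded_linear l" "smooth q" shows "lie_deriv A (\<lambda>x. l (q x)) x = l (lie_deriv A q x)"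
  unfolding lie_deriv_def
  by (subst frechet_derivative_at[OF bounded_linear.has_derivative[OF assms(1) smooth_has_derivative[OF assms(2)]],
      symmetric]) simp

lemma lie_deriv_cmult:
  fixes q :: "'w::real_normed_vector \<Rightarrow> complex"
  shows "smooth q \<Longrightarrow> lie_deriv A (\<lambda>x. c * q x) x = c * lie_deriv A q x"
  by (rule lie_deriv_linear_comp[OF bounded_linear_mult_right])

lemma lie_deriv_mult:
  fixes p q :: "'w::real_normed_vector \<Rightarrow> complex"
  assumes "smooth p" "smooth q"
  shows "lie_deriv A (\<lambda>x. p x * q x) x = lie_deriv A p x * q x + p x * lie_deriv A q x"
  unfolding lie_deriv_def
  by (subst frechet_derivative_at[OF has_derivative_mult[OF assms[THEN smooth_has_derivative]], symmetric])
    (simp add: add.commute)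

lemma lie_deriv_const [simp]: "lie_deriv A (\<lambda>x. c) x = 0"
  by (simp add: lie_deriv_def)

lemma smooth_cmult:
  fixes q :: "'w::real_normed_vector \<Rightarrow> complex"
  shows "smooth q \<Longrightarrow> smooth (\<lambda>x. c * q x)"
  by (rule smooth_linear_comp[OF bounded_linear_mult_right])

text \<open>The condition (D - \<mu>)^n q = 0 for the derivation D along A. Smoothness is demanded
  at every stage because \<open>frechet_derivative\<close> is meaningful only for differentiable
  maps.\<close>

primrec gen_eigen :: "('w::euclidean_space \<Rightarrow> 'w) \<Rightarrow> complex \<Rightarrow> nat \<Rightarrow> ('w \<Rightarrow> complex) \<Rightarrow> bool" where
  "gen_eigen A \<mu> 0 q \<longleftrightarrow> q = (\<lambda>x. 0)"
| "gen_eigen A \<mu> (Suc n) q \<longleftrightarrow> smooth q \<and> gen_eigen A \<mu> n (\<lambda>x. lie_deriv A q x - \<mu> * q x)"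

lemma gen_eigen_smooth: "gen_eigen A \<mu> n q \<Longrightarrow> smooth q"
  by (cases n) auto

lemma gen_eigen_zero: "gen_eigen A \<mu> n (\<lambda>x. 0)"
  by (induction n) auto

lemma gen_eigen_Suc: "gen_eigen A \<mu> n q \<Longrightarrow> gen_eigen A \<mu> (Suc n) q"
  by (induction n arbitrary: q) (auto simp: gen_eigen_zero)

lemma gen_eigen_mono: "n \<le> m \<Longrightarrow> gen_eigen A \<mu> n q \<Longrightarrow> gen_eigen A \<mu> m q"
  by (induction m rule: nat_induct_at_least) (auto intro: gen_eigen_Suc simp del: gen_eigen.simps)

lemma gen_eigen_add:
  "gen_eigen A \<mu> n p \<Longrightarrow> gen_eigen A \<mu> n q \<Longrightarrow> gen_eigen A \<mu> n (\<lambda>x. p x + q x)"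
proof (induction n arbitrary: p q)
  case (Suc n)
  then have "gen_eigen A \<mu> n (\<lambda>x. (lie_deriv A p x - \<mu> * p x) + (lie_deriv A q x - \<mu> * q x))"
    by simp
  with Suc.prems show ?case by (simp add: smooth_add lie_deriv_add algebra_simps)
qed simp

lemma gen_eigen_cmult: "gen_eigen A \<mu> n q \<Longrightarrow> gen_eigen A \<mu> n (\<lambda>x. c * q x)"
proof (induction n arbitrary: q)
  case (Suc n)
  then have "gen_eigen A \<mu> n (\<lambda>x. c * (lie_deriv A q x - \<mu> * q x))" by simp
  with Suc.prems show ?case by (simp add: smooth_cmult lie_deriv_cmult algebra_simps)
qed simp

lemma gen_eigen_diff:
  "gen_eigen A \<mu> n p \<Longrightarrow> gen_eigen A \<mu> n q \<Longrightarrow> gen_eigen A \<mu> n (\<lambda>x. p x - q x)"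
  using gen_eigen_add[OF _ gen_eigen_cmult[of A \<mu> n q "- 1"]] by simp

context
  fixes A :: "'w::euclidean_space \<Rightarrow> 'w"
  assumes A: "linear A"
begin

lemma smooth_lie_deriv:
  fixes q :: "'w \<Rightarrow> 'b::real_normed_vector"
  shows "smooth q \<Longrightarrow> smooth (lie_deriv A q)"
  unfolding lie_deriv_def[abs_def] by (rule smooth_frechet_derivative[OF _ smooth_linear[OF A]])

lemma lie_deriv_diff_cmult:
  fixes p q :: "'w \<Rightarrow> complex"
  assumes "smooth p" "smooth q"
  shows "lie_deriv A (\<lambda>x. p x - c * q x) x = lie_deriv A p x - c * lie_deriv A q x"
  using lie_deriv_add[OF assms(1) smooth_cmult[OF assms(2), of "- c"]] lie_deriv_cmult[OF assms(2), of A "- c"]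
  by simp

text \<open>By the Leibniz rule D - (\<mu> + \<nu>) sends p q to ((D - \<mu>) p) q + p ((D - \<nu>)
  q), and both summands have smaller total order.\<close>

lemma gen_eigen_mult:
  "gen_eigen A \<mu> i p \<Longrightarrow> gen_eigen A \<nu> j q \<Longrightarrow> gen_eigen A (\<mu> + \<nu>) (i + j) (\<lambda>x. p x * q x)"
proof (induction "i + j" arbitrary: i j p q)
  case 0
  then show ?case by simp
next
  case (Suc n)
  note sm = gen_eigen_smooth[OF Suc.prems(1)] gen_eigen_smooth[OF Suc.prems(2)]
  show ?case
  proof (cases "i = 0 \<or> j = 0")
    case True
    then have "(\<lambda>x. p x * q x) = (\<lambda>x. 0)" using Suc.prems by auto
    then show ?thesis by (simp only: gen_eigen_zero)
  next
    case False
    then obtain i' j' where ij: "i = Suc i'" "j = Suc j'" by (meson not0_implies_Suc)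
    have "gen_eigen A (\<mu> + \<nu>) (i' + j) (\<lambda>x. (lie_deriv A p x - \<mu> * p x) * q x)"
      using Suc ij by (intro Suc.hyps(1)) auto
    moreover have "gen_eigen A (\<mu> + \<nu>) (i + j') (\<lambda>x. p x * (lie_deriv A q x - \<nu> * q x))"
      using Suc ij by (intro Suc.hyps(1)) auto
    ultimately have "gen_eigen A (\<mu> + \<nu>) (i' + j)
        (\<lambda>x. (lie_deriv A p x - \<mu> * p x) * q x + p x * (lie_deriv A q x - \<nu> * q x))"
      using ij by (intro gen_eigen_add) (simp_all del: gen_eigen.simps)
    then have "gen_eigen A (\<mu> + \<nu>) (Suc (i' + j)) (\<lambda>x. p x * q x)"
      using sm by (simp add: smooth_mult lie_deriv_mult algebra_simps)
    then show ?thesis by (simp add: ij del: gen_eigen.simps)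
  qed
qed

lemma gen_eigen_shift:
  "gen_eigen A \<mu> n q \<Longrightarrow> gen_eigen A \<mu> n (\<lambda>x. lie_deriv A q x - \<nu> * q x)"
proof (induction n arbitrary: q)
  case (Suc n)
  have q: "smooth q" "smooth (lie_deriv A q)" using Suc.prems smooth_lie_deriv by auto
  have s: "smooth (\<lambda>x. lie_deriv A q x - \<nu> * q x)" by (intro smooth_diff smooth_cmult q)
  let ?q = "\<lambda>x. lie_deriv A q x - \<mu> * q x"
  have "gen_eigen A \<mu> n (\<lambda>x. lie_deriv A ?q x - \<nu> * ?q x)" using Suc by simp
  moreover have "lie_deriv A ?q x - \<nu> * ?q x = lie_deriv A (\<lambda>x. lie_deriv A q x - \<nu> * q x) x
      - \<mu> * (lie_deriv A q x - \<nu> * q x)" for x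
    using q by (simp add: lie_deriv_diff_cmult algebra_simps)
  ultimately show ?case using s by simp
qed (simp add: gen_eigen_zero lie_deriv_def)

text \<open>Sums avoiding the eigenvalue \<kappa>. The number m of summands is recorded for the
  induction that proves independence.\<close>

inductive gen_sum :: "complex \<Rightarrow> nat \<Rightarrow> ('w \<Rightarrow> complex) \<Rightarrow> bool" for \<kappa> where
  zero: "gen_sum \<kappa> 0 (\<lambda>x. 0)"
| step: "\<mu> \<noteq> \<kappa> \<Longrightarrow> gen_eigen A \<mu> n q \<Longrightarrow> gen_sum \<kappa> m r \<Longrightarrow> gen_sum \<kappa> (Suc m) (\<lambda>x. q x + r x)"

lemma gen_sum_smooth: "gen_sum \<kappa> m r \<Longrightarrow> smooth r"
  by (induction rule: gen_sum.induct) (auto intro: smooth_add gen_eigen_smooth)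

lemma gen_sum_shift: "gen_sum \<kappa> m r \<Longrightarrow> gen_sum \<kappa> m (\<lambda>x. lie_deriv A r x - \<nu> * r x)"
proof (induction rule: gen_sum.induct)
  case zero
  then show ?case by (simp add: gen_sum.zero)
next
  case (step \<mu> n q m r)
  have "gen_sum \<kappa> (Suc m) (\<lambda>x. (lie_deriv A q x - \<nu> * q x) + (lie_deriv A r x - \<nu> * r x))"
    using step by (intro gen_sum.step gen_eigen_shift)
  moreover have "smooth q" "smooth r" using step gen_eigen_smooth gen_sum_smooth by auto
  ultimately show ?case by (simp add: lie_deriv_add algebra_simps)
qed

text \<open>For r = q + r' the operator D - \<mu> multiplies r by the nonzero number \<kappa> -
  \<mu> but lowers the order of q. Induction on this order removes q and leaves a sum with one
  summand fewer.\<close>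

lemma gen_sum_eigen_zero:
  assumes "gen_sum \<kappa> m r" "\<And>x. lie_deriv A r x = \<kappa> * r x"
  shows "r = (\<lambda>x. 0)"
  using assms
proof (induction m arbitrary: r)
  case 0
  then show ?case by (auto elim: gen_sum.cases)
next
  case (Suc m)
  then obtain \<mu> n q r' where r: "r = (\<lambda>x. q x + r' x)" "\<mu> \<noteq> \<kappa>" "gen_eigen A \<mu> n q" "gen_sum \<kappa> m r'"
    by (auto elim: gen_sum.cases)
  have "(\<lambda>x. q x + r' x) = (\<lambda>x. 0)"
    if "gen_eigen A \<mu> n q" "gen_sum \<kappa> m r'" "\<And>x. lie_deriv A (\<lambda>x. q x + r' x) x = \<kappa> * (q x + r' x)" for n q r'
    using that
  proof (induction n arbitrary: q r')
    case 0
    then have q0: "q = (\<lambda>x. 0)" by simp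
    have "r' = (\<lambda>x. 0)" using Suc.IH[OF 0(2)] 0(3) unfolding q0 by simp
    then show ?case unfolding q0 by simp
  next
    case (Suc n)
    have sm: "smooth q" "smooth r'" using Suc.prems gen_eigen_smooth gen_sum_smooth by blast+
    let ?q = "\<lambda>x. lie_deriv A q x - \<mu> * q x" and ?r = "\<lambda>x. lie_deriv A r' x - \<mu> * r' x"
    have e: "lie_deriv A q x + lie_deriv A r' x = \<kappa> * (q x + r' x)" for x
      using Suc.prems(3)[of x] sm by (simp add: lie_deriv_add)
    have b: "?q x + ?r x = (\<kappa> - \<mu>) * (q x + r' x)" for x
      using e[of x] by (simp add: algebra_simps)
    have "lie_deriv A (\<lambda>x. ?q x + ?r x) x = \<kappa> * (?q x + ?r x)" for x
      unfolding b using sm Suc.prems(3) by (simp add: lie_deriv_cmult smooth_add mult_ac)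
    then have "(\<lambda>x. ?q x + ?r x) = (\<lambda>x. 0)"
      using Suc.prems by (intro Suc.IH gen_sum_shift) auto
    then show ?case using r(2) unfolding b by (auto simp: fun_eq_iff)
  qed
  from this[OF r(3,4)] Suc.prems(2) show ?case unfolding r(1) by blast
qed

text \<open>D - \<kappa> does not leave the sums avoiding \<kappa>, so induction on the order
  reduces to a genuine eigenfunction.\<close>

lemma gen_sum_gen_eigen_zero: "gen_sum \<kappa> m r \<Longrightarrow> gen_eigen A \<kappa> n r \<Longrightarrow> r = (\<lambda>x. 0)"
proof (induction n arbitrary: r)
  case (Suc n)
  have "(\<lambda>x. lie_deriv A r x - \<kappa> * r x) = (\<lambda>x. 0)"
    using Suc.prems by (intro Suc.IH gen_sum_shift) auto
  then show ?case by (intro gen_sum_eigen_zero[OF Suc.prems(1)]) (simp add: fun_eq_iff)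
qed simp

text \<open>When \<open>S\<close> is the semisimple part of \<open>A\<close>, every polynomial is a sum of such functions.\<close>

definition bi_eigen :: "('w \<Rightarrow> 'w) \<Rightarrow> complex \<Rightarrow> ('w \<Rightarrow> complex) \<Rightarrow> bool" where
  "bi_eigen S \<mu> q \<longleftrightarrow> (\<exists>n. gen_eigen A \<mu> n q) \<and> smooth q \<and> (\<forall>x. lie_deriv S q x = \<mu> * q x)"

inductive_set bi_sums :: "('w \<Rightarrow> 'w) \<Rightarrow> ('w \<Rightarrow> complex) set" for S where
  zero: "(\<lambda>x. 0) \<in> bi_sums S"
| step: "bi_eigen S \<mu> q \<Longrightarrow> r \<in> bi_sums S \<Longrightarrow> (\<lambda>x. q x + r x) \<in> bi_sums S"

lemma bi_sums_add: "p \<in> bi_sums S \<Longrightarrow> q \<in> bi_sums S \<Longrightarrow> (\<lambda>x. p x + q x) \<in> bi_sums S"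
  by (induction p rule: bi_sums.induct) (auto simp: add.assoc intro: bi_sums.intros)

lemma bi_sums_eigen: "bi_eigen S \<mu> q \<Longrightarrow> q \<in> bi_sums S"
  using bi_sums.step[OF _ bi_sums.zero] by fastforce

lemma bi_eigen_mult:
  assumes "bi_eigen S \<mu> p" "bi_eigen S \<nu> q" shows "bi_eigen S (\<mu> + \<nu>) (\<lambda>x. p x * q x)"
  using assms gen_eigen_mult unfolding bi_eigen_def
  by (auto simp: smooth_mult lie_deriv_mult algebra_simps) blast

lemma bi_sums_mult: "p \<in> bi_sums S \<Longrightarrow> q \<in> bi_sums S \<Longrightarrow> (\<lambda>x. p x * q x) \<in> bi_sums S"
proof (induction p rule: bi_sums.induct)
  case (step \<mu> p r)
  have "(\<lambda>x. p x * q x) \<in> bi_sums S"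
    using step.prems
  proof (induction q rule: bi_sums.induct)
    case (step \<nu> q r)
    then show ?case
      using bi_sums.step[OF bi_eigen_mult[OF \<open>bi_eigen S \<mu> p\<close>]] by (simp add: distrib_left)
  qed (simp add: bi_sums.zero)
  with step show ?case by (simp add: distrib_right bi_sums_add)
qed (simp add: bi_sums.zero)

lemma bi_eigen_const: "bi_eigen S 0 (\<lambda>x. c)"
  by (auto simp: bi_eigen_def intro!: exI[of _ 1])

lemma bi_sums_cmult: "q \<in> bi_sums S \<Longrightarrow> (\<lambda>x. c * q x) \<in> bi_sums S"
  by (rule bi_sums_mult[OF bi_sums_eigen[OF bi_eigen_const]])

lemma bi_eigen_add:
  assumes "bi_eigen S \<mu> p" "bi_eigen S \<mu> q" shows "bi_eigen S \<mu> (\<lambda>x. p x + q x)"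
proof -
  obtain m n where "gen_eigen A \<mu> m p" "gen_eigen A \<mu> n q" using assms by (auto simp: bi_eigen_def)
  then have "gen_eigen A \<mu> (max m n) (\<lambda>x. p x + q x)"
    by (intro gen_eigen_add) (auto intro: gen_eigen_mono[rotated])
  with assms show ?thesis by (auto simp: bi_eigen_def smooth_add lie_deriv_add distrib_left)
qed

text \<open>Summands with eigenvalue \<kappa> are collected in a; of those in b only the behaviour
  along A is remembered.\<close>

lemma bi_sums_split:
  assumes "q \<in> bi_sums S"
  shows "\<exists>a b m. bi_eigen S \<kappa> a \<and> gen_sum \<kappa> m b \<and> q = (\<lambda>x. a x + b x)"
  using assms
proof (induction q rule: bi_sums.induct)
  case zero
  have "bi_eigen S \<kappa> (\<lambda>x. 0)" by (auto simp: bi_eigen_def gen_eigen_zero)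
  then show ?case using gen_sum.zero by fastforce
next
  case (step \<mu> q r)
  then obtain a b m where ab: "bi_eigen S \<kappa> a" "gen_sum \<kappa> m b" "r = (\<lambda>x. a x + b x)" by blast
  show ?case
  proof (cases "\<mu> = \<kappa>")
    case True
    with step ab have "bi_eigen S \<kappa> (\<lambda>x. q x + a x)" by (simp add: bi_eigen_add)
    with ab show ?thesis by (intro exI[of _ "\<lambda>x. q x + a x"] exI[of _ b]) (auto simp: add.assoc)
  next
    case False
    with step ab have "gen_sum \<kappa> (Suc m) (\<lambda>x. q x + b x)" by (auto simp: bi_eigen_def intro: gen_sum.step)
    with ab show ?thesis by (intro exI[of _ a] exI[of _ "\<lambda>x. q x + b x"]) (auto simp: add_ac)
  qed
qed

text \<open>In the splitting q = a + b at \<kappa>, b = q - a is a generalized eigenfunction for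
  \<kappa> and a sum of ones for other eigenvalues, hence 0. On a the derivation along S is
  multiplication by \<kappa>.\<close>

lemma bi_sums_eigenI:
  assumes q: "q \<in> bi_sums S" and g: "gen_eigen A \<kappa> n q" shows "lie_deriv S q x = \<kappa> * q x"
proof -
  obtain a b m where ab: "bi_eigen S \<kappa> a" "gen_sum \<kappa> m b" "q = (\<lambda>x. a x + b x)"
    using bi_sums_split[OF q] by blast
  obtain k where k: "gen_eigen A \<kappa> k a" using ab(1) by (auto simp: bi_eigen_def)
  have "gen_eigen A \<kappa> (max n k) (\<lambda>x. q x - a x)"
    using k g by (intro gen_eigen_diff) (auto intro: gen_eigen_mono[rotated])
  then have "gen_eigen A \<kappa> (max n k) b" by (simp add: ab(3))
  then have "b = (\<lambda>x. 0)" by (rule gen_sum_gen_eigen_zero[OF ab(2)])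
  with ab show ?thesis by (simp add: bi_eigen_def)
qed

end

text \<open>For linear A, the Lie bracket with the sign convention of \<open>ad\<close>.\<close>

definition bracket :: "('w::real_normed_vector \<Rightarrow> 'w) \<Rightarrow> ('w \<Rightarrow> 'w) \<Rightarrow> 'w \<Rightarrow> 'w" where
  "bracket A Y x = A (Y x) - frechet_derivative Y (at x) (A x)"

text \<open>On polynomial vector fields, the bracket with the semisimple part is the semisimple part of
  the bracket; here only the inclusion of the generalized kernel is needed.\<close>

theorem semisimple_part_bracket:
  fixes A S Y :: "'w::euclidean_space \<Rightarrow> 'w"
  assumes ss: "is_semisimple_part A S" and Y: "polynomial_function Y"
    and ker: "(bracket A ^^ m) Y = (\<lambda>x. 0)"
  shows "frechet_derivative Y (at x) (S x) = S (Y x)"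
proof -
  obtain T where S: "semisimple_map S" and T: "nilpotent_map T"
    and AST: "\<And>x. A x = S x + T x" and comm: "S \<circ> T = T \<circ> S"
    using ss by (auto simp: is_semisimple_part_def)
  have lin: "linear S" "linear T" using S T by (auto simp: semisimple_map_def nilpotent_map_def)
  obtain k where k: "\<And>x. (T ^^ k) x = 0" using T by (auto simp: nilpotent_map_def)
  have ST: "S (T x) = T (S x)" for x using comm by (metis comp_apply)
  have A: "linear A" using lin unfolding linear_iff AST by (simp add: algebra_simps)
  have eigT: "eigen_functional S \<kappa> (\<lambda>x. l (T x))" if "eigen_functional S \<kappa> l" for \<kappa> l
    using that lin ST by (auto simp: eigen_functional_def linear_iff) metis
  have blin: "bounded_linear l" if "eigen_functional S \<kappa> l" for \<kappa> l
    using that by (simp add: eigen_functional_def linear_conv_bounded_linear)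
  have bA: "bounded_linear A" using A by (simp add: linear_conv_bounded_linear)
  have brs: "smooth (bracket A Z)" if "smooth Z" for Z
    unfolding bracket_def[abs_def]
    by (intro smooth_diff smooth_linear_comp[OF bA that]
        smooth_frechet_derivative[OF that smooth_linear[OF A]])
  \<comment> \<open>The derivation along A minus \<kappa> sends l o Z to l o T o Z - l o (bracket A
    Z). The first term uses up one power of T, the second one power of the bracket.\<close>
  have chain: "gen_eigen A \<kappa> n (\<lambda>x. l (Z x))"
    if "n = i + j" "eigen_functional S \<kappa> l" "\<And>x. l ((T ^^ i) x) = 0" "smooth Z" "(bracket A ^^ j) Z = (\<lambda>x. 0)"
    for n i j \<kappa> l Z
    using that
  proof (induction n arbitrary: i j l Z)
    case 0
    then have "l (Z x) = 0" for x by simp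
    then show ?case by simp
  next
    case (Suc n)
    have l: "linear l" "\<And>x. l (S x) = \<kappa> * l x" using Suc.prems by (auto simp: eigen_functional_def)
    consider "i = 0" | "j = 0" | i' j' where "i = Suc i'" "j = Suc j'" by (meson not0_implies_Suc)
    then show ?case
    proof cases
      case 1
      then have "(\<lambda>x. l (Z x)) = (\<lambda>x. 0)" using Suc.prems(3) by simp
      then show ?thesis by (simp only: gen_eigen_zero)
    next
      case 2
      then have "(\<lambda>x. l (Z x)) = (\<lambda>x. 0)" using Suc.prems(5) by (simp add: linear_0[OF l(1)])
      then show ?thesis by (simp only: gen_eigen_zero)
    next
      case 3
      have "gen_eigen A \<kappa> n (\<lambda>x. l (T (Z x)))"
        using 3 Suc.prems eigT by (intro Suc.IH[of i' j]) (auto simp: funpow_swap1)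
      moreover have "gen_eigen A \<kappa> n (\<lambda>x. l (bracket A Z x))"
        using 3 Suc.prems brs by (intro Suc.IH[of i j']) (auto simp: funpow_swap1)
      ultimately have "gen_eigen A \<kappa> n (\<lambda>x. l (T (Z x)) - l (bracket A Z x))" by (rule gen_eigen_diff)
      moreover have "l (T (Z x)) - l (bracket A Z x) = lie_deriv A (\<lambda>x. l (Z x)) x - \<kappa> * l (Z x)" for x
        using lie_deriv_linear_comp[OF blin[OF Suc.prems(2)] Suc.prems(4), of A x]
        by (simp add: bracket_def lie_deriv_def AST linear_diff[OF l(1)] linear_add[OF l(1)] l(2))
      ultimately show ?thesis
        using smooth_linear_comp[OF blin[OF Suc.prems(2)] Suc.prems(4)] by simp
    qed
  qed
  \<comment> \<open>The derivation along A minus \<kappa> sends l to l o T, so the nilpotency of T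
    makes l a generalized eigenfunction along A; along S it is a genuine one.\<close>
  have eig_bi: "l \<in> bi_sums A S" if l: "eigen_functional S \<kappa> l" for \<kappa> l
  proof (rule bi_sums_eigen[OF A])
    have "gen_eigen A \<kappa> k l"
    proof -
      have "gen_eigen A \<kappa> n l" if "eigen_functional S \<kappa> l" "\<And>x. l ((T ^^ n) x) = 0" for n l
        using that
      proof (induction n arbitrary: l)
        case (Suc n)
        have "gen_eigen A \<kappa> n (\<lambda>x. l (T x))"
          using Suc.prems eigT by (intro Suc.IH) (auto simp: funpow_swap1)
        moreover have "l (T x) = lie_deriv A l x - \<kappa> * l x" for x
          using lie_deriv_linear_comp[OF blin[OF Suc.prems(1)] smooth_id, of A x] Suc.prems(1)
          by (simp add: lie_deriv_def AST eigen_functional_def linear_add)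
        ultimately show ?case using smooth_bounded_linear[OF blin[OF Suc.prems(1)]] by simp
      qed (simp add: fun_eq_iff)
      from this[OF l] show ?thesis using l by (simp add: k eigen_functional_def linear_0)
    qed
    moreover have "lie_deriv S l x = \<kappa> * l x" for x
      using lie_deriv_linear_comp[OF blin[OF l] smooth_id, of S x] l
      by (simp add: lie_deriv_def eigen_functional_def)
    ultimately show "bi_eigen A S \<kappa> l"
      using smooth_bounded_linear[OF blin[OF l]] by (auto simp: bi_eigen_def[OF A])
  qed
  have eig_sums_bi: "f \<in> bi_sums A S" if "f \<in> eigen_sums S" for f
    using that by (induction rule: eigen_sums.induct) (auto intro: bi_sums.zero[OF A] bi_sums_add[OF A] eig_bi)
  \<comment> \<open>Real linear functionals are sums of eigenfunctionals, and simultaneous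
    eigenfunctions are closed under products; this reaches all polynomials.\<close>
  have poly_bi: "(\<lambda>x. complex_of_real (p x)) \<in> bi_sums A S" if "real_polynomial_function p" for p
    using that
  proof (induction p rule: real_polynomial_function.induct)
    case (linear f)
    define r where "r = (\<Sum>b\<in>Basis. f b *\<^sub>R b)"
    have "f x = x \<bullet> r" for x
      using linear_basis_expand[OF bounded_linear.linear[OF linear], of x]
      by (simp add: r_def inner_sum_right mult.commute)
    then show ?case using eig_sums_bi[OF inner_in_eigen_sums[OF S, of r]] by simp
  next
    case (const c)
    show ?case by (rule bi_sums_eigen[OF A bi_eigen_const[OF A]])
  qed (auto intro: bi_sums_add[OF A] bi_sums_mult[OF A])
  have sY: "smooth Y" by (rule smooth_polynomial_function[OF Y])
  have "l (frechet_derivative Y (at x) (S x) - S (Y x)) = 0" if l: "eigen_functional S \<kappa> l" for \<kappa> l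
  proof -
    have ll: "linear l" "\<And>x. l (S x) = \<kappa> * l x" using l by (auto simp: eigen_functional_def)
    have fin: "(\<lambda>x. \<Sum>b\<in>B. l b * complex_of_real (Y x \<bullet> b)) \<in> bi_sums A S" if "B \<subseteq> Basis" for B
      using finite_subset[OF that finite_Basis] that
    proof (induction B rule: finite_induct)
      case empty
      then show ?case by (simp add: bi_sums.zero[OF A])
    next
      case (insert b B)
      then show ?case using Y unfolding polynomial_function_iff_Basis_inner
        by (simp add: bi_sums_add[OF A] bi_sums_cmult[OF A] poly_bi)
    qed
    have lexp: "l (Y x) = (\<Sum>b\<in>Basis. l b * complex_of_real (Y x \<bullet> b))" for x
      by (subst linear_basis_expand[OF ll(1)]) (simp add: scaleR_conv_of_real mult.commute)
    have "(\<lambda>x. l (Y x)) \<in> bi_sums A S" unfolding lexp by (rule fin) simp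
    moreover have "gen_eigen A \<kappa> (k + m) (\<lambda>x. l (Y x))"
      by (rule chain[OF refl l _ sY ker]) (simp add: k linear_0[OF ll(1)])
    ultimately have "lie_deriv S (\<lambda>x. l (Y x)) x = \<kappa> * l (Y x)" by (rule bi_sums_eigenI[OF A])
    then show ?thesis
      using lie_deriv_linear_comp[OF blin[OF l] sY, of S x]
      by (simp add: lie_deriv_def linear_diff[OF ll(1)] ll(2))
  qed
  then have "frechet_derivative Y (at x) (S x) - S (Y x) = 0" by (rule eigen_functionals_separate[OF S])
  then show ?thesis by simp
qed

subsection \<open>Coupled cell maps\<close>

text \<open>The states read by cell i. The index type is general so that \<tau> can be \<sigma>, for
  the network on V^N, or \<open>sigma_tilde\<close>, for the semigroup acting on itself, where the
  result is \<open>input_map\<close>.\<close>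

definition inputs :: "('n::finite \<Rightarrow> 'i \<Rightarrow> 'i) \<Rightarrow> 'i \<Rightarrow> 'a ^ 'i \<Rightarrow> 'a ^ 'n" where
  "inputs \<tau> i x = (\<chi> j. x $ \<tau> j i)"

lemma gamma_nth [simp]: "gamma \<tau> f x $ i = f (inputs \<tau> i x)"
  by (simp add: gamma_def inputs_def)

lemma inputs_nth [simp]: "inputs \<tau> i x $ j = x $ \<tau> j i"
  by (simp add: inputs_def)

lemma input_map_eq_inputs: "input_map \<sigma> = inputs (sigma_tilde \<sigma>)"
  by (simp add: input_map_def[abs_def] inputs_def[abs_def])

lemma linear_inputs: "linear (inputs \<tau> i :: 'a::real_vector ^ 'i::finite \<Rightarrow> 'a ^ 'n::finite)"
  by (rule linearI) (simp_all add: vec_eq_iff)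

lemma sigma_tilde_comp:
  assumes "inj \<sigma>" "map_semigroup \<sigma>"
  shows "\<sigma> (sigma_tilde \<sigma> j k) = \<sigma> j \<circ> \<sigma> k"
proof -
  obtain l where l: "\<sigma> j \<circ> \<sigma> k = \<sigma> l" using assms(2) unfolding map_semigroup_def by blast
  have "sigma_tilde \<sigma> j k = l"
    unfolding sigma_tilde_def l using assms(1) by (intro the_equality) (auto dest: injD)
  with l show ?thesis by simp
qed

lemma sigma_act:
  assumes "inj \<sigma>" "map_semigroup \<sigma>"
  shows "\<sigma> j (\<sigma> k i) = \<sigma> (sigma_tilde \<sigma> j k) i"
  using sigma_tilde_comp[OF assms, of j k] by simp

lemma sigma_tilde_act:
  assumes "inj \<sigma>" "map_semigroup \<sigma>"
  shows "sigma_tilde \<sigma> j (sigma_tilde \<sigma> k i) = sigma_tilde \<sigma> (sigma_tilde \<sigma> j k) i"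
  using sigma_tilde_comp[OF assms] by (intro injD[OF assms(1)]) (simp add: o_assoc)

lemma vec_eq_sum_axis: "x = (\<Sum>i\<in>UNIV. axis i (x $ i))" for x :: "'a::real_vector ^ 'i::finite"
  by (simp add: vec_eq_iff axis_def if_distrib[of "\<lambda>f. f $ _"] if_distrib sum.delta cong: if_cong)

lemma bounded_linear_axis: "bounded_linear (axis i :: 'a::euclidean_space \<Rightarrow> 'a ^ 'i::finite)"
  unfolding linear_conv_bounded_linear[symmetric]
  by (rule linearI) (simp_all add: vec_eq_iff axis_def)

lemma gamma_eq_sum:
  "gamma \<tau> f = (\<lambda>x. \<Sum>i\<in>UNIV. axis i (f (inputs \<tau> i x)))" for f :: "'a::real_vector ^ 'n::finite \<Rightarrow> 'a"
  using vec_eq_sum_axis[of "gamma \<tau> f _"] by (intro ext) simp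

lemma bounded_linear_inputs:
  "bounded_linear (inputs \<tau> i :: 'a::euclidean_space ^ 'i::finite \<Rightarrow> 'a ^ 'n::finite)"
  by (simp add: linear_conv_bounded_linear[symmetric] linear_inputs)

lemma smooth_gamma:
  fixes f :: "'a::euclidean_space ^ 'n::finite \<Rightarrow> 'a" and \<tau> :: "'n \<Rightarrow> 'i::finite \<Rightarrow> 'i"
  assumes "smooth f" shows "smooth (gamma \<tau> f)"
  unfolding gamma_eq_sum
  by (intro smooth_sum smooth_linear_comp[OF bounded_linear_axis] smooth_compose[OF assms]
      smooth_bounded_linear bounded_linear_inputs) auto

lemma polynomial_gamma:
  fixes f :: "'a::euclidean_space ^ 'n::finite \<Rightarrow> 'a" and \<tau> :: "'n \<Rightarrow> 'i::finite \<Rightarrow> 'i"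
  assumes "polynomial_function f" shows "polynomial_function (gamma \<tau> f)"
proof -
  have "polynomial_function (\<lambda>x. axis i (f (inputs \<tau> i x)) :: 'a ^ 'i)" for i
    using polynomial_function_compose[OF polynomial_function_compose[OF
        polynomial_function_bounded_linear[OF bounded_linear_inputs] assms]
        polynomial_function_bounded_linear[OF bounded_linear_axis]]
    by (simp add: o_def)
  then show ?thesis unfolding gamma_eq_sum by (intro polynomial_function_sum) auto
qed

lemma linear_gamma:
  fixes f :: "'a::euclidean_space ^ 'n::finite \<Rightarrow> 'a"
  assumes "linear f" shows "linear (gamma \<tau> f)"
  by (rule linearI) (simp_all add: vec_eq_iff linear_add[OF linear_inputs] linear_add[OF assms]
      linear_scale[OF linear_inputs] linear_scale[OF assms])

lemma gamma_frechet_derivative: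
  fixes f :: "'a::euclidean_space ^ 'n::finite \<Rightarrow> 'a" and \<tau> :: "'n \<Rightarrow> 'i::finite \<Rightarrow> 'i"
  assumes "smooth f"
  shows "frechet_derivative (gamma \<tau> f) (at x) v $ i
    = frechet_derivative f (at (inputs \<tau> i x)) (inputs \<tau> i v)"
proof -
  have "((\<lambda>x. f (inputs \<tau> i x)) has_derivative
      (\<lambda>v. frechet_derivative f (at (inputs \<tau> i x)) (inputs \<tau> i v))) (at x)" for i
    by (rule has_derivative_compose[OF bounded_linear_imp_has_derivative[OF bounded_linear_inputs]
        smooth_has_derivative[OF assms]])
  then have "(gamma \<tau> f has_derivative
      (\<lambda>v. \<Sum>i\<in>UNIV. axis i (frechet_derivative f (at (inputs \<tau> i x)) (inputs \<tau> i v)))) (at x)"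
    unfolding gamma_eq_sum
    by (intro has_derivative_sum bounded_linear.has_derivative[OF bounded_linear_axis])
  then have "frechet_derivative (gamma \<tau> f) (at x) v
      = (\<Sum>i\<in>UNIV. axis i (frechet_derivative f (at (inputs \<tau> i x)) (inputs \<tau> i v)))"
    by (simp add: frechet_derivative_at[symmetric])
  also have "\<dots> = (\<chi> i. frechet_derivative f (at (inputs \<tau> i x)) (inputs \<tau> i v))"
    using vec_eq_sum_axis[of "\<chi> i. frechet_derivative f (at (inputs \<tau> i x)) (inputs \<tau> i v)"] by simp
  finally show ?thesis by simp
qed

section \<open>The operators \<open>ad\<close> in the form of brackets\<close>

lemma partial_D_eq:
  fixes f :: "'a::euclidean_space ^ 'n::finite \<Rightarrow> 'b::real_normed_vector"
  assumes "smooth f"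
  shows "partial_D j f X w = frechet_derivative f (at X) (axis j w)"
proof -
  have e: "(\<chi> i. if i = j then v else X $ i) = X + axis j (v - X $ j)" for v
    by (simp add: vec_eq_iff axis_def)
  have d: "((\<lambda>v. X + axis j (v - X $ j)) has_derivative axis j) (at (X $ j))"
    using has_derivative_add[OF has_derivative_const bounded_linear.has_derivative[OF bounded_linear_axis
          has_derivative_diff[OF has_derivative_ident has_derivative_const]]]
    by fastforce
  have "((\<lambda>v. f (X + axis j (v - X $ j))) has_derivative (\<lambda>w. frechet_derivative f (at X) (axis j w))) (at (X $ j))"
    using has_derivative_compose[OF d, of f "frechet_derivative f (at X)"] smooth_has_derivative[OF assms, of X]
    by (simp add: axis_eq_0_iff[THEN iffD2])
  then show ?thesis unfolding partial_D_def e by (simp add: frechet_derivative_at[symmetric])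
qed

text \<open>Summed over j, the partial derivatives in the directions g o A_j form the total
  derivative along the field of g on V^n.\<close>

lemma ad_eq:
  fixes f g :: "'a::euclidean_space ^ 'n::finite \<Rightarrow> 'a"
  assumes f: "smooth f" and g: "smooth g"
  shows "ad \<sigma> f g X = frechet_derivative f (at X) (gamma (sigma_tilde \<sigma>) g X)
    - frechet_derivative g (at X) (gamma (sigma_tilde \<sigma>) f X)"
proof -
  have "(\<Sum>j\<in>UNIV. partial_D j p X (q (input_map \<sigma> j X)))
      = frechet_derivative p (at X) (gamma (sigma_tilde \<sigma>) q X)"
    if "smooth p" for p q :: "'a ^ 'n \<Rightarrow> 'a"
    unfolding gamma_eq_sum input_map_eq_inputs partial_D_eq[OF that]
    by (simp add: linear_sum[OF linear_smooth_frechet[OF that]])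
  with f g show ?thesis by (simp add: ad_def sum_subtractf)
qed

lemma frechet_derivative_linear:
  fixes f :: "'a::euclidean_space \<Rightarrow> 'b::real_normed_vector"
  assumes "linear f" shows "frechet_derivative f (at x) = f"
  using assms by (metis bounded_linear_imp_has_derivative frechet_derivative_at linear_conv_bounded_linear)

text \<open>The inputs of cell \<tau> j i are obtained from those of cell i through the
  multiplication table c. This is where the semigroup property enters: input maps intertwine a
  network vector field with that of the semigroup acting on itself.\<close>

lemma inputs_gamma:
  assumes act: "\<And>j k i. \<tau> j (\<tau> k i) = \<tau> (c j k) i"
  shows "inputs \<tau> i (gamma \<tau> g x) = gamma c g (inputs \<tau> i x)"
proof -
  have "inputs \<tau> (\<tau> j i) x = inputs c j (inputs \<tau> i x)" for j by (simp add: vec_eq_iff act)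
  then show ?thesis by (subst vec_eq_iff) simp
qed

lemma P_D:
  assumes "p \<in> P k"
  shows "polynomial_function p" "p (c *\<^sub>R x) = c ^ Suc k *\<^sub>R p x"
  using assms by (auto simp: P_def homogeneous_polynomial_def)

lemma ad_in_P:
  fixes f0 :: "'a::euclidean_space ^ 'n::finite \<Rightarrow> 'a"
  assumes f0: "linear f0" and g: "g \<in> P k" shows "ad \<sigma> f0 g \<in> P k"
proof -
  let ?c = "sigma_tilde \<sigma>"
  have sm: "smooth f0" "smooth g" using f0 P_smooth[OF g] by (auto intro: smooth_linear)
  have eq: "ad \<sigma> f0 g = (\<lambda>X. f0 (gamma ?c g X) - frechet_derivative g (at X) (gamma ?c f0 X))"
    using ad_eq[OF sm] by (auto simp: fun_eq_iff frechet_derivative_linear[OF f0])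
  have bl: "bounded_linear f0" "bounded_linear (gamma ?c f0)"
    using f0 linear_gamma[OF f0] by (auto simp: linear_conv_bounded_linear)
  have "polynomial_function (ad \<sigma> f0 g)"
    unfolding eq
    using polynomial_function_compose[OF polynomial_gamma[OF P_D(1)[OF g]]
        polynomial_function_bounded_linear[OF bl(1)], of ?c]
    by (intro polynomial_function_diff polynomial_frechet_derivative[OF P_D(1)[OF g] bl(2)])
      (simp add: o_def)
  moreover have "ad \<sigma> f0 g (a *\<^sub>R x) = a ^ Suc k *\<^sub>R ad \<sigma> f0 g x" for a x
  proof -
    have "gamma ?c g (a *\<^sub>R x) = a ^ Suc k *\<^sub>R gamma ?c g x"
      by (simp add: vec_eq_iff linear_scale[OF linear_inputs] P_D(2)[OF g] del: power_Suc)
    moreover have "frechet_derivative g (at (a *\<^sub>R x)) v = a ^ k *\<^sub>R frechet_derivative g (at x) v" for v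
      by (rule frechet_derivative_homogeneous[OF sm(2) P_D(2)[OF g]])
    ultimately show ?thesis
      unfolding eq by (simp add: linear_scale[OF f0] linear_scale[OF linear_gamma[OF f0]]
          linear_scale[OF linear_smooth_frechet[OF sm(2)]] scaleR_diff_right mult.commute)
  qed
  ultimately show ?thesis by (simp add: P_def homogeneous_polynomial_def)
qed

lemma ad_linear_right:
  fixes f0 :: "'a::euclidean_space ^ 'n::finite \<Rightarrow> 'a"
  assumes f0: "linear f0" and g: "smooth g" "smooth h"
  shows "ad \<sigma> f0 (g + h) = ad \<sigma> f0 g + ad \<sigma> f0 h" "ad \<sigma> f0 (a *\<^sub>R g) = a *\<^sub>R ad \<sigma> f0 g"
proof -
  let ?c = "sigma_tilde \<sigma>"
  have sf: "smooth f0" using f0 by (rule smooth_linear)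
  have sm: "smooth (g + h)" "smooth (a *\<^sub>R g)"
    using smooth_add[OF g] smooth_linear_comp[OF bounded_linear_scaleR_right g(1)]
    by (simp_all add: plus_fun_def scaleR_fun_def)
  note sm' = sm(2)[unfolded scaleR_fun_def]
  have "gamma ?c (g + h) X = gamma ?c g X + gamma ?c h X" "gamma ?c (a *\<^sub>R g) X = a *\<^sub>R gamma ?c g X" for X
    by (simp_all add: vec_eq_iff scaleR_fun_def)
  moreover have "frechet_derivative (g + h) (at X) v = frechet_derivative g (at X) v + frechet_derivative h (at X) v" for X v
    using frechet_derivative_add[OF g[THEN smooth_differentiable]] by (simp add: plus_fun_def)
  moreover have "frechet_derivative (a *\<^sub>R g) (at X) v = a *\<^sub>R frechet_derivative g (at X) v" for X v
    unfolding scaleR_fun_def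
    by (subst frechet_derivative_at[OF has_derivative_scaleR_right[OF smooth_has_derivative[OF g(1)]], symmetric]) simp
  ultimately show "ad \<sigma> f0 (g + h) = ad \<sigma> f0 g + ad \<sigma> f0 h" "ad \<sigma> f0 (a *\<^sub>R g) = a *\<^sub>R ad \<sigma> f0 g"
    by (auto simp: fun_eq_iff ad_eq[OF sf] sm sm' g frechet_derivative_linear[OF f0] linear_add[OF f0]
        linear_scale[OF f0] scaleR_fun_def algebra_simps)
qed

text \<open>By the chain rule and \<open>inputs_gamma\<close>, the i-th component of the bracket is
  the formula of \<open>ad_eq\<close> at the inputs of cell i.\<close>

lemma gamma_ad:
  fixes f0 :: "'a::euclidean_space ^ 'n::finite \<Rightarrow> 'a" and \<sigma> :: "'n \<Rightarrow> 'm::finite \<Rightarrow> 'm"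
  assumes \<sigma>: "inj \<sigma>" "map_semigroup \<sigma>" and f0: "linear f0" and g: "smooth g"
  shows "gamma \<sigma> (ad \<sigma> f0 g) = bracket (gamma \<sigma> f0) (gamma \<sigma> g)"
  unfolding bracket_def[abs_def]
  by (simp add: fun_eq_iff vec_eq_iff gamma_frechet_derivative[OF g] inputs_gamma[OF sigma_act[OF \<sigma>]]
      ad_eq[OF smooth_linear[OF f0] g] frechet_derivative_linear[OF f0])

lemma gamma_ad_pow:
  fixes f0 :: "'a::euclidean_space ^ 'n::finite \<Rightarrow> 'a" and \<sigma> :: "'n \<Rightarrow> 'm::finite \<Rightarrow> 'm"
  assumes \<sigma>: "inj \<sigma>" "map_semigroup \<sigma>" and f0: "linear f0" and g: "g \<in> P k"
  shows "gamma \<sigma> ((ad \<sigma> f0 ^^ m) g) = (bracket (gamma \<sigma> f0) ^^ m) (gamma \<sigma> g)"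
proof (induction m)
  case (Suc m)
  have "(ad \<sigma> f0 ^^ m) g \<in> P k" using g ad_in_P[OF f0] by (induction m) auto
  then show ?case using gamma_ad[OF \<sigma> f0 P_smooth] Suc by simp
qed simp

subsection \<open>Transforming the network by a polynomial change of coordinates\<close>

text \<open>With \<open>\<Psi> = id + \<gamma>\<^sub>g\<close>, the vector field \<open>\<gamma>\<^sub>h\<close> is the pullback of \<open>\<gamma>\<^sub>f\<close> under \<open>\<Psi>\<close> near \<open>0\<close>.\<close>

definition pullback_solution ::
  "('n::finite \<Rightarrow> 'm \<Rightarrow> 'm) \<Rightarrow> ('a::euclidean_space ^ 'n \<Rightarrow> 'a) \<Rightarrow> ('a ^ 'n \<Rightarrow> 'a) \<Rightarrow> ('a ^ 'n \<Rightarrow> 'a) \<Rightarrow> bool" where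
  "pullback_solution \<sigma> f g h \<longleftrightarrow> smooth h \<and> (\<forall>\<^sub>F X in nhds 0.
     h X + frechet_derivative g (at X) (gamma (sigma_tilde \<sigma>) h X) = f (X + gamma (sigma_tilde \<sigma>) g X))"

lemma vanish_order_2_derivative:
  fixes g :: "'a::euclidean_space \<Rightarrow> 'b::euclidean_space"
  assumes g: "smooth g" "vanish_order 2 g" shows "frechet_derivative g (at 0) v = 0"
proof -
  have "g 0 = 0" by (rule vanish_order_imp_0[OF g(2)]) simp
  from vanish_order_diff[OF g(2) vanish_order_sub_linear_part[OF g(1) this]]
  have "vanish_order (Suc 1) (\<lambda>x. \<Sum>k<1. taylor_part k g x)" by (simp add: numeral_2_eq_2)
  then have "taylor_part 0 g v = 0"
    by (rule homogeneous_sum_unique) (auto simp: P_D(2)[OF taylor_part_in_P[OF g(1)]] simp del: power_Suc)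
  then show ?thesis by (simp add: taylor_part_def dir_deriv_def)
qed

lemma vanish_order_frechet_apply:
  fixes g :: "'a::euclidean_space \<Rightarrow> 'b::euclidean_space" and v :: "'a \<Rightarrow> 'a"
  assumes g: "smooth g" "\<And>b. vanish_order m (\<lambda>X. frechet_derivative g (at X) b)" and v: "vanish_order n v"
  shows "vanish_order (m + n) (\<lambda>X. frechet_derivative g (at X) (v X))"
proof -
  have "vanish_order (n + m) (\<lambda>X. \<Sum>b\<in>Basis. (v X \<bullet> b) *\<^sub>R frechet_derivative g (at X) b)"
    by (intro vanish_order_sum vanish_order_bilinear[OF bounded_bilinear_scaleR]
        vanish_order_linear_comp[OF bounded_linear_inner_left v] g) auto
  then show ?thesis
    by (simp add: frechet_derivative_basis[OF smooth_differentiable[OF g(1)], symmetric] add.commute)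
qed

lemma vanish_order_frechet_1:
  fixes g :: "'a::euclidean_space \<Rightarrow> 'b::euclidean_space"
  assumes "smooth g" "vanish_order 2 g" shows "vanish_order 1 (\<lambda>X. frechet_derivative g (at X) b)"
  using vanish_order_2_derivative[OF assms] by (intro vanish_order_1 smooth_dir_deriv assms(1))

lemma vanish_order_gamma:
  fixes f :: "'a::euclidean_space ^ 'n::finite \<Rightarrow> 'a" and \<tau> :: "'n \<Rightarrow> 'i::finite \<Rightarrow> 'i"
  assumes "vanish_order m f" shows "vanish_order m (gamma \<tau> f)"
  unfolding gamma_eq_sum
  by (intro vanish_order_sum vanish_order_linear_comp[OF bounded_linear_axis]
      vanish_order_compose[OF assms] vanish_order_linear linear_inputs) auto

lemma vanish_order_near_identity:
  fixes g :: "'a::euclidean_space ^ 'n::finite \<Rightarrow> 'a" and \<tau> :: "'n \<Rightarrow> 'n \<Rightarrow> 'n"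
  assumes "vanish_order 2 g" shows "vanish_order 1 (\<lambda>X. X + gamma \<tau> g X)"
  using vanish_order_linear[OF linear_id] vanish_order_mono[OF vanish_order_gamma[OF assms], of 1]
  by (intro vanish_order_add) (auto simp: id_def)

text \<open>A mean value estimate on the ball of radius |a X| + |b X|: the derivative of f is O(|X|)
  there, and the displacement b has order m + 1.\<close>

lemma vanish_order_increment:
  fixes f :: "'a::euclidean_space \<Rightarrow> 'b::euclidean_space" and a b :: "'c::real_normed_vector \<Rightarrow> 'a"
  assumes f: "smooth f" "vanish_order 2 f" and a: "vanish_order 1 a" and b: "vanish_order (Suc m) b"
  shows "vanish_order (Suc (Suc m)) (\<lambda>X. f (a X + b X) - f (a X))"
proof -
  have "\<exists>C. C \<ge> 0 \<and> (\<forall>\<^sub>F z in nhds 0. norm (frechet_derivative f (at z) i) \<le> C * norm z)" for i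
    by (rule vanish_orderE[OF vanish_order_frechet_1[OF f, of i]]) auto
  from choice[OF allI[OF this]] obtain C where
    "\<forall>i. C i \<ge> 0 \<and> (\<forall>\<^sub>F z in nhds 0. norm (frechet_derivative f (at z) i) \<le> C i * norm z)" ..
  then have C: "\<And>i. C i \<ge> 0"
    "\<And>i. \<forall>\<^sub>F z in nhds 0. norm (frechet_derivative f (at z) i) \<le> C i * norm z" by simp_all
  define K where "K = (\<Sum>i\<in>Basis. C i)"
  have "\<forall>\<^sub>F z in nhds 0. \<forall>i\<in>Basis. norm (frechet_derivative f (at z) i) \<le> C i * norm z"
    using C(2) by (intro eventually_ball_finite) auto
  then obtain e where e: "e > 0"
    "\<And>z i. norm z < e \<Longrightarrow> i \<in> Basis \<Longrightarrow> norm (frechet_derivative f (at z) i) \<le> C i * norm z"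
    by (auto simp: eventually_nhds_metric dist_norm)
  have der: "norm (frechet_derivative f (at z) v) \<le> (K * norm z) * norm v" if "norm z < e" for z v
  proof -
    have "norm (frechet_derivative f (at z) v) \<le> (\<Sum>i\<in>Basis. norm ((v \<bullet> i) *\<^sub>R frechet_derivative f (at z) i))"
      by (subst frechet_derivative_basis[OF smooth_differentiable[OF f(1)]]) (rule norm_sum)
    also have "\<dots> \<le> (\<Sum>i\<in>Basis. norm v * (C i * norm z))"
      unfolding norm_scaleR using e(2)[OF that] by (intro sum_mono mult_mono) (auto simp: Basis_le_norm)
    finally show ?thesis by (simp add: K_def sum_distrib_left sum_distrib_right mult_ac)
  qed
  have K0: "K \<ge> 0" using C(1) by (auto simp: K_def intro: sum_nonneg)
  have "vanish_order 1 (\<lambda>X. norm (a X) + norm (b X))"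
    using a vanish_order_mono[OF b, of 1] by (intro vanish_order_add) (simp_all add: vanish_order_def)
  then have "vanish_order (1 + Suc m) (\<lambda>X. (norm (a X) + norm (b X)) *\<^sub>R b X)"
    using b by (intro vanish_order_bilinear[OF bounded_bilinear_scaleR])
  then obtain D where D: "D \<ge> 0"
    "\<forall>\<^sub>F X in nhds 0. norm ((norm (a X) + norm (b X)) *\<^sub>R b X) \<le> D * norm X ^ Suc (Suc m)"
    by (auto elim: vanish_orderE)
  have small: "\<forall>\<^sub>F X in nhds 0. norm (a X) < e / 2" "\<forall>\<^sub>F X in nhds 0. norm (b X) < e / 2"
    using filterlim_iff[THEN iffD1, OF vanish_order_tendsto, rule_format, OF _ eventually_small[of "e / 2"]]
      a b e(1) by auto
  have "\<forall>\<^sub>F X in nhds 0. norm (f (a X + b X) - f (a X)) \<le> (K * D) * norm X ^ Suc (Suc m)"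
    using small D(2)
  proof eventually_elim
    case (elim X)
    let ?r = "norm (a X) + norm (b X)"
    have "norm (f (a X + b X) - f (a X)) \<le> (K * ?r) * norm (a X + b X - a X)"
    proof (rule differentiable_bound[where S = "cball 0 ?r"])
      show "(f has_derivative frechet_derivative f (at z)) (at z within cball 0 ?r)" for z
        by (rule has_derivative_at_withinI[OF smooth_has_derivative[OF f(1)]])
      show "onorm (frechet_derivative f (at z)) \<le> K * ?r" if "z \<in> cball 0 ?r" for z
      proof (rule onorm_le)
        fix v
        have "norm (frechet_derivative f (at z) v) \<le> (K * norm z) * norm v"
          using that elim by (intro der) auto
        also have "\<dots> \<le> (K * ?r) * norm v" using that K0 by (intro mult_right_mono mult_left_mono) auto
        finally show "norm (frechet_derivative f (at z) v) \<le> (K * ?r) * norm v" .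
      qed
    qed (auto intro: norm_triangle_ineq)
    also have "\<dots> = K * norm (?r *\<^sub>R b X)" by simp
    also have "\<dots> \<le> K * (D * norm X ^ Suc (Suc m))" using elim(3) K0 by (intro mult_left_mono)
    finally show ?case by (simp add: mult_ac)
  qed
  then show ?thesis by (auto simp: vanish_order_def)
qed

context
  fixes \<sigma> :: "'n::finite \<Rightarrow> 'm::finite \<Rightarrow> 'm"
  assumes \<sigma>: "inj \<sigma>" "map_semigroup \<sigma>"
begin

lemma inputs_frechet_gamma:
  fixes g :: "'a::euclidean_space ^ 'n \<Rightarrow> 'a"
  assumes g: "smooth g"
  shows "inputs (sigma_tilde \<sigma>) j (frechet_derivative (gamma (sigma_tilde \<sigma>) g) (at X) v)
    = frechet_derivative (gamma (sigma_tilde \<sigma>) g) (at (inputs (sigma_tilde \<sigma>) j X)) (inputs (sigma_tilde \<sigma>) j v)"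
proof -
  have "inputs (sigma_tilde \<sigma>) (sigma_tilde \<sigma> k j) x = inputs (sigma_tilde \<sigma>) k (inputs (sigma_tilde \<sigma>) j x)"
    for k and x :: "'a ^ 'n"
    by (simp add: vec_eq_iff sigma_tilde_act[OF \<sigma>])
  then show ?thesis by (subst vec_eq_iff) (simp add: gamma_frechet_derivative[OF g])
qed

lemma eventually_inputs:
  assumes "\<forall>\<^sub>F X in nhds (0::'a::euclidean_space ^ 'n). Q X"
  shows "\<forall>\<^sub>F x in nhds (0::'a ^ 'i::finite). \<forall>i. Q (inputs \<tau> i x)"
proof -
  have "\<forall>\<^sub>F x in nhds (0::'a ^ 'i). Q (inputs \<tau> i x)" for i
    using filterlim_iff[THEN iffD1, OF vanish_order_tendsto[of 0], rule_format, OF _ assms]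
      vanish_order_linear[OF linear_inputs, of \<tau> i] by simp
  then show ?thesis by (rule eventually_all_finite)
qed

text \<open>At X the equation involves h at all points A_j X. For u, the field of h on V^n, it
  becomes u + M u = w with M the derivative of the field of g, a linear equation at each single X.
  With u solved for, h is read off from the original equation; it remains to see that the field of
  this h is u.\<close>

lemma pullback_solution_exists:
  fixes f g :: "'a::euclidean_space ^ 'n \<Rightarrow> 'a"
  assumes f: "smooth f" and g: "smooth g" "vanish_order 2 g"
  obtains h where "pullback_solution \<sigma> f g h"
proof -
  let ?c = "sigma_tilde \<sigma>"
  let ?G = "gamma ?c g"
  define M where "M X = frechet_derivative ?G (at X)" for X
  define w where "w X = gamma ?c f (X + ?G X)" for X
  have sG: "smooth ?G" by (rule smooth_gamma[OF g(1)])
  have s\<Psi>: "smooth (\<lambda>X. X + ?G X)" by (intro smooth_add smooth_id sG)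
  have linM: "linear (M X)" for X unfolding M_def by (rule linear_smooth_frechet[OF sG])
  have "M 0 v = 0" for v
    using vanish_order_2_derivative[OF g]
    by (simp add: M_def vec_eq_iff gamma_frechet_derivative[OF g(1)] linear_0[OF linear_inputs])
  moreover have "smooth (\<lambda>X. M X v)" for v unfolding M_def by (rule smooth_dir_deriv[OF sG])
  moreover have "smooth w" unfolding w_def by (rule smooth_compose[OF smooth_gamma[OF f] s\<Psi>])
  ultimately obtain u e where u: "smooth u" "e > 0" "\<And>X. norm X < e \<Longrightarrow> u X + M X (u X) = w X"
    "\<And>X v. norm X < e \<Longrightarrow> norm (M X v) \<le> norm v / 2"
    using exists_smooth_linear_solution[of M w] linM by blast
  define h where "h X = f (X + ?G X) - frechet_derivative g (at X) (u X)" for X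
  have "smooth h" unfolding h_def
    by (intro smooth_diff smooth_compose[OF f s\<Psi>] smooth_frechet_derivative g u)
  moreover have "\<forall>\<^sub>F X in nhds 0. h X + frechet_derivative g (at X) (gamma ?c h X) = f (X + ?G X)"
    using eventually_small[OF u(2)] eventually_inputs[OF eventually_small[OF u(2)], of ?c]
  proof eventually_elim
    case (elim X)
    \<comment> \<open>Both sides solve v + M Y v = w Y at Y = inputs j X, and M Y has norm at most
      1/2 there, so they coincide.\<close>
    have equiv: "u (inputs ?c j X) = inputs ?c j (u X)" for j
    proof -
      let ?Y = "inputs ?c j X" and ?v = "inputs ?c j (u X)"
      have "w ?Y = inputs ?c j (w X)"
        by (simp add: w_def inputs_gamma[OF sigma_tilde_act[OF \<sigma>]] linear_add[OF linear_inputs])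
      also have "\<dots> = inputs ?c j (u X) + inputs ?c j (M X (u X))"
        unfolding u(3)[OF elim(1), symmetric] by (rule linear_add[OF linear_inputs])
      also have "\<dots> = ?v + M ?Y ?v" unfolding M_def inputs_frechet_gamma[OF g(1)] ..
      finally have "u ?Y + M ?Y (u ?Y) = ?v + M ?Y ?v" using u(3)[of ?Y] elim(2) by simp
      then have "u ?Y - ?v = - M ?Y (u ?Y - ?v)" by (simp add: linear_diff[OF linM] algebra_simps)
      then have "norm (u ?Y - ?v) \<le> norm (u ?Y - ?v) / 2"
        using u(4)[of ?Y "u ?Y - ?v"] elim(2) by (metis norm_minus_cancel)
      then show ?thesis by simp
    qed
    have "gamma ?c h X = u X"
    proof -
      have "gamma ?c h X $ j = u X $ j" for j
      proof -
        have "gamma ?c h X $ j = w X $ j - M X (u X) $ j"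
          by (simp add: h_def equiv w_def M_def gamma_frechet_derivative[OF g(1)]
              linear_add[OF linear_inputs] inputs_gamma[OF sigma_tilde_act[OF \<sigma>]])
        then show ?thesis unfolding u(3)[OF elim(1), symmetric] by simp
      qed
      then show ?thesis by (simp add: vec_eq_iff)
    qed
    then show ?case by (simp add: h_def)
  qed
  ultimately show thesis using that by (simp add: pullback_solution_def)
qed

text \<open>Dg applied to the field of h and f0 applied to the field of g have order 2 because g
  has, so the linear part of f is left unchanged.\<close>

lemma pullback_solution_vanish:
  fixes f g h :: "'a::euclidean_space ^ 'n \<Rightarrow> 'a"
  assumes f: "smooth f" "f 0 = 0" and g: "smooth g" "vanish_order 2 g" and h: "pullback_solution \<sigma> f g h"
  shows "h 0 = 0" "vanish_order 2 (\<lambda>X. h X - taylor_part 0 f X)"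
proof -
  let ?c = "sigma_tilde \<sigma>" and ?f0 = "taylor_part 0 f"
  have g0: "g 0 = 0" by (rule vanish_order_imp_0[OF g(2)]) simp
  have sh: "smooth h" and eq: "\<forall>\<^sub>F X in nhds 0.
      h X + frechet_derivative g (at X) (gamma ?c h X) = f (X + gamma ?c g X)"
    using h by (auto simp: pullback_solution_def)
  have "gamma ?c g 0 = 0" by (simp add: vec_eq_iff linear_0[OF linear_inputs] g0)
  then show h0: "h 0 = 0"
    using eventually_nhds_x_imp_x[OF eq] f(2) vanish_order_2_derivative[OF g] by simp
  have lin: "linear ?f0" by (rule linear_taylor_part_0[OF f(1)])
  note v\<Psi> = vanish_order_near_identity[OF g(2), of ?c]
  have f1: "vanish_order 2 (\<lambda>X. f X - ?f0 X)" by (rule vanish_order_sub_linear_part[OF f])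
  have "vanish_order (1 + 1) (\<lambda>X. frechet_derivative g (at X) (gamma ?c h X))"
    by (intro vanish_order_frechet_apply g vanish_order_frechet_1 vanish_order_gamma vanish_order_1 sh h0)
  then have "vanish_order 2 (\<lambda>X. frechet_derivative g (at X) (gamma ?c h X))" by (simp add: numeral_2_eq_2)
  moreover have "vanish_order 2 (\<lambda>X. ?f0 (gamma ?c g X))"
    using lin by (intro vanish_order_linear_comp[OF _ vanish_order_gamma[OF g(2)]])
      (simp add: linear_conv_bounded_linear)
  ultimately have "vanish_order 2 (\<lambda>X. (f (X + gamma ?c g X) - ?f0 (X + gamma ?c g X)) + ?f0 (gamma ?c g X)
      - frechet_derivative g (at X) (gamma ?c h X))"
    using vanish_order_diff[OF vanish_order_add[OF vanish_order_compose[OF f1 v\<Psi>]]] by blast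
  then show "vanish_order 2 (\<lambda>X. h X - ?f0 X)"
    by (rule vanish_order_cong[rotated])
      (rule eventually_mono[OF eq], simp add: linear_add[OF lin] algebra_simps)
qed

text \<open>Subtracting the equations for h' and h gives \<delta> + Dg \<delta>' = R, where
  \<delta>' is the field of \<delta> = h' - h and R equals \<open>ad f0 p\<close> up to order k + 2.
  Since the derivative of the field of g is small near 0, \<delta>' inherits order k + 1 from R, so
  Dg \<delta>' has order k + 2.\<close>

lemma pullback_solution_step:
  fixes f g h h' p :: "'a::euclidean_space ^ 'n \<Rightarrow> 'a"
  assumes f: "smooth f" "f 0 = 0" and g: "smooth g" "vanish_order 2 g" and h: "pullback_solution \<sigma> f g h"
    and p: "p \<in> P k" "k \<ge> 1" and h': "pullback_solution \<sigma> f (\<lambda>X. g X + p X) h'"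
  shows "vanish_order (Suc (Suc k)) (\<lambda>X. h' X - h X - ad \<sigma> (taylor_part 0 f) p X)"
proof -
  let ?c = "sigma_tilde \<sigma>" and ?f0 = "taylor_part 0 f"
  let ?D = "\<lambda>g X. frechet_derivative g (at X)"
  have lin: "linear ?f0" by (rule linear_taylor_part_0[OF f(1)])
  have sp: "smooth p" by (rule P_smooth[OF p(1)])
  have sf0: "smooth ?f0" by (rule smooth_linear[OF lin])
  have vp: "vanish_order (Suc k) p"
    by (rule vanish_order_homogeneous[OF P_D(2)[OF p(1)] smooth_continuous_on[OF sp]])
  then have vp2: "vanish_order 2 p" using p(2) by (rule_tac vanish_order_mono) auto
  have vDp: "vanish_order k (\<lambda>X. ?D p X b)" for b
    by (rule vanish_order_homogeneous[OF frechet_derivative_homogeneous[OF sp P_D(2)[OF p(1)]]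
          smooth_continuous_on[OF smooth_dir_deriv[OF sp]]])
  have sgp: "smooth (\<lambda>X. g X + p X)" and vgp: "vanish_order 2 (\<lambda>X. g X + p X)"
    using smooth_add[OF g(1) sp] vanish_order_add[OF g(2) vp2] by auto
  note v\<Psi> = vanish_order_near_identity[OF g(2), of ?c]
  define \<delta> where "\<delta> X = h' X - h X" for X
  define R where "R X = f (X + gamma ?c g X + gamma ?c p X) - f (X + gamma ?c g X) - ?D p X (gamma ?c h' X)" for X
  have sh: "smooth h" "smooth h'" using h h' by (auto simp: pullback_solution_def)
  have gam_add: "gamma ?c (\<lambda>X. g X + p X) X = gamma ?c g X + gamma ?c p X"
    "gamma ?c h' X = gamma ?c h X + gamma ?c \<delta> X" for X
    by (simp_all add: vec_eq_iff \<delta>_def)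
  have lD: "linear (?D g X)" "linear (?D p X)" for X using g(1) sp by (auto intro: linear_smooth_frechet)
  have "\<forall>\<^sub>F X in nhds 0. h X + ?D g X (gamma ?c h X) = f (X + gamma ?c g X)"
    "\<forall>\<^sub>F X in nhds 0. h' X + ?D (\<lambda>X. g X + p X) X (gamma ?c h' X) = f (X + gamma ?c (\<lambda>X. g X + p X) X)"
    using h h' by (auto simp: pullback_solution_def)
  then have eq: "\<forall>\<^sub>F X in nhds 0. \<delta> X + ?D g X (gamma ?c \<delta> X) = R X"
  proof eventually_elim
    case (elim X)
    have "?D (\<lambda>X. g X + p X) X (gamma ?c h' X) = ?D g X (gamma ?c h' X) + ?D p X (gamma ?c h' X)"
      by (rule frechet_derivative_add[OF smooth_differentiable[OF g(1)] smooth_differentiable[OF sp]])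
    moreover have "?D g X (gamma ?c h' X) = ?D g X (gamma ?c h X) + ?D g X (gamma ?c \<delta> X)"
      unfolding gam_add by (rule linear_add[OF lD(1)])
    moreover have "f (X + gamma ?c g X + gamma ?c p X) = h' X + ?D (\<lambda>X. g X + p X) X (gamma ?c h' X)"
      using elim(2) by (simp add: gam_add(1) add.assoc)
    ultimately show ?case unfolding R_def elim(1)[symmetric] by (simp add: \<delta>_def)
  qed
  have sf1: "smooth (\<lambda>X. f X - ?f0 X)" by (intro smooth_diff f sf0)
  have f1: "vanish_order 2 (\<lambda>X. f X - ?f0 X)" by (rule vanish_order_sub_linear_part[OF f])
  have vDp': "vanish_order (k + 2) (\<lambda>X. ?D p X (gamma ?c (\<lambda>X. h' X - ?f0 X) X))"
    by (intro vanish_order_frechet_apply sp vDp vanish_order_gamma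
        pullback_solution_vanish(2)[OF f sgp vgp h'])
  \<comment> \<open>Split f into f0 and a remainder of order 2. The f0 part contributes f0 applied
    to the field of p, the remainder changes only by order k + 2, and in Dp the field of h' may be
    replaced by that of f0 with an error of the same order.\<close>
  have RA: "vanish_order (Suc (Suc k)) (\<lambda>X. R X - ad \<sigma> ?f0 p X)"
  proof -
    have e: "gamma ?c (\<lambda>X. h' X - ?f0 X) X = gamma ?c h' X - gamma ?c ?f0 X" for X by (simp add: vec_eq_iff)
    have "R X - ad \<sigma> ?f0 p X
      = ((f (X + gamma ?c g X + gamma ?c p X) - ?f0 (X + gamma ?c g X + gamma ?c p X))
          - (f (X + gamma ?c g X) - ?f0 (X + gamma ?c g X))) - ?D p X (gamma ?c (\<lambda>X. h' X - ?f0 X) X)" for X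
      by (simp add: R_def ad_eq[OF sf0 sp] frechet_derivative_linear[OF lin] linear_add[OF lin]
          e linear_diff[OF lD(2)])
    then show ?thesis
      using vanish_order_diff[OF vanish_order_increment[OF sf1 f1 v\<Psi> vanish_order_gamma[OF vp]]] vDp'
      by simp
  qed
  have "ad \<sigma> ?f0 p \<in> P k" by (rule ad_in_P[OF lin p(1)])
  then have "vanish_order (Suc k) (ad \<sigma> ?f0 p)"
    using smooth_continuous_on[OF P_smooth] P_D(2) by (intro vanish_order_homogeneous) blast+
  from vanish_order_add[OF vanish_order_mono[OF RA] this]
  have vR: "vanish_order (Suc k) R" by simp
  have sG: "smooth (gamma ?c g)" by (rule smooth_gamma[OF g(1)])
  \<comment> \<open>Applied with right-hand side 0, solely for the bound on the operator near
    0.\<close>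
  obtain e where e: "e > 0" "\<And>X v. norm X < e \<Longrightarrow> norm (?D (gamma ?c g) X v) \<le> norm v / 2"
  proof (rule exists_smooth_linear_solution[of "?D (gamma ?c g)" "\<lambda>X. 0"])
    show "linear (?D (gamma ?c g) X)" for X by (rule linear_smooth_frechet[OF sG])
    show "smooth (\<lambda>X. ?D (gamma ?c g) X v)" for v by (rule smooth_dir_deriv[OF sG])
    show "?D (gamma ?c g) 0 v = 0" for v
      using vanish_order_2_derivative[OF g]
      by (simp add: vec_eq_iff gamma_frechet_derivative[OF g(1)] linear_0[OF linear_inputs])
  qed (use that in auto)
  obtain C where C: "C \<ge> 0" "\<forall>\<^sub>F X in nhds 0. norm (gamma ?c R X) \<le> C * norm X ^ Suc k"
    using vanish_order_gamma[OF vR] by (blast elim: vanish_orderE)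
  have "\<forall>\<^sub>F X in nhds 0. norm (gamma ?c \<delta> X) \<le> (2 * C) * norm X ^ Suc k"
    using C(2) eventually_small[OF e(1)] eventually_inputs[OF eq, of ?c]
  proof eventually_elim
    case (elim X)
    have "gamma ?c R X = gamma ?c \<delta> X + ?D (gamma ?c g) X (gamma ?c \<delta> X)"
      using elim(3) by (simp add: vec_eq_iff gamma_frechet_derivative[OF g(1)]
          inputs_gamma[OF sigma_tilde_act[OF \<sigma>]])
    then have "norm (gamma ?c \<delta> X) \<le> norm (gamma ?c R X) + norm (?D (gamma ?c g) X (gamma ?c \<delta> X))"
      using norm_triangle_ineq4[of "gamma ?c R X" "?D (gamma ?c g) X (gamma ?c \<delta> X)"] by simp
    with e(2)[OF elim(2), of "gamma ?c \<delta> X"] elim(1) show ?case by simp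
  qed
  then have "vanish_order (Suc k) (gamma ?c \<delta>)" by (auto simp: vanish_order_def)
  then have "vanish_order (1 + Suc k) (\<lambda>X. ?D g X (gamma ?c \<delta> X))"
    by (intro vanish_order_frechet_apply g vanish_order_frechet_1)
  then have "vanish_order (Suc (Suc k)) (\<lambda>X. (R X - ad \<sigma> ?f0 p X) - ?D g X (gamma ?c \<delta> X))"
    using vanish_order_diff[OF RA] by simp
  then show ?thesis
    by (rule vanish_order_cong[rotated])
      (rule eventually_mono[OF eq], simp add: \<delta>_def algebra_simps)
qed

text \<open>The equation constrains h only near 0, which suffices for its Taylor parts; the
  statement therefore speaks of every solution. In the induction, part r + 1 of h is n + ad f0 q,
  and adding p = - q to g cancels the second summand.\<close>

lemma normal_form_generator:
  fixes f :: "'a::euclidean_space ^ 'n \<Rightarrow> 'a"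
  assumes f: "smooth f" "f 0 = 0"
    and N: "\<And>k. k \<ge> 1 \<Longrightarrow> is_direct_sum (Nf k) (ad \<sigma> (taylor_part 0 f) ` P k) (P k)"
  shows "\<exists>g. polynomial_function g \<and> vanish_order 2 g \<and> (\<forall>h. pullback_solution \<sigma> f g h \<longrightarrow>
    taylor_part 0 h = taylor_part 0 f \<and> (\<forall>k\<in>{1..r}. taylor_part k h \<in> Nf k))"
proof (induction r)
  case 0
  have pol: "polynomial_function (\<lambda>X. 0 :: 'a)" by simp
  have "taylor_part 0 h = taylor_part 0 f" if h: "pullback_solution \<sigma> f (\<lambda>X. 0) h" for h
  proof (rule taylor_part_unique[where n = 1 and p = "\<lambda>k. taylor_part k f"])
    show "smooth h" using h by (simp add: pullback_solution_def)
    note v = pullback_solution_vanish[OF f smooth_const vanish_order_zero h]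
    show "h 0 = 0" by (rule v)
    show "vanish_order (Suc 1) (\<lambda>x. h x - (\<Sum>k<1. taylor_part k f x))"
      using v(2) by (simp add: numeral_2_eq_2)
  qed (auto intro: taylor_part_in_P f)
  then show ?case using pol by (intro exI[of _ "\<lambda>X. 0"]) auto
next
  case (Suc r)
  let ?f0 = "taylor_part 0 f"
  have lin: "linear ?f0" by (rule linear_taylor_part_0[OF f(1)])
  obtain g where g: "polynomial_function g" "vanish_order 2 g" and gh: "\<And>h. pullback_solution \<sigma> f g h \<Longrightarrow>
      taylor_part 0 h = ?f0 \<and> (\<forall>k\<in>{1..r}. taylor_part k h \<in> Nf k)"
    using Suc by blast
  have sg: "smooth g" by (rule smooth_polynomial_function[OF g(1)])
  obtain h where h: "pullback_solution \<sigma> f g h" using pullback_solution_exists[OF f(1) sg g(2)] .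
  have sh: "smooth h" using h by (simp add: pullback_solution_def)
  have h0: "h 0 = 0" by (rule pullback_solution_vanish(1)[OF f sg g(2) h])
  have "taylor_part (Suc r) h \<in> {u + v |u v. u \<in> Nf (Suc r) \<and> v \<in> ad \<sigma> ?f0 ` P (Suc r)}"
    using N[of "Suc r"] taylor_part_in_P[OF sh, of "Suc r"] by (simp add: is_direct_sum_def)
  then obtain n q where nq: "n \<in> Nf (Suc r)" "q \<in> P (Suc r)" "taylor_part (Suc r) h = n + ad \<sigma> ?f0 q"
    by blast
  define p where "p = (- 1) *\<^sub>R q"
  have p: "p \<in> P (Suc r)" unfolding p_def by (rule subspace_scale[OF P_subspace nq(2)])
  have adp: "ad \<sigma> ?f0 p = (- 1) *\<^sub>R ad \<sigma> ?f0 q"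
    unfolding p_def by (rule ad_linear_right(2)[OF lin P_smooth[OF nq(2)] P_smooth[OF nq(2)]])
  have sp: "smooth p" by (rule P_smooth[OF p])
  have vp: "vanish_order 2 p"
    by (rule vanish_order_mono[OF vanish_order_homogeneous[OF P_D(2)[OF p] smooth_continuous_on[OF sp]]]) simp
  let ?g = "\<lambda>X. g X + p X"
  have g': "polynomial_function ?g" "vanish_order 2 ?g" "smooth ?g"
    using g vp P_D(1)[OF p] smooth_add[OF sg sp] by (auto intro: vanish_order_add)
  have "taylor_part 0 h' = ?f0 \<and> (\<forall>k\<in>{1..Suc r}. taylor_part k h' \<in> Nf k)"
    if h': "pullback_solution \<sigma> f ?g h'" for h'
  proof -
    \<comment> \<open>The expected Taylor parts of h': those of h up to r, then n.\<close>
    define t where "t j = (if j = Suc r then n else taylor_part j h)" for j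
    have "taylor_part j h' = t j" if "j < Suc (Suc r)" for j
    proof (rule taylor_part_unique[where n = "Suc (Suc r)" and p = t])
      show "smooth h'" using h' by (simp add: pullback_solution_def)
      show "h' 0 = 0" by (rule pullback_solution_vanish(1)[OF f g'(3,2) h'])
      have "n = taylor_part (Suc r) h + ad \<sigma> ?f0 p" using nq(3) adp by simp
      then have n_eq: "n x = taylor_part (Suc r) h x + ad \<sigma> ?f0 p x" for x by simp
      have "n \<in> P (Suc r)"
        using \<open>n = _\<close> subspace_add[OF P_subspace taylor_part_in_P[OF sh] ad_in_P[OF lin p]] by simp
      then show "t k \<in> P k" for k using taylor_part_in_P[OF sh] by (simp add: t_def)
      have "(\<Sum>k<Suc (Suc r). t k x) = (\<Sum>k<Suc (Suc r). taylor_part k h x) + ad \<sigma> ?f0 p x" for x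
        by (simp add: t_def n_eq)
      then have e: "(\<lambda>x. h' x - (\<Sum>k<Suc (Suc r). t k x))
          = (\<lambda>x. (h' x - h x - ad \<sigma> ?f0 p x) + (h x - (\<Sum>k<Suc (Suc r). taylor_part k h x)))"
        by (intro ext) (simp del: sum.lessThan_Suc)
      have "Suc r \<ge> 1" by simp
      then show "vanish_order (Suc (Suc (Suc r))) (\<lambda>x. h' x - (\<Sum>k<Suc (Suc r). t k x))"
        unfolding e by (intro vanish_order_add pullback_solution_step[OF f sg g(2) h p _ h']
            taylor_expansion[OF sh h0])
      show "j < Suc (Suc r)" by fact
    qed
    then show ?thesis using gh[OF h] nq(1) by (auto simp: t_def le_Suc_eq)
  qed
  with g' show ?case by (intro exI[of _ ?g]) auto
qed

end

subsection \<open>The conjugacy and the symmetry of the truncated normal form\<close>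

lemma real_analytic_on_cong:
  fixes F G :: "'a::real_normed_vector \<Rightarrow> 'b::real_normed_vector"
  assumes W: "open W" and eq: "\<And>x. x \<in> W \<Longrightarrow> F x = G x" and F: "real_analytic_on F W"
  shows "real_analytic_on G W"
  unfolding real_analytic_on_def
proof
  fix a assume a: "a \<in> W"
  obtain e p where e: "e > 0" "\<And>k. homogeneous_polynomial k (p k)"
    "uniform_limit (ball 0 e) (\<lambda>n h. \<Sum>k<n. p k h) (\<lambda>h. F (a + h)) sequentially"
    using F a unfolding real_analytic_on_def by blast
  obtain d where d: "d > 0" "ball a d \<subseteq> W" using W a openE by blast
  have "uniform_limit (ball 0 (min d e)) (\<lambda>n h. \<Sum>k<n. p k h) (\<lambda>h. F (a + h)) sequentially"
    by (rule uniform_limit_on_subset[OF e(3)]) auto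
  moreover have "F (a + h) = G (a + h)" if "h \<in> ball 0 (min d e)" for h
    using that d(2) by (intro eq) (auto simp: dist_norm)
  ultimately have "uniform_limit (ball 0 (min d e)) (\<lambda>n h. \<Sum>k<n. p k h) (\<lambda>h. G (a + h)) sequentially"
    by (simp add: uniform_limit_iff)
  then show "\<exists>e>0. \<exists>p. (\<forall>k. homogeneous_polynomial k (p k)) \<and>
      uniform_limit (ball 0 e) (\<lambda>n h. \<Sum>k<n. p k h) (\<lambda>h. G (a + h)) sequentially"
    using d(1) e(1,2) by (intro exI[of _ "min d e"] conjI exI[of _ p]) auto
qed

text \<open>The curve Y (exp_map t S x) solves the linear differential equation of S with initial
  value Y x, and such solutions are unique.\<close>

lemma commutes_with_flow:
  fixes S Y :: "'w::euclidean_space \<Rightarrow> 'w"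
  assumes S: "linear S" and Y: "smooth Y" and eq: "\<And>x. frechet_derivative Y (at x) (S x) = S (Y x)"
  shows "Y (exp_map t S x) = exp_map t S (Y x)"
proof (rule exp_map_flow_unique[OF S, of "\<lambda>t. Y (exp_map t S x)"])
  show "Y (exp_map 0 S x) = Y x" by (simp add: exp_map_flow(1)[OF S])
  fix t
  have "((\<lambda>t. Y (exp_map t S x)) has_derivative
      (\<lambda>h. frechet_derivative Y (at (exp_map t S x)) (h *\<^sub>R S (exp_map t S x)))) (at t)"
    using exp_map_flow(2)[OF S, of x t] unfolding has_vector_derivative_def
    by (rule has_derivative_compose[OF _ smooth_has_derivative[OF Y]])
  then show "((\<lambda>t. Y (exp_map t S x)) has_vector_derivative S (Y (exp_map t S x))) (at t)"
    unfolding has_vector_derivative_def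
    by (simp add: linear_scale[OF linear_smooth_frechet[OF Y]] eq)
qed

lemma gamma_smooth_frechet_sum:
  fixes t :: "nat \<Rightarrow> 'a::euclidean_space ^ 'n::finite \<Rightarrow> 'a" and \<sigma> :: "'n \<Rightarrow> 'm::finite \<Rightarrow> 'm"
  assumes t: "\<And>k. k \<le> r \<Longrightarrow> smooth (t k)" and S: "linear S"
    and eq: "\<And>k x. k \<le> r \<Longrightarrow> frechet_derivative (gamma \<sigma> (t k)) (at x) (S x) = S (gamma \<sigma> (t k) x)"
  shows "frechet_derivative (gamma \<sigma> (\<lambda>X. \<Sum>k\<le>r. t k X)) (at x) (S x) = S (gamma \<sigma> (\<lambda>X. \<Sum>k\<le>r. t k X) x)"
proof -
  have g: "gamma \<sigma> (\<lambda>X. \<Sum>k\<le>r. t k X) = (\<lambda>x. \<Sum>k\<le>r. gamma \<sigma> (t k) x)"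
    by (simp add: fun_eq_iff vec_eq_iff)
  have "((\<lambda>x. \<Sum>k\<le>r. gamma \<sigma> (t k) x) has_derivative
      (\<lambda>v. \<Sum>k\<le>r. frechet_derivative (gamma \<sigma> (t k)) (at x) v)) (at x)"
    using t by (intro has_derivative_sum smooth_has_derivative smooth_gamma) auto
  then have "frechet_derivative (\<lambda>x. \<Sum>k\<le>r. gamma \<sigma> (t k) x) (at x) (S x)
      = (\<Sum>k\<le>r. frechet_derivative (gamma \<sigma> (t k)) (at x) (S x))"
    by (simp add: frechet_derivative_at[symmetric])
  then show ?thesis unfolding g by (simp add: eq linear_sum[OF S])
qed

text \<open>The map \<Psi> = id + gamma g has derivative id at 0 and pulls gamma f back to gamma h;
  its local inverse \<Phi> therefore carries gamma f to gamma h.\<close>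

lemma near_identity_conjugacy:
  fixes \<sigma> :: "'n::finite \<Rightarrow> 'm::finite \<Rightarrow> 'm" and f g h :: "'a::euclidean_space ^ 'n \<Rightarrow> 'a"
  assumes \<sigma>: "inj \<sigma>" "map_semigroup \<sigma>" and g: "polynomial_function g" "vanish_order 2 g"
    and h: "pullback_solution \<sigma> f g h"
  shows "\<exists>(\<Phi> :: 'a ^ 'm \<Rightarrow> 'a ^ 'm) U W. 0 \<in> U \<and> 0 \<in> W \<and> analytic_diffeomorphism \<Phi> U W \<and> \<Phi> 0 = 0 \<and>
    conjugates_vector_field \<Phi> U (gamma \<sigma> f) (gamma \<sigma> h)"
proof -
  let ?c = "sigma_tilde \<sigma>"
  define \<Psi> :: "'a ^ 'm \<Rightarrow> 'a ^ 'm" where "\<Psi> x = x + gamma \<sigma> g x" for x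
  have sg: "smooth g" by (rule smooth_polynomial_function[OF g(1)])
  have p\<Psi>: "polynomial_function \<Psi>"
    unfolding \<Psi>_def by (intro polynomial_function_add polynomial_gamma g
        polynomial_function_bounded_linear bounded_linear_ident)
  have s\<Psi>: "smooth \<Psi>" by (rule smooth_polynomial_function[OF p\<Psi>])
  define D where "D x = frechet_derivative \<Psi> (at x)" for x
  have D: "D x v = v + frechet_derivative (gamma \<sigma> g) (at x) v" for x v
  proof -
    have "(\<Psi> has_derivative (\<lambda>v. v + frechet_derivative (gamma \<sigma> g) (at x) v)) (at x)"
      unfolding \<Psi>_def
      by (intro has_derivative_add has_derivative_ident smooth_has_derivative smooth_gamma sg)
    then show ?thesis by (simp add: D_def frechet_derivative_at[symmetric])
  qed
  have g0: "g 0 = 0" by (rule vanish_order_imp_0[OF g(2)]) simp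
  have \<Psi>0: "\<Psi> 0 = 0" by (simp add: \<Psi>_def vec_eq_iff linear_0[OF linear_inputs] g0)
  have D0: "D 0 v = v" for v
    unfolding D using vanish_order_2_derivative[OF sg g(2)]
    by (simp add: vec_eq_iff gamma_frechet_derivative[OF sg] linear_0[OF linear_inputs])
  have "\<forall>\<^sub>F X in nhds 0. h X + frechet_derivative g (at X) (gamma ?c h X) = f (X + gamma ?c g X)"
    using h by (simp add: pullback_solution_def)
  from eventually_inputs[OF \<sigma> this, of \<sigma>] obtain V0 where V0: "open V0" "(0::'a ^ 'm) \<in> V0"
    and eq: "\<And>x i. x \<in> V0 \<Longrightarrow> h (inputs \<sigma> i x) + frechet_derivative g (at (inputs \<sigma> i x))
        (gamma ?c h (inputs \<sigma> i x)) = f (inputs \<sigma> i x + gamma ?c g (inputs \<sigma> i x))"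
    unfolding eventually_nhds by blast
  \<comment> \<open>The i-th component is the equation for h at the inputs of cell i, with
    \<open>inputs_gamma\<close> translating between V^N and V^n.\<close>
  have pull: "D x (gamma \<sigma> h x) = gamma \<sigma> f (\<Psi> x)" if "x \<in> V0" for x
    using eq[OF that]
    by (simp add: D vec_eq_iff gamma_frechet_derivative[OF sg] inputs_gamma[OF sigma_act[OF \<sigma>]]
        \<Psi>_def linear_add[OF linear_inputs])
  have bD: "bounded_linear (D x)" for x
    unfolding D_def using linear_smooth_frechet[OF s\<Psi>] by (simp add: linear_conv_bounded_linear)
  define D' where "D' x = Blinfun (D x)" for x
  have D'_apply: "blinfun_apply (D' x) = D x" for x
    unfolding D'_def by (rule bounded_linear_Blinfun_apply[OF bD])
  have D'_cont: "continuous_on V0 D'"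
    by (rule continuous_on_blinfun_componentwise)
      (simp add: D'_apply D_def smooth_continuous_on[OF smooth_dir_deriv[OF s\<Psi>]])
  have D'_der: "(\<Psi> has_derivative blinfun_apply (D' x)) (at x)" for x
    unfolding D'_apply D_def by (rule smooth_has_derivative[OF s\<Psi>])
  have "id_blinfun o\<^sub>L D' 0 = id_blinfun"
    by (rule blinfun_eqI) (simp add: D'_apply D0)
  \<comment> \<open>The derivative at 0 is the identity and serves as its own inverse. Working
    inside V0 keeps the values of \<Phi> where \<open>pull\<close> holds.\<close>
  from inverse_function_theorem[OF V0(1) D'_der D'_cont V0(2) this]
  obtain W U \<Phi> \<Phi>' where W: "open W" "W \<subseteq> V0" "0 \<in> W" and U: "open U" "\<Psi> 0 \<in> U"
    and hom: "homeomorphism W U \<Psi> \<Phi>" and \<Phi>': "\<And>y. y \<in> U \<Longrightarrow> (\<Phi> has_derivative \<Phi>' y) (at y)"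
    "\<And>y. y \<in> U \<Longrightarrow> \<Phi>' y = inv (blinfun_apply (D' (\<Phi> y)))"
    and bij: "\<And>y. y \<in> U \<Longrightarrow> bij (blinfun_apply (D' (\<Phi> y)))"
    by metis
  have \<Phi>\<Psi>: "\<Phi> (\<Psi> x) = x" "\<Psi> x \<in> U" if "x \<in> W" for x using hom that by (auto simp: homeomorphism_def)
  have \<Psi>\<Phi>: "\<Psi> (\<Phi> y) = y" "\<Phi> y \<in> W" if "y \<in> U" for y using hom that by (auto simp: homeomorphism_def)
  have bij_UW: "bij_betw \<Phi> U W" by (rule bij_betw_byWitness[where f' = \<Psi>]) (use \<Phi>\<Psi> \<Psi>\<Phi> in auto)
  have "real_analytic_on \<Phi> U"
    unfolding real_analytic_on_def
  proof
    fix y assume y: "y \<in> U"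
    have "bij (frechet_derivative \<Psi> (at (\<Phi> y)))" using bij[OF y] by (simp add: D'_apply D_def)
    from analytic_local_inverse[OF p\<Psi> this W(1) \<Psi>\<Phi>(2)[OF y] \<Phi>\<Psi>(1)]
    show "\<exists>e>0. \<exists>p. (\<forall>k. homogeneous_polynomial k (p k)) \<and>
        uniform_limit (ball 0 e) (\<lambda>n h. \<Sum>k<n. p k h) (\<lambda>h. \<Phi> (y + h)) sequentially"
      by (simp add: \<Psi>\<Phi>(1)[OF y])
  qed
  moreover have "real_analytic_on (inv_into U \<Phi>) W"
  proof (rule real_analytic_on_cong[OF W(1) _ real_analytic_polynomial[OF p\<Psi>]])
    fix x assume x: "x \<in> W"
    then show "\<Psi> x = inv_into U \<Phi> x"
      using inv_into_f_f[OF bij_betw_imp_inj_on[OF bij_UW] \<Phi>\<Psi>(2)[OF x]] \<Phi>\<Psi>(1)[OF x] by simp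
  qed
  ultimately have "analytic_diffeomorphism \<Phi> U W"
    using U W bij_UW by (simp add: analytic_diffeomorphism_def)
  moreover have "conjugates_vector_field \<Phi> U (gamma \<sigma> f) (gamma \<sigma> h)"
    unfolding conjugates_vector_field_def
  proof
    fix y assume y: "y \<in> U"
    have "frechet_derivative \<Phi> (at y) = inv (D (\<Phi> y))"
      using frechet_derivative_at[OF \<Phi>'(1)[OF y]] \<Phi>'(2)[OF y] by (simp add: D'_apply)
    moreover have "gamma \<sigma> f y = D (\<Phi> y) (gamma \<sigma> h (\<Phi> y))"
      using pull[of "\<Phi> y"] \<Psi>\<Phi>[OF y] W(2) by auto
    moreover have "inj (D (\<Phi> y))" using bij[OF y] by (simp add: D'_apply bij_def)
    ultimately show "frechet_derivative \<Phi> (at y) (gamma \<sigma> f y) = gamma \<sigma> h (\<Phi> y)" by simp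
  qed
  moreover have "0 \<in> U" "\<Phi> 0 = 0" using U(2) \<Phi>\<Psi>(1)[OF W(3)] by (simp_all add: \<Psi>0)
  ultimately show ?thesis using W(3) by blast
qed

theorem corollary9p5:
  fixes \<sigma> :: "'n::finite \<Rightarrow> 'm::finite \<Rightarrow> 'm"
    and f f0S :: "'a::euclidean_space ^ 'n \<Rightarrow> 'a"
    and r :: nat
  assumes "inj \<sigma>"
    and "map_semigroup \<sigma>"
    and "smooth f"
    and "f 0 = 0"
    and "linear f0S"
    and "is_semisimple_part (gamma \<sigma> (taylor_part 0 f)) (gamma \<sigma> f0S)"
  shows "\<exists>Nf :: nat \<Rightarrow> ('a ^ 'n \<Rightarrow> 'a) set.
    (\<forall>k\<in>{1..r}. subspace (Nf k) \<and> Nf k \<subseteq> P k \<and>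
        is_direct_sum (Nf k) (ad \<sigma> (taylor_part 0 f) ` P k) (P k)) \<and>
    (\<exists>(fbar :: 'a ^ 'n \<Rightarrow> 'a) (\<Phi> :: 'a ^ 'm \<Rightarrow> 'a ^ 'm) U W.
        smooth fbar \<and> fbar 0 = 0 \<and>
        taylor_part 0 fbar = taylor_part 0 f \<and>
        (\<forall>k\<in>{1..r}. taylor_part k fbar \<in> Nf k) \<and>
        0 \<in> U \<and> 0 \<in> W \<and> analytic_diffeomorphism \<Phi> U W \<and> \<Phi> 0 = 0 \<and>
        conjugates_vector_field \<Phi> U (gamma \<sigma> f) (gamma \<sigma> fbar) \<and>
        (\<forall>t x. gamma \<sigma> (\<lambda>X. \<Sum>k\<le>r. taylor_part k fbar X) (exp_map t (gamma \<sigma> f0S) x)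
             = exp_map t (gamma \<sigma> f0S) (gamma \<sigma> (\<lambda>X. \<Sum>k\<le>r. taylor_part k fbar X) x)))"
proof -
  note \<sigma> = assms(1,2) and f = assms(3,4) and ss = assms(6)
  let ?f0 = "taylor_part 0 f" and ?S = "gamma \<sigma> f0S"
  let ?A = "gamma \<sigma> ?f0"
  have lin: "linear ?f0" by (rule linear_taylor_part_0[OF f(1)])
  \<comment> \<open>Besides being a complement, N is annihilated by a power of \<open>ad f0\<close>,
    with an exponent that may depend on k; the symmetry is derived from this property.\<close>
  have "\<forall>k. \<exists>N. (\<exists>m. \<forall>x\<in>N. (ad \<sigma> ?f0 ^^ m) x = 0) \<and> subspace N \<and> N \<subseteq> P k \<and>
      is_direct_sum N (ad \<sigma> ?f0 ` P k) (P k)"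
  proof
    fix k
    obtain B :: "('a ^ 'n \<Rightarrow> 'a) set" where B: "finite B" "P k \<subseteq> span B" by (rule P_finite_span)
    show "\<exists>N. (\<exists>m. \<forall>x\<in>N. (ad \<sigma> ?f0 ^^ m) x = 0) \<and> subspace N \<and> N \<subseteq> P k \<and>
        is_direct_sum N (ad \<sigma> ?f0 ` P k) (P k)"
      by (rule fitting_complement[OF P_subspace B(2,1), of "ad \<sigma> ?f0"])
        (auto intro: ad_in_P[OF lin] ad_linear_right[OF lin P_smooth P_smooth])
  qed
  from choice[OF this] obtain Nf where Nf:
    "\<And>k. \<exists>m. \<forall>x\<in>Nf k. (ad \<sigma> ?f0 ^^ m) x = 0" "\<And>k. subspace (Nf k)" "\<And>k. Nf k \<subseteq> P k"
    "\<And>k. is_direct_sum (Nf k) (ad \<sigma> ?f0 ` P k) (P k)"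
    by auto
  obtain g where g: "polynomial_function g" "vanish_order 2 g" and gh: "\<And>h. pullback_solution \<sigma> f g h \<Longrightarrow>
      taylor_part 0 h = ?f0 \<and> (\<forall>k\<in>{1..r}. taylor_part k h \<in> Nf k)"
    using normal_form_generator[OF \<sigma> f Nf(4), of r] by blast
  have sg: "smooth g" by (rule smooth_polynomial_function[OF g(1)])
  obtain h where h: "pullback_solution \<sigma> f g h" using pullback_solution_exists[OF \<sigma> f(1) sg g(2)] .
  have sh: "smooth h" using h by (simp add: pullback_solution_def)
  have h0: "h 0 = 0" by (rule pullback_solution_vanish(1)[OF \<sigma> f sg g(2) h])
  have T: "taylor_part 0 h = ?f0" "\<And>k. k \<in> {1..r} \<Longrightarrow> taylor_part k h \<in> Nf k" using gh[OF h] by auto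
  obtain \<Phi> :: "'a ^ 'm \<Rightarrow> 'a ^ 'm" and U W where conj: "0 \<in> U" "0 \<in> W" "analytic_diffeomorphism \<Phi> U W"
    "\<Phi> 0 = 0" "conjugates_vector_field \<Phi> U (gamma \<sigma> f) (gamma \<sigma> h)"
    using near_identity_conjugacy[OF \<sigma> g h] by blast
  obtain TT where TT: "semisimple_map ?S" "nilpotent_map TT" "\<And>x. ?A x = ?S x + TT x" "?S \<circ> TT = TT \<circ> ?S"
    using ss by (auto simp: is_semisimple_part_def)
  have lS: "linear ?S" using TT(1) by (simp add: semisimple_map_def)
  have stp: "smooth (taylor_part k h)" for k by (rule P_smooth[OF taylor_part_in_P[OF sh]])
  have "frechet_derivative (gamma \<sigma> (taylor_part k h)) (at x) (?S x) = ?S (gamma \<sigma> (taylor_part k h) x)"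
    if k: "k \<le> r" for k x
  proof (cases "k = 0")
    case True
    \<comment> \<open>The linear part belongs to no chosen complement; it commutes with S because S
      commutes with both summands of A = S + T.\<close>
    have "?A (?S x) = ?S (?A x)"
      unfolding TT(3) linear_add[OF lS] using fun_cong[OF TT(4), of x] by simp
    then show ?thesis by (simp add: True T(1) frechet_derivative_linear[OF linear_gamma[OF lin]])
  next
    case False
    with k have Nk: "taylor_part k h \<in> Nf k" by (intro T(2)) auto
    obtain m where "(ad \<sigma> ?f0 ^^ m) (taylor_part k h) = 0" using Nf(1) Nk by blast
    \<comment> \<open>\<open>gamma\<close> carries powers of \<open>ad f0\<close> to powers of the
      bracket with A, so the generalized kernel on the level of response maps goes into that on
      V^N.\<close>
    then have "(bracket ?A ^^ m) (gamma \<sigma> (taylor_part k h)) = gamma \<sigma> 0"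
      using gamma_ad_pow[OF \<sigma> lin taylor_part_in_P[OF sh], of m k] by simp
    also have "\<dots> = (\<lambda>x. 0)" by (simp add: fun_eq_iff vec_eq_iff)
    finally show ?thesis
      by (rule semisimple_part_bracket[OF ss polynomial_gamma[OF P_D(1)[OF taylor_part_in_P[OF sh]]]])
  qed
  then have "frechet_derivative (gamma \<sigma> (\<lambda>X. \<Sum>k\<le>r. taylor_part k h X)) (at x) (?S x)
      = ?S (gamma \<sigma> (\<lambda>X. \<Sum>k\<le>r. taylor_part k h X) x)" for x
    by (intro gamma_smooth_frechet_sum stp lS)
  then have "gamma \<sigma> (\<lambda>X. \<Sum>k\<le>r. taylor_part k h X) (exp_map t ?S x)
      = exp_map t ?S (gamma \<sigma> (\<lambda>X. \<Sum>k\<le>r. taylor_part k h X) x)" for t x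
    by (intro commutes_with_flow lS smooth_gamma smooth_sum stp) auto
  then show ?thesis
    using Nf(2-4) sh h0 T conj by (intro exI[of _ Nf] conjI ballI exI[of _ h] exI[of _ \<Phi>] exI[of _ U] exI[of _ W]) auto
qed

end
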